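(* Let $\mathcal P$ be a pasting scheme with atomic 2-cells $\gamma_1,\dots,\gamma_n$. Then the hom-category $\mathfrak F\mathcal P(s_{\mathcal P},t_{\mathcal P})$ is isomorphic to the full subposet $P^{\ge}$ of the cube $\{0\le 1\}^{\{\gamma_1,\dots,\gamma_n\}}$ consisting of those functions $f$ with $f(\gamma_i)\ge f(\gamma_j)$ whenever $\gamma_i$ lies directly above $\gamma_j$. Explicitly, a path $p$ from $s_{\mathcal P}$ to $t_{\mathcal P}$ corresponds to the function assigning $1$ to the atomic 2-cells lying above $p$ (in the region bounded by $p$ and $\mathrm{dom}_{\mathcal P}$) and $0$ to those lying below $p$.
   Context: A plane graph is a finite connected directed graph $G$ with an embedding in the plane $\mathbb C$. Its faces are the closures of the connected components of $\mathbb C\setminus G$; the unbounded one is the exterior face, the others are interior faces. Each edge has a face on its left and a face on its right. The exterior face is anchorable if the set of edges having the exterior face on their left and the set having it on their right each form a nonempty directed path from a vertex $s_G$ to a vertex $t_G$ (these are the source path $\mathrm{dom}_G$ and target path $\mathrm{cod}_G$). An interior face $F$ is anchorable if the set of edges having $F$ on their right and the set having $F$ on their left each form a nonempty directed path from $s_F$ to $t_F$, with no common edges and no common vertices other than $s_F,t_F$ (these are $\mathrm{dom}_F$, $\mathrm{cod}_F$). A pasting scheme $\mathcal P$ is a finite connected plane graph all of whose faces are anchorable, such that $s_{\mathcal P}$ is the only vertex with no incoming edges and $t_{\mathcal P}$ the only vertex with no outgoing edges. Interior faces are atomic 2-cells $\alpha$ with $s_\alpha,t_\alpha,\mathrm{dom}_\alpha,\mathrm{cod}_\alpha$.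 $\mathfrak F\mathcal P$ is the free 2-category generated by $\mathcal P$: objects are vertices, 1-cells are directed paths of edges (composition is concatenation), 2-cells are freely generated under whiskering and vertical composition by the atomic 2-cells $\alpha:\mathrm{dom}_\alpha\Rightarrow\mathrm{cod}_\alpha$. An atomic 2-cell $\alpha$ lies directly above an atomic 2-cell $\beta$ if some edge belongs to both $\mathrm{cod}_\alpha$ and $\mathrm{dom}_\beta$. *)

theory Defs
  imports "HOL-Complex_Analysis.Complex_Analysis"
begin

section \<open>Plane graphs\<close>

text \<open>A finite directed multigraph (loops and parallel edges allowed) together with
  an embedding in the complex plane: vertices are points, edges are arcs (simple
  closed curves for loops) from the source point to the target point.\<close>

record ('v,'e) pgraph =
  verts  :: "'v set"
  edges  :: "'e set"
  src    :: "'e \<Rightarrow> 'v"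
  tgt    :: "'e \<Rightarrow> 'v"
  vpos   :: "'v \<Rightarrow> complex"
  ecurve :: "'e \<Rightarrow> real \<Rightarrow> complex"

definition uedge :: "('v,'e) pgraph \<Rightarrow> ('v \<times> 'v) set" where
  "uedge G = {(src G e, tgt G e) | e. e \<in> edges G} \<union> {(tgt G e, src G e) | e. e \<in> edges G}"

definition gset :: "('v,'e) pgraph \<Rightarrow> complex set" where
  "gset G = vpos G ` verts G \<union> (\<Union>e\<in>edges G. path_image (ecurve G e))"

definition plane_graph :: "('v,'e) pgraph \<Rightarrow> bool" where
  "plane_graph G \<longleftrightarrow>
     finite (verts G) \<and> finite (edges G) \<and> verts G \<noteq> {} \<and>
     (\<forall>e\<in>edges G. src G e \<in> verts G \<and> tgt G e \<in> verts G) \<and>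
     inj_on (vpos G) (verts G) \<and>
     (\<forall>e\<in>edges G.
        pathstart (ecurve G e) = vpos G (src G e) \<and>
        pathfinish (ecurve G e) = vpos G (tgt G e) \<and>
        (if src G e = tgt G e then simple_path (ecurve G e) else arc (ecurve G e)) \<and>
        (\<forall>x\<in>{0<..<1}. ecurve G e x \<notin> vpos G ` verts G)) \<and>
     (\<forall>e\<in>edges G. \<forall>e'\<in>edges G. e \<noteq> e' \<longrightarrow>
        path_image (ecurve G e) \<inter> path_image (ecurve G e') \<subseteq> vpos G ` verts G) \<and>
     (\<forall>u\<in>verts G. \<forall>v\<in>verts G. (u, v) \<in> (uedge G)\<^sup>*)"

text \<open>Regions: connected components of the complement of the drawing.
  Faces are their closures.\<close>

definition regions :: "('v,'e) pgraph \<Rightarrow> complex set set" where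
  "regions G = components (- gset G)"

definition interior_faces :: "('v,'e) pgraph \<Rightarrow> complex set set" where
  "interior_faces G = {closure R | R. R \<in> regions G \<and> bounded R}"

definition ext_face :: "('v,'e) pgraph \<Rightarrow> complex set" where
  "ext_face G = closure (THE R. R \<in> regions G \<and> \<not> bounded R)"

text \<open>Left/right side of an edge.  A region R lies on the left of edge e if, for a
  positively oriented (counterclockwise) Jordan curve J that traverses e forwards
  (J = e itself for a loop, otherwise e followed by some closing path), R contains
  points of the inside of J arbitrarily close to the midpoint of e.  Right side:
  the same with a negatively oriented J.\<close>

definition side_region :: "('v,'e) pgraph \<Rightarrow> complex \<Rightarrow> 'e \<Rightarrow> complex set \<Rightarrow> bool" where
  "side_region G k e R \<longleftrightarrow>
     (\<exists>J. simple_path J \<and> pathfinish J = pathstart J \<and>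
        (if src G e = tgt G e then J = ecurve G e else (\<exists>\<delta>. J = ecurve G e +++ \<delta>)) \<and>
        (\<forall>w\<in>inside (path_image J). winding_number J w = k) \<and>
        (\<forall>\<epsilon>>0. \<exists>w\<in>R \<inter> inside (path_image J). dist w (ecurve G e (1/2)) < \<epsilon>))"

definition left_of :: "('v,'e) pgraph \<Rightarrow> 'e \<Rightarrow> complex set \<Rightarrow> bool" where
  "left_of G e F \<longleftrightarrow> (\<exists>R\<in>regions G. closure R = F \<and> side_region G 1 e R)"

definition right_of :: "('v,'e) pgraph \<Rightarrow> 'e \<Rightarrow> complex set \<Rightarrow> bool" where
  "right_of G e F \<longleftrightarrow> (\<exists>R\<in>regions G. closure R = F \<and> side_region G (-1) e R)"

section \<open>Directed paths\<close>

text \<open>Walks (the 1-cells of the free 2-category): lists of consecutive edges;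
  the empty walk at a vertex is allowed.\<close>

primrec walk :: "('v,'e) pgraph \<Rightarrow> 'v \<Rightarrow> 'e list \<Rightarrow> 'v \<Rightarrow> bool" where
  "walk G a [] b \<longleftrightarrow> a = b \<and> a \<in> verts G"
| "walk G a (e # p) b \<longleftrightarrow> e \<in> edges G \<and> src G e = a \<and> walk G (tgt G e) p b"

definition pverts :: "('v,'e) pgraph \<Rightarrow> 'v \<Rightarrow> 'e list \<Rightarrow> 'v list" where
  "pverts G a p = a # map (tgt G) p"

text \<open>Nonempty directed path without repeated vertices.\<close>
definition spath :: "('v,'e) pgraph \<Rightarrow> 'v \<Rightarrow> 'e list \<Rightarrow> 'v \<Rightarrow> bool" where
  "spath G a p b \<longleftrightarrow> walk G a p b \<and> p \<noteq> [] \<and> distinct (pverts G a p)"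

definition ext_anchored :: "('v,'e) pgraph \<Rightarrow> 'v \<Rightarrow> 'v \<Rightarrow> 'e list \<Rightarrow> 'e list \<Rightarrow> bool" where
  "ext_anchored G s t d c \<longleftrightarrow>
     spath G s d t \<and> spath G s c t \<and>
     set d = {e \<in> edges G. left_of G e (ext_face G)} \<and>
     set c = {e \<in> edges G. right_of G e (ext_face G)}"

definition face_anchored :: "('v,'e) pgraph \<Rightarrow> complex set \<Rightarrow> 'v \<Rightarrow> 'v \<Rightarrow> 'e list \<Rightarrow> 'e list \<Rightarrow> bool" where
  "face_anchored G F s t d c \<longleftrightarrow>
     spath G s d t \<and> spath G s c t \<and>
     set d = {e \<in> edges G. right_of G e F} \<and>
     set c = {e \<in> edges G. left_of G e F} \<and>
     set d \<inter> set c = {} \<and>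
     set (pverts G s d) \<inter> set (pverts G s c) \<subseteq> {s, t}"

definition pasting_scheme :: "('v,'e) pgraph \<Rightarrow> 'v \<Rightarrow> 'v \<Rightarrow> bool" where
  "pasting_scheme G s t \<longleftrightarrow>
     plane_graph G \<and>
     (\<exists>d c. ext_anchored G s t d c) \<and>
     (\<forall>F\<in>interior_faces G. \<exists>sF tF d c. face_anchored G F sF tF d c) \<and>
     (\<forall>v\<in>verts G. (\<not> (\<exists>e\<in>edges G. tgt G e = v)) \<longleftrightarrow> v = s) \<and>
     (\<forall>v\<in>verts G. (\<not> (\<exists>e\<in>edges G. src G e = v)) \<longleftrightarrow> v = t)"

text \<open>Data of atomic 2-cells (interior faces) and of the exterior face.\<close>

definition cell_src :: "('v,'e) pgraph \<Rightarrow> complex set \<Rightarrow> 'v" where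
  "cell_src G F = (THE s. \<exists>t d c. face_anchored G F s t d c)"
definition cell_tgt :: "('v,'e) pgraph \<Rightarrow> complex set \<Rightarrow> 'v" where
  "cell_tgt G F = (THE t. \<exists>s d c. face_anchored G F s t d c)"
definition cell_dom :: "('v,'e) pgraph \<Rightarrow> complex set \<Rightarrow> 'e list" where
  "cell_dom G F = (THE d. \<exists>s t c. face_anchored G F s t d c)"
definition cell_cod :: "('v,'e) pgraph \<Rightarrow> complex set \<Rightarrow> 'e list" where
  "cell_cod G F = (THE c. \<exists>s t d. face_anchored G F s t d c)"

definition ext_dom :: "('v,'e) pgraph \<Rightarrow> 'e list" where
  "ext_dom G = (THE d. \<exists>s t c. ext_anchored G s t d c)"

definition directly_above :: "('v,'e) pgraph \<Rightarrow> complex set \<Rightarrow> complex set \<Rightarrow> bool" where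
  "directly_above G \<alpha> \<beta> \<longleftrightarrow> set (cell_cod G \<alpha>) \<inter> set (cell_dom G \<beta>) \<noteq> {}"

section \<open>The free 2-category on a pasting scheme\<close>

text \<open>Terms for 2-cells: identities on 1-cells, atomic cells, left/right whiskering
  and vertical composition (diagrammatic order: VC x y means first x, then y).\<close>

datatype ('e,'c) tm2 =
    Id2 "'e list"
  | At 'c
  | LW "'e list" "('e,'c) tm2"
  | RW "('e,'c) tm2" "'e list"
  | VC "('e,'c) tm2" "('e,'c) tm2"

primrec dom2 :: "('v,'e) pgraph \<Rightarrow> ('e, complex set) tm2 \<Rightarrow> 'e list" where
  "dom2 G (Id2 p) = p"
| "dom2 G (At F) = cell_dom G F"
| "dom2 G (LW u x) = u @ dom2 G x"
| "dom2 G (RW x v) = dom2 G x @ v"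
| "dom2 G (VC x y) = dom2 G x"

primrec cod2 :: "('v,'e) pgraph \<Rightarrow> ('e, complex set) tm2 \<Rightarrow> 'e list" where
  "cod2 G (Id2 p) = p"
| "cod2 G (At F) = cell_cod G F"
| "cod2 G (LW u x) = u @ cod2 G x"
| "cod2 G (RW x v) = cod2 G x @ v"
| "cod2 G (VC x y) = cod2 G y"

text \<open>Well-typed 2-cell terms between 1-cells from object a to object b.\<close>
inductive wt2 :: "('v,'e) pgraph \<Rightarrow> ('e, complex set) tm2 \<Rightarrow> 'v \<Rightarrow> 'v \<Rightarrow> bool"
  for G where
  wt_id: "walk G a p b \<Longrightarrow> wt2 G (Id2 p) a b"
| wt_at: "F \<in> interior_faces G \<Longrightarrow> wt2 G (At F) (cell_src G F) (cell_tgt G F)"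
| wt_lw: "walk G a u b \<Longrightarrow> wt2 G x b c \<Longrightarrow> wt2 G (LW u x) a c"
| wt_rw: "wt2 G x a b \<Longrightarrow> walk G b v c \<Longrightarrow> wt2 G (RW x v) a c"
| wt_vc: "wt2 G x a b \<Longrightarrow> wt2 G y a b \<Longrightarrow> cod2 G x = dom2 G y \<Longrightarrow> wt2 G (VC x y) a b"

text \<open>The congruence generated by the 2-category axioms (presented via whiskering:
  vertical associativity and units, functoriality and associativity/unitality of
  whiskering, compatibility of left and right whiskering, and interchange).\<close>
inductive eq2 :: "('v,'e) pgraph \<Rightarrow> 'v \<Rightarrow> 'v \<Rightarrow> ('e, complex set) tm2 \<Rightarrow> ('e, complex set) tm2 \<Rightarrow> bool"
  for G where
  eq_refl: "wt2 G x a b \<Longrightarrow> eq2 G a b x x"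
| eq_sym: "eq2 G a b x y \<Longrightarrow> eq2 G a b y x"
| eq_trans: "eq2 G a b x y \<Longrightarrow> eq2 G a b y z \<Longrightarrow> eq2 G a b x z"
| eq_vc: "eq2 G a b x x' \<Longrightarrow> eq2 G a b y y' \<Longrightarrow> wt2 G (VC x y) a b \<Longrightarrow> wt2 G (VC x' y') a b
          \<Longrightarrow> eq2 G a b (VC x y) (VC x' y')"
| eq_lw: "walk G a u b \<Longrightarrow> eq2 G b c x x' \<Longrightarrow> eq2 G a c (LW u x) (LW u x')"
| eq_rw: "eq2 G a b x x' \<Longrightarrow> walk G b v c \<Longrightarrow> eq2 G a c (RW x v) (RW x' v)"
| vc_assoc: "wt2 G (VC (VC x y) z) a b \<Longrightarrow> eq2 G a b (VC (VC x y) z) (VC x (VC y z))"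
| vc_unitl: "wt2 G x a b \<Longrightarrow> eq2 G a b (VC (Id2 (dom2 G x)) x) x"
| vc_unitr: "wt2 G x a b \<Longrightarrow> eq2 G a b (VC x (Id2 (cod2 G x))) x"
| lw_id: "walk G a u b \<Longrightarrow> walk G b p c \<Longrightarrow> eq2 G a c (LW u (Id2 p)) (Id2 (u @ p))"
| rw_id: "walk G a p b \<Longrightarrow> walk G b v c \<Longrightarrow> eq2 G a c (RW (Id2 p) v) (Id2 (p @ v))"
| lw_vc: "walk G a u b \<Longrightarrow> wt2 G (VC x y) b c \<Longrightarrow>
          eq2 G a c (LW u (VC x y)) (VC (LW u x) (LW u y))"
| rw_vc: "wt2 G (VC x y) a b \<Longrightarrow> walk G b v c \<Longrightarrow>
          eq2 G a c (RW (VC x y) v) (VC (RW x v) (RW y v))"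
| lw_nil: "wt2 G x a b \<Longrightarrow> eq2 G a b (LW [] x) x"
| rw_nil: "wt2 G x a b \<Longrightarrow> eq2 G a b (RW x []) x"
| lw_app: "walk G a u b \<Longrightarrow> walk G b u' c \<Longrightarrow> wt2 G x c d \<Longrightarrow>
          eq2 G a d (LW (u @ u') x) (LW u (LW u' x))"
| rw_app: "wt2 G x a b \<Longrightarrow> walk G b v c \<Longrightarrow> walk G c v' d \<Longrightarrow>
          eq2 G a d (RW x (v @ v')) (RW (RW x v) v')"
| lw_rw: "walk G a u b \<Longrightarrow> wt2 G x b c \<Longrightarrow> walk G c v d \<Longrightarrow>
          eq2 G a d (RW (LW u x) v) (LW u (RW x v))"
| interchange: "wt2 G x a b \<Longrightarrow> wt2 G y b c \<Longrightarrow>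
          eq2 G a c (VC (RW x (dom2 G y)) (LW (cod2 G x) y))
                    (VC (LW (dom2 G x) y) (RW x (cod2 G y)))"

text \<open>Hom-set of the hom-category FP(a,b) between 1-cells p and q, as terms
  (the 2-cells are these terms modulo eq2 G a b).\<close>
definition hom2 :: "('v,'e) pgraph \<Rightarrow> 'v \<Rightarrow> 'v \<Rightarrow> 'e list \<Rightarrow> 'e list \<Rightarrow> ('e, complex set) tm2 set" where
  "hom2 G a b p q = {x. wt2 G x a b \<and> dom2 G x = p \<and> cod2 G x = q}"

section \<open>The cube and the characteristic functions of paths\<close>

primrec pcurve :: "('v,'e) pgraph \<Rightarrow> 'v \<Rightarrow> 'e list \<Rightarrow> real \<Rightarrow> complex" where
  "pcurve G a [] = linepath (vpos G a) (vpos G a)"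
| "pcurve G a (e # p) = ecurve G e +++ pcurve G (tgt G e) p"

text \<open>Face F lies above the path p (from s): it is in the region bounded by p and
  dom_P, i.e. the closed curve p followed by dom_P backwards winds around it.\<close>
definition above :: "('v,'e) pgraph \<Rightarrow> 'v \<Rightarrow> 'e list \<Rightarrow> complex set \<Rightarrow> bool" where
  "above G s p F \<longleftrightarrow>
     (\<exists>R\<in>regions G. closure R = F \<and>
        (\<exists>w\<in>R. winding_number (pcurve G s p +++ reversepath (pcurve G s (ext_dom G))) w \<noteq> 0))"

definition chi :: "('v,'e) pgraph \<Rightarrow> 'v \<Rightarrow> 'e list \<Rightarrow> complex set \<Rightarrow> nat" where
  "chi G s p F = (if F \<in> interior_faces G \<and> above G s p F then 1 else 0)"

text \<open>The subposet P^{>=} of the cube {0<=1}^{cells}, functions extended by 0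
  outside the set of atomic cells; ordered pointwise.\<close>
definition Pge :: "('v,'e) pgraph \<Rightarrow> (complex set \<Rightarrow> nat) set" where
  "Pge G = {f. (\<forall>F. F \<notin> interior_faces G \<longrightarrow> f F = 0) \<and>
               (\<forall>F\<in>interior_faces G. f F \<in> {0, 1}) \<and>
               (\<forall>\<alpha>\<in>interior_faces G. \<forall>\<beta>\<in>interior_faces G.
                   directly_above G \<alpha> \<beta> \<longrightarrow> f \<beta> \<le> f \<alpha>)}"

end

theory Submission
  imports Defs
begin

text \<open>
  Every edge has exactly one region on its left and one on its right, and the winding number of a closed walk,
  seen as a function on faces, jumps across an edge by the signed number of times the walk traverses it.
  Hence the cycle space of the graph is freely spanned by the boundaries of the bounded faces, and the rest of
  the argument is combinatorial.

  A directed cycle gives a nonempty set of bounded faces closed under passing to the faces directly above (or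
  directly below), namely a level set of its winding number. Conversely such a set carries a circulation of the
  dual graph; the circulation has a potential on the vertices, which is monotone along edges and takes the same
  value at the source and at the sink, so a superlevel or sublevel set of it contains a directed cycle. An
  innermost such set is contradictory, so neither the graph nor the relation ``directly above'' has a cycle.

  The winding number of a path followed by the reversed source path then has values in {0, 1}, is monotone,
  and determines the path. A monotone function that is one larger on a single face is reached by replacing the
  domain of that face by its codomain, which realises every element of the poset and every inequality.
  Two sequences of such replacements with the same ends are equal 2-cells by induction, since distinct
  replacements available at a path occupy disjoint segments and commute by interchange.
\<close>

text \<open>The sides of an edge are defined through an arbitrary Jordan curve running along it.
  Hence two facts precede the combinatorics: curves of both orientations exist, and the region seen
  near the midpoint depends on the orientation alone. The first is obtained by blocking one side of
  the edge with an arc that runs to a large circle. The second holds because the edge cancels in the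
  difference of the winding numbers of two such curves, which is therefore continuous across the
  edge.

  Acyclicity has to be derived from the anchoring of the faces and the uniqueness of source and
  sink. A cycle yields a closed set of faces and a closed set yields a cycle, so a descent is
  needed. It works because the potential has the value of the source on all edges bordering faces
  reachable from the exterior without entering the set, whereas the new cycle avoids that value. The
  new cycle therefore keeps away from the outer boundary of the set.\<close>

section \<open>Local connectivity and accessibility\<close>

text \<open>Janiszewski's theorem applied to K and to the union of \<open>\<beta>\<close> with the sphere of radius \<open>\<epsilon>\<close>:
  their intersection is \<open>\<beta>\<close>, which is connected.\<close>

lemma complement_locally_connected_at:
  fixes K :: "complex set"
  assumes "compact K" and K: "K = \<alpha> \<union> \<beta>" and "compact \<beta>" "connected \<beta>" "x \<notin> \<beta>"
    and \<alpha>: "\<alpha> \<subseteq> ball x \<epsilon>" and "0 < \<epsilon>"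
  obtains \<delta> where "0 < \<delta>"
    "\<And>p q. p \<in> ball x \<delta> \<Longrightarrow> q \<in> ball x \<delta> \<Longrightarrow> connected_component (- K) p q
       \<Longrightarrow> connected_component (ball x \<epsilon> - K) p q"
proof -
  have "open (- \<beta>)" using \<open>compact \<beta>\<close> by (simp add: compact_imp_closed open_Compl)
  then obtain d where d: "0 < d" "ball x d \<subseteq> - \<beta>"
    using \<open>x \<notin> \<beta>\<close> by (meson ComplI open_contains_ball)
  define \<delta> where "\<delta> = min d \<epsilon>"
  have \<delta>: "0 < \<delta>" "ball x \<delta> \<subseteq> - \<beta>" "ball x \<delta> \<subseteq> ball x \<epsilon>"
    using d \<open>0 < \<epsilon>\<close> by (auto simp: \<delta>_def)
  show thesis
  proof (rule that[OF \<delta>(1)])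
    fix p q assume pq: "p \<in> ball x \<delta>" "q \<in> ball x \<delta>" and cc: "connected_component (- K) p q"
    have sub: "ball x \<delta> \<subseteq> - (\<beta> \<union> sphere x \<epsilon>)"
      using \<delta> by auto
    have "connected_component (- (\<beta> \<union> sphere x \<epsilon>)) p q"
      unfolding connected_component_def using sub pq convex_connected[OF convex_ball] by blast
    moreover have "closed (\<beta> \<union> sphere x \<epsilon>)"
      using \<open>compact \<beta>\<close> by (simp add: compact_imp_closed closed_Un)
    moreover have "K \<inter> (\<beta> \<union> sphere x \<epsilon>) = \<beta>"
      using K \<alpha> by auto
    ultimately have "connected_component (- (K \<union> (\<beta> \<union> sphere x \<epsilon>))) p q"
      using Janiszewski[OF \<open>compact K\<close> _ _ cc] \<open>connected \<beta>\<close> by metis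
    then obtain C where C: "connected C" "C \<subseteq> - (K \<union> (\<beta> \<union> sphere x \<epsilon>))" "p \<in> C" "q \<in> C"
      unfolding connected_component_def by blast
    have "C \<subseteq> ball x \<epsilon>"
    proof (rule ccontr)
      assume "\<not> C \<subseteq> ball x \<epsilon>"
      then have "C \<inter> frontier (ball x \<epsilon>) \<noteq> {}"
        using connected_Int_frontier[OF C(1), of "ball x \<epsilon>"] C(3) pq \<delta>(3) by blast
      then show False using C(2) \<open>0 < \<epsilon>\<close> by (auto simp: frontier_ball)
    qed
    then show "connected_component (ball x \<epsilon> - K) p q"
      unfolding connected_component_def using C by blast
  qed
qed

text \<open>The arc without a short initial piece is connected and misses the start, so it can serve
  as \<open>\<beta>\<close>. That \<open>p\<close> and \<open>q\<close> lie in one component of the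
  complement is automatic here, since an arc does not separate the plane.\<close>

lemma arc_complement_locally_connected_at_start:
  fixes \<gamma> :: "real \<Rightarrow> complex"
  assumes "arc \<gamma>" "0 < \<epsilon>"
  obtains \<delta> where "0 < \<delta>"
    "\<And>p q. p \<in> ball (pathstart \<gamma>) \<delta> - path_image \<gamma> \<Longrightarrow> q \<in> ball (pathstart \<gamma>) \<delta> - path_image \<gamma>
       \<Longrightarrow> connected_component (ball (pathstart \<gamma>) \<epsilon> - path_image \<gamma>) p q"
proof -
  have cont: "continuous_on {0..1} \<gamma>" and inj: "inj_on \<gamma> {0..1}"
    using assms by (auto simp: arc_def path_def)
  obtain d where d: "0 < d" "\<And>u. u \<in> {0..1} \<Longrightarrow> dist u 0 < d \<Longrightarrow> dist (\<gamma> u) (\<gamma> 0) < \<epsilon>"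
    using cont \<open>0 < \<epsilon>\<close> unfolding continuous_on_iff by (metis atLeastAtMost_iff order_refl zero_le_one)
  define h where "h = min (d/2) 1"
  have h: "0 < h" "h \<le> 1" "h < d" using d by (auto simp: h_def)
  have K: "path_image \<gamma> = \<gamma> ` {0..h} \<union> \<gamma> ` {h..1}"
    unfolding path_image_def using h by (metis image_Un ivl_disj_un_two_touch(4) less_imp_le)
  have cb: "compact (\<gamma> ` {h..1})" "connected (\<gamma> ` {h..1})"
    using h by (auto intro!: compact_continuous_image connected_continuous_image continuous_on_subset[OF cont])
  have notin: "pathstart \<gamma> \<notin> \<gamma> ` {h..1}"
    using inj h unfolding pathstart_def inj_on_def by force
  have sub: "\<gamma> ` {0..h} \<subseteq> ball (pathstart \<gamma>) \<epsilon>"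
    using d h by (auto simp: pathstart_def dist_commute)
  have conn: "connected (- path_image \<gamma>)"
    using connected_arc_complement[OF \<open>arc \<gamma>\<close>] by simp
  obtain \<delta> where "0 < \<delta>"
    and \<delta>: "\<And>p q. p \<in> ball (pathstart \<gamma>) \<delta> \<Longrightarrow> q \<in> ball (pathstart \<gamma>) \<delta> \<Longrightarrow> connected_component (- path_image \<gamma>) p q
       \<Longrightarrow> connected_component (ball (pathstart \<gamma>) \<epsilon> - path_image \<gamma>) p q"
    using complement_locally_connected_at[OF _ K cb notin sub \<open>0 < \<epsilon>\<close>] compact_arc_image[OF \<open>arc \<gamma>\<close>] by metis
  show thesis
  proof (rule that[OF \<open>0 < \<delta>\<close>])
    fix p q assume "p \<in> ball (pathstart \<gamma>) \<delta> - path_image \<gamma>" "q \<in> ball (pathstart \<gamma>) \<delta> - path_image \<gamma>"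
    then show "connected_component (ball (pathstart \<gamma>) \<epsilon> - path_image \<gamma>) p q"
      using \<delta> conn by (metis ComplI DiffD1 DiffD2 connected_iff_connected_component)
  qed
qed

text \<open>Removing a short piece around \<open>u\<close> from a closed curve leaves two pieces
  that meet at \<open>J 0 = J 1\<close>, so \<open>\<beta>\<close> is connected. A closed curve does
  separate the plane, hence \<open>p\<close> and \<open>q\<close> must be assumed to lie in one
  component.\<close>

lemma loop_complement_locally_connected_at:
  fixes J :: "real \<Rightarrow> complex"
  assumes "simple_path J" "pathfinish J = pathstart J" "0 < u" "u < 1" "0 < \<epsilon>"
  obtains \<delta> where "0 < \<delta>"
    "\<And>p q. p \<in> ball (J u) \<delta> \<Longrightarrow> q \<in> ball (J u) \<delta> \<Longrightarrow> connected_component (- path_image J) p q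
       \<Longrightarrow> connected_component (ball (J u) \<epsilon> - path_image J) p q"
proof -
  have cont: "continuous_on {0..1} J" and "path J"
    using assms by (auto simp: simple_path_def path_def)
  have inj: "\<And>x y. x \<in> {0..1} \<Longrightarrow> y \<in> {0..1} \<Longrightarrow> J x = J y \<Longrightarrow> x = y \<or> x = 0 \<and> y = 1 \<or> x = 1 \<and> y = 0"
    using assms by (auto simp: simple_path_def loop_free_def)
  obtain d where d: "0 < d" "\<And>v. v \<in> {0..1} \<Longrightarrow> dist v u < d \<Longrightarrow> dist (J v) (J u) < \<epsilon>"
    using cont \<open>0 < \<epsilon>\<close> assms unfolding continuous_on_iff by (metis atLeastAtMost_iff less_imp_le)
  define h where "h = min (d/2) (min (u/2) ((1-u)/2))"
  have h: "0 < h" "0 < u - h" "u + h < 1" "h < d" using d assms by (auto simp: h_def min_def field_simps)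
  let ?\<beta> = "J ` {0..u-h} \<union> J ` {u+h..1}"
  have *: "{0..1} = {u-h..u+h} \<union> ({0..u-h} \<union> {u+h..1})" using h by auto
  have K: "path_image J = J ` {u-h..u+h} \<union> ?\<beta>"
    unfolding path_image_def by (subst *) (simp only: image_Un)
  have "compact ?\<beta>"
    using h assms(3,4) by (intro compact_Un compact_continuous_image continuous_on_subset[OF cont]) auto
  moreover have "connected ?\<beta>"
  proof (rule connected_Un)
    show "connected (J ` {0..u-h})" "connected (J ` {u+h..1})"
      using h assms(3,4) by (auto intro!: connected_continuous_image continuous_on_subset[OF cont])
    have "J 0 \<in> J ` {0..u-h}" "J 1 \<in> J ` {u+h..1}" using h by auto
    then show "J ` {0..u-h} \<inter> J ` {u+h..1} \<noteq> {}" using assms(2) by (auto simp: pathstart_def pathfinish_def)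
  qed
  moreover have "J u \<notin> ?\<beta>"
  proof
    assume "J u \<in> ?\<beta>"
    then obtain y where "J u = J y" "y \<in> {0..u-h} \<union> {u+h..1}" by blast
    then show False using inj[of u y] h assms(3,4) by auto
  qed
  moreover have "J ` {u-h..u+h} \<subseteq> ball (J u) \<epsilon>"
    using d(2) h by (force simp: dist_real_def dist_commute[of "J u"])
  ultimately show thesis
    using complement_locally_connected_at[OF _ K _ _ _ _ \<open>0 < \<epsilon>\<close>] compact_path_image[OF \<open>path J\<close>] that by metis
qed

text \<open>A sequence in \<open>U\<close> tending to \<open>a\<close> is joined term by term inside
  balls of radius \<open>\<epsilon> / (n + 1)\<close>; local connectivity of \<open>U\<close> at
  \<open>a\<close> supplies the joins. Their concatenation is a half-open path whose missing end is
  \<open>a\<close>.\<close>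

lemma accessible_point:
  fixes a :: complex
  assumes "open U" "a \<in> closure U" "a \<notin> U" "0 < \<epsilon>"
    and loc: "\<And>\<epsilon>. 0 < \<epsilon> \<Longrightarrow> \<exists>\<delta>>0. \<forall>x\<in>U \<inter> ball a \<delta>. \<forall>y\<in>U \<inter> ball a \<delta>. connected_component (U \<inter> ball a \<epsilon>) x y"
  obtains g where "path g" "pathstart g = a" "path_image g - {a} \<subseteq> U" "path_image g \<subseteq> ball a \<epsilon>"
    "pathfinish g \<in> U"
proof -
  define r where "r n = \<epsilon> / (real n + 1)" for n :: nat
  have rpos: "0 < r n" for n using \<open>0 < \<epsilon>\<close> by (simp add: r_def)
  have "\<exists>\<delta>>0. \<forall>x\<in>U \<inter> ball a \<delta>. \<forall>y\<in>U \<inter> ball a \<delta>. connected_component (U \<inter> ball a (r n)) x y" for n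
    using loc[OF rpos] .
  then obtain D where D: "\<And>n. 0 < D n"
    "\<And>n x y. x \<in> U \<inter> ball a (D n) \<Longrightarrow> y \<in> U \<inter> ball a (D n) \<Longrightarrow> connected_component (U \<inter> ball a (r n)) x y"
    by metis
  \<comment> \<open>\<open>X n\<close> is the start of the \<open>n\<close>-th piece and the end of
    the piece before it, so it must be close enough to \<open>a\<close> for both. For
    \<open>n = 0\<close> truncated subtraction makes the two radii equal.\<close>
  have "\<exists>x. x \<in> U \<and> x \<in> ball a (min (D n) (D (n-1)))" for n
    using closure_approachable[THEN iffD1, OF \<open>a \<in> closure U\<close>, rule_format, of "min (D n) (D (n-1))"] D(1)
    by (auto simp: dist_commute)
  then obtain X where X: "\<And>n. X n \<in> U" "\<And>n. X n \<in> ball a (min (D n) (D (n-1)))" by metis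
  have X1: "X n \<in> U \<inter> ball a (D n)" for n using X[of n] by auto
  have X2: "X (Suc n) \<in> U \<inter> ball a (D n)" for n using X[of "Suc n"] by auto
  have "path_component (U \<inter> ball a (r n)) (X n) (X (Suc n))" for n
    using D(2)[OF X1 X2] \<open>open U\<close> by (metis open_Int open_ball open_path_connected_component)
  then obtain P where P: "\<And>n. path (P n)" "\<And>n. path_image (P n) \<subseteq> U \<inter> ball a (r n)"
    "\<And>n. pathstart (P n) = X n" "\<And>n. pathfinish (P n) = X (Suc n)"
    unfolding path_component_def by metis
  define H where "H t = P (nat \<lfloor>t\<rfloor>) (t - of_int \<lfloor>t\<rfloor>)" for t :: real
  have Hn: "H t = P n (t - n)" if "t \<in> {real n..real n + 1}" for t n
  proof (cases "t = real n + 1")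
    case True
    then have "t = real (Suc n)" by simp
    then show ?thesis using P(3)[of "Suc n"] P(4)[of n] unfolding H_def pathstart_def pathfinish_def
      by (simp del: of_nat_Suc) (simp add: nat_add_distrib)
  next
    case False
    then have "\<lfloor>t\<rfloor> = int n" using that by (auto simp: floor_eq_iff)
    then show ?thesis by (simp add: H_def)
  qed
  have cont1: "continuous_on {real n..real n + 1} H" for n
  proof -
    have "continuous_on {real n..real n + 1} (\<lambda>t. P n (t - n))"
      by (rule continuous_on_compose2[of "{0..1}" "P n"]) (use P(1)[of n] in \<open>auto simp: path_def intro!: continuous_intros\<close>)
    then show ?thesis by (rule continuous_on_eq) (simp add: Hn)
  qed
  have contn: "continuous_on {0..real n} H" for n
  proof (induction n)
    case 0 show ?case by simp
  next
    case (Suc n)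
    have "{0..real (Suc n)} = {0..real n} \<union> {real n..real n + 1}" by auto
    then show ?case using continuous_on_closed_Un[OF _ _ Suc cont1[of n]] by simp
  qed
  have Hmem: "H t \<in> U \<inter> ball a (r n)" if "real n \<le> t" for t n
  proof -
    define m where "m = nat \<lfloor>t\<rfloor>"
    have m: "t \<in> {real m..real m + 1}" "n \<le> m"
      using that unfolding m_def by (auto simp: le_nat_floor)
    have "H t \<in> path_image (P m)"
      using Hn[OF m(1)] m(1) by (auto simp: path_image_def)
    moreover have "r m \<le> r n" using m(2) \<open>0 < \<epsilon>\<close> by (auto simp: r_def intro!: divide_left_mono)
    ultimately show ?thesis using P(2)[of m] by (auto simp: subset_iff)
  qed
  \<comment> \<open>H runs through infinitely many paths that shrink to a; reparametrise the ray to the unit interval.\<close>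
  define g where "g s = (if s = 0 then a else H (1/s - 1))" for s :: real
  have g_mem: "g s \<in> U \<inter> ball a (r n)" if "0 < s" "s * (real n + 1) \<le> 1" for s n
    using Hmem[of n "1/s - 1"] that by (auto simp: g_def field_simps)
  have "continuous (at s within {0..1}) g" if s: "s \<in> {0..1}" for s
  proof (cases "s = 0")
    case True
    have "\<exists>d>0. \<forall>y\<in>{0..1}. 0 < dist y s \<and> dist y s < d \<longrightarrow> dist (g y) (g s) < e" if "e > 0" for e
    proof -
      obtain n where n: "r n < e"
      proof -
        obtain n where "\<epsilon> / e < real n" using reals_Archimedean2 by blast
        then have "r n < e" using \<open>0 < \<epsilon>\<close> \<open>e > 0\<close> by (simp add: r_def field_simps)
        then show thesis by (rule that)
      qed
      have "dist (g y) (g s) < e" if "0 < y" "y < 1 / (real n + 1)" for y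
        using g_mem[of y n] that n True by (auto simp: g_def field_simps dist_commute)
      then show ?thesis using True by (intro exI[of _ "1 / (real n + 1)"]) auto
    qed
    then show ?thesis unfolding continuous_within Lim_within by blast
  next
    case False
    then have "0 < s" "s \<le> 1" using s by auto
    obtain n :: nat where n: "1 / s < real n" using reals_Archimedean2 by blast
    have "0 < n" using n \<open>0 < s\<close> by (metis divide_pos_pos gr0I less_numeral_extra(1) of_nat_0 order.asym)
    \<comment> \<open>Away from 0 only finitely many pieces matter: on \<open>?T\<close> the
      parameter \<open>1/s - 1\<close> stays between 0 and \<open>n\<close>, where \<open>H\<close>
      is already continuous.\<close>
    let ?T = "{1 / real n..1}"
    have cT: "continuous_on ?T (\<lambda>s. H (1/s - 1))"
    proof (rule continuous_on_compose2[OF contn[of n]])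
      show "continuous_on ?T (\<lambda>s. 1/s - 1)" using \<open>0 < n\<close> by (intro continuous_intros) auto
      show "(\<lambda>s. 1/s - 1) ` ?T \<subseteq> {0..real n}"
      proof clarify
        fix x assume x: "x \<in> ?T"
        then have "0 < x" using \<open>0 < n\<close> by (smt (verit, best) atLeastAtMost_iff divide_pos_pos of_nat_0_less_iff)
        then show "1 / x - 1 \<in> {0..real n}" using x \<open>0 < n\<close> by (auto simp: field_simps)
      qed
    qed
    have "?T \<subseteq> - {0}" using \<open>0 < n\<close> by auto
    then have "continuous_on ?T g"
      using cT by (rule_tac continuous_on_eq[OF cT]) (auto simp: g_def)
    moreover have "s \<in> ?T" using n \<open>0 < s\<close> \<open>s \<le> 1\<close> \<open>0 < n\<close> by (auto simp: field_simps)
    ultimately have "continuous (at s within ?T) g" by (simp add: continuous_on_eq_continuous_within)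
    moreover have "at s within ?T = at s within {0..1}"
    proof (rule at_within_nhd[of s "{1 / real n<..}"])
      show "s \<in> {1 / real n<..}" using n \<open>0 < s\<close> \<open>0 < n\<close> by (auto simp: field_simps)
      show "?T \<inter> {1 / real n<..} - {s} = {0..1} \<inter> {1 / real n<..} - {s}"
      proof -
        have "0 \<le> x" if "1 / real n < x" for x :: real
          using that by (smt (verit) divide_nonneg_nonneg of_nat_0_le_iff)
        then show ?thesis by auto
      qed
    qed auto
    ultimately show ?thesis by simp
  qed
  then have "path g" unfolding path_def by (simp add: continuous_on_eq_continuous_within)
  have mem0: "g s \<in> U \<inter> ball a \<epsilon>" if "0 < s" "s \<le> 1" for s
    using g_mem[of s 0] that by (simp add: r_def)
  show thesis
  proof (rule that[OF \<open>path g\<close>])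
    show "pathstart g = a" by (simp add: pathstart_def g_def)
    have *: "path_image g \<subseteq> insert a (U \<inter> ball a \<epsilon>)"
    proof
      fix y assume "y \<in> path_image g"
      then obtain s where "s \<in> {0..1}" "y = g s" by (auto simp: path_image_def)
      then show "y \<in> insert a (U \<inter> ball a \<epsilon>)" using mem0[of s] by (cases "s = 0") (auto simp: g_def)
    qed
    show "path_image g - {a} \<subseteq> U" "path_image g \<subseteq> ball a \<epsilon>" using * \<open>0 < \<epsilon>\<close> by auto
    show "pathfinish g \<in> U" using mem0[of 1] by (simp add: pathfinish_def)
  qed
qed

text \<open>On an open part of the image the inverse parametrisation would be a continuous injection
  of a plane open set into the line, against invariance of dimension. This puts the start of an arc
  in the closure of its complement.\<close>

lemma interior_arc_image_eq_empty:
  fixes \<gamma> :: "real \<Rightarrow> complex"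
  assumes "arc \<gamma>"
  shows "interior (path_image \<gamma>) = {}"
proof (rule ccontr)
  assume ne: "interior (path_image \<gamma>) \<noteq> {}"
  obtain h where h: "homeomorphism {0..1} (path_image \<gamma>) \<gamma> h"
    using homeomorphism_arc[OF assms] .
  have "continuous_on (interior (path_image \<gamma>)) h"
    using homeomorphism_cont2[OF h] continuous_on_subset interior_subset by blast
  moreover have "inj_on h (interior (path_image \<gamma>))"
    using h interior_subset unfolding homeomorphism_def inj_on_def by (metis subsetD)
  ultimately show False
    using invariance_of_dimension[OF _ open_interior _ ne] by force
qed

section \<open>Closing an arc to a Jordan curve of either orientation\<close>

lemma arc_start_accessible:
  fixes \<gamma> :: "real \<Rightarrow> complex"
  assumes "arc \<gamma>" "0 < \<epsilon>"
  obtains g where "path g" "pathstart g = pathstart \<gamma>" "path_image g - {pathstart \<gamma>} \<subseteq> - path_image \<gamma>"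
    "path_image g \<subseteq> ball (pathstart \<gamma>) \<epsilon>" "pathfinish g \<notin> path_image \<gamma>"
proof -
  have op: "open (- path_image \<gamma>)" using closed_arc_image[OF assms(1)] by (simp add: open_Compl)
  have cl: "pathstart \<gamma> \<in> closure (- path_image \<gamma>)"
    using interior_arc_image_eq_empty[OF assms(1)] by (simp add: closure_complement)
  have loc: "\<exists>\<delta>>0. \<forall>x\<in>- path_image \<gamma> \<inter> ball (pathstart \<gamma>) \<delta>. \<forall>y\<in>- path_image \<gamma> \<inter> ball (pathstart \<gamma>) \<delta>.
      connected_component (- path_image \<gamma> \<inter> ball (pathstart \<gamma>) e) x y" if e: "0 < e" for e
  proof -
    obtain \<delta> where \<delta>: "0 < \<delta>"
      "\<And>p q. p \<in> ball (pathstart \<gamma>) \<delta> - path_image \<gamma> \<Longrightarrow> q \<in> ball (pathstart \<gamma>) \<delta> - path_image \<gamma>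
       \<Longrightarrow> connected_component (ball (pathstart \<gamma>) e - path_image \<gamma>) p q"
      using arc_complement_locally_connected_at_start[OF assms(1) e] by blast
    have "- path_image \<gamma> \<inter> ball (pathstart \<gamma>) r = ball (pathstart \<gamma>) r - path_image \<gamma>" for r by blast
    then show ?thesis using \<delta> by metis
  qed
  show thesis
    using accessible_point[OF op cl _ assms(2) loc] that by (metis Compl_iff pathstart_in_path_image)
qed

text \<open>By Janiszewski's theorem \<open>\<gamma>\<close> and \<open>T\<close> together do not
  separate the plane, so short access paths at the two ends of \<open>\<gamma>\<close> can be joined
  off both sets. The obstacle \<open>T\<close> is empty when the orientation is irrelevant;
  otherwise it keeps a chosen side of \<open>\<gamma>\<close> outside the resulting loop.\<close>

lemma closing_arc_avoiding:
  fixes \<gamma> :: "real \<Rightarrow> complex"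
  assumes "arc \<gamma>" "closed T" "connected (path_image \<gamma> \<inter> T)" "connected (- T)"
    "pathstart \<gamma> \<notin> T" "pathfinish \<gamma> \<notin> T"
  obtains \<delta> where "arc \<delta>" "pathstart \<delta> = pathfinish \<gamma>" "pathfinish \<delta> = pathstart \<gamma>"
    "path_image \<gamma> \<inter> path_image \<delta> \<subseteq> {pathstart \<gamma>, pathfinish \<gamma>}" "path_image \<delta> \<inter> T = {}"
proof -
  let ?U = "- (path_image \<gamma> \<union> T)"
  have "connected ?U"
    using Janiszewski_connected[OF compact_arc_image[OF assms(1)] assms(2,3) _ assms(4)]
      connected_arc_complement[OF assms(1)] by simp
  moreover have "open ?U" using assms(2) closed_arc_image[OF assms(1)] by auto
  ultimately have pc: "path_connected ?U" by (simp add: connected_open_path_connected)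
  have opT: "open (- T)" using assms(2) by (rule open_Compl)
  obtain r where r: "0 < r" "ball (pathstart \<gamma>) r \<subseteq> - T" "ball (pathfinish \<gamma>) r \<subseteq> - T"
  proof -
    obtain r1 r2 where "0 < r1" "ball (pathstart \<gamma>) r1 \<subseteq> - T" "0 < r2" "ball (pathfinish \<gamma>) r2 \<subseteq> - T"
      using opT assms(5,6) by (meson ComplI open_contains_ball)
    then show thesis by (intro that[of "min r1 r2"]) auto
  qed
  obtain g where g: "path g" "pathstart g = pathstart \<gamma>" "path_image g - {pathstart \<gamma>} \<subseteq> - path_image \<gamma>"
    "path_image g \<subseteq> ball (pathstart \<gamma>) r" "pathfinish g \<notin> path_image \<gamma>"
    using arc_start_accessible[OF assms(1) r(1)] by blast
  obtain g' where g': "path g'" "pathstart g' = pathfinish \<gamma>" "path_image g' - {pathfinish \<gamma>} \<subseteq> - path_image \<gamma>"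
    "path_image g' \<subseteq> ball (pathfinish \<gamma>) r" "pathfinish g' \<notin> path_image \<gamma>"
    using arc_start_accessible[OF arc_reversepath[OF assms(1)] r(1)] by auto
  have "pathfinish g \<in> ?U" "pathfinish g' \<in> ?U"
    using g g' r pathfinish_in_path_image[of g] pathfinish_in_path_image[of g'] by blast+
  then obtain h where h: "path h" "path_image h \<subseteq> ?U" "pathstart h = pathfinish g'" "pathfinish h = pathfinish g"
    using pc unfolding path_connected_def by metis
  define P where "P = g' +++ h +++ reversepath g"
  have P: "path P" "pathstart P = pathfinish \<gamma>" "pathfinish P = pathstart \<gamma>"
    using g g' h by (auto simp: P_def)
  have "path_image P = path_image g' \<union> (path_image h \<union> path_image g)"
    using g g' h by (simp add: P_def path_image_join)
  then have im: "path_image P \<subseteq> ?U \<union> {pathstart \<gamma>, pathfinish \<gamma>}"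
    using g(3,4) g'(3,4) h(2) r(2,3) by blast
  obtain \<delta> where \<delta>: "arc \<delta>" "path_image \<delta> \<subseteq> path_image P" "pathstart \<delta> = pathfinish \<gamma>" "pathfinish \<delta> = pathstart \<gamma>"
    using path_contains_arc[OF P] arc_distinct_ends[OF assms(1)] by metis
  show thesis
    using \<delta> im assms(5,6) by (intro that[of \<delta>]) auto
qed

text \<open>The point \<open>x\<close> will lie on the curves off which \<open>f\<close>, built from
  winding numbers, is an integer, so \<open>x\<close> is typically not in \<open>S\<close>. Two
  values within 1/2 of \<open>f x\<close> differ by less than 1 and hence agree.\<close>

lemma continuous_integer_valued_locally_constant:
  fixes f :: "complex \<Rightarrow> complex"
  assumes "continuous (at x) f" "\<And>w. w \<in> S \<Longrightarrow> f w \<in> \<int>"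
  obtains \<eta> where "0 < \<eta>" "\<And>w w'. w \<in> S \<inter> ball x \<eta> \<Longrightarrow> w' \<in> S \<inter> ball x \<eta> \<Longrightarrow> f w = f w'"
proof -
  obtain \<eta> where \<eta>: "0 < \<eta>" "\<And>w. dist w x < \<eta> \<Longrightarrow> dist (f w) (f x) < 1/2"
    using assms(1) unfolding continuous_at by (metis continuous_at continuous_at_eps_delta half_gt_zero_iff zero_less_one)
  show thesis
  proof (rule that[OF \<eta>(1)])
    fix w w' assume w: "w \<in> S \<inter> ball x \<eta>" "w' \<in> S \<inter> ball x \<eta>"
    then have "dist (f w) (f w') < 1"
      using \<eta>(2)[of w] \<eta>(2)[of w'] dist_triangle_half_l[of "f w" "f x" 1 "f w'"] by (auto simp: dist_commute)
    moreover have "f w - f w' \<in> \<int>" using w assms(2) by auto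
    ultimately have "f w - f w' = 0"
      by (metis Ints_nonzero_abs_less1 dist_norm Ints_cases of_int_0 norm_of_int of_int_less_1_iff of_int_abs zero_less_abs_iff linorder_not_less int_one_le_iff_zero_less)
    then show "f w = f w'" by simp
  qed
qed

text \<open>The inside and the outside are single components of the complement, so a connected set
  off the curve that starts in \<open>S\<close> cannot leave it.\<close>

lemma loop_side_locally_connected_at:
  fixes J :: "real \<Rightarrow> complex"
  assumes J: "simple_path J" "pathfinish J = pathstart J" "0 < u" "u < 1" "0 < \<epsilon>"
    and S: "S = inside (path_image J) \<or> S = outside (path_image J)"
  shows "\<exists>\<delta>>0. \<forall>x\<in>S \<inter> ball (J u) \<delta>. \<forall>y\<in>S \<inter> ball (J u) \<delta>. connected_component (S \<inter> ball (J u) \<epsilon>) x y"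
proof -
  obtain \<delta> where \<delta>: "0 < \<delta>"
    "\<And>p q. p \<in> ball (J u) \<delta> \<Longrightarrow> q \<in> ball (J u) \<delta> \<Longrightarrow> connected_component (- path_image J) p q
       \<Longrightarrow> connected_component (ball (J u) \<epsilon> - path_image J) p q"
    using loop_complement_locally_connected_at[OF J] by blast
  have "connected_component (S \<inter> ball (J u) \<epsilon>) x y" if xy: "x \<in> S \<inter> ball (J u) \<delta>" "y \<in> S \<inter> ball (J u) \<delta>" for x y
  proof -
    have "connected S" "S \<subseteq> - path_image J" using S Jordan_inside_outside[OF J(1,2)] inside_no_overlap outside_no_overlap by blast+
    then have "connected_component (- path_image J) x y"
      using xy unfolding connected_component_def by auto
    then obtain C where C: "connected C" "C \<subseteq> ball (J u) \<epsilon> - path_image J" "x \<in> C" "y \<in> C"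
      using \<delta>(2) xy unfolding connected_component_def by blast
    have "C \<subseteq> S"
    proof
      fix c assume "c \<in> C"
      then have "connected_component (- path_image J) x c"
        using C unfolding connected_component_def by blast
      then show "c \<in> S" using S xy inside_same_component outside_same_component by blast
    qed
    then show ?thesis using C unfolding connected_component_def by blast
  qed
  then show ?thesis using \<delta>(1) by blast
qed

lemma loop_interior_point_notin:
  fixes \<gamma> \<delta> :: "real \<Rightarrow> complex"
  assumes J: "simple_path (\<gamma> +++ \<delta>)" "pathfinish (\<gamma> +++ \<delta>) = pathstart (\<gamma> +++ \<delta>)"
    and start: "pathstart \<delta> = pathfinish \<gamma>" and u: "0 < u" "u < 1"
  shows "\<gamma> u \<notin> path_image \<delta>"
proof
  assume "\<gamma> u \<in> path_image \<delta>"
  then obtain v where v: "v \<in> {0..1}" "\<gamma> u = \<delta> v" by (auto simp: path_image_def)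
  \<comment> \<open>At \<open>v = 0\<close> the joined path takes its value from
    \<open>\<gamma>\<close>, so the matching of the ends is used there.\<close>
  have "(\<gamma> +++ \<delta>) ((v+1)/2) = \<delta> v"
  proof (cases "v = 0")
    case True
    then show ?thesis using start unfolding joinpaths_def pathstart_def pathfinish_def by simp
  next
    case False
    then show ?thesis using v(1) by (auto simp: joinpaths_def add_divide_distrib)
  qed
  moreover have "(\<gamma> +++ \<delta>) (u/2) = \<gamma> u" using u by (simp add: joinpaths_def)
  moreover have "x = y \<or> x = 0 \<and> y = 1 \<or> x = 1 \<and> y = 0"
    if "x \<in> {0..1}" "y \<in> {0..1}" "(\<gamma> +++ \<delta>) x = (\<gamma> +++ \<delta>) y" for x y
    using J(1) that by (auto simp: simple_path_def loop_free_def)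
  note this[of "u/2" "(v+1)/2"]
  ultimately have "u/2 = (v+1)/2 \<or> u/2 = 0 \<or> u/2 = 1" using v u by auto
  then show False using v u by auto
qed

text \<open>The difference of the winding numbers of the two loops equals that of
  \<open>\<delta>'\<close> and \<open>\<delta>\<close>. This is continuous at
  \<open>\<gamma> u\<close>, and as an integer off the loops it is constant near that point. So both
  winding numbers jump alike across \<open>\<gamma>\<close>: loops of equal orientation have the
  same inside near \<open>\<gamma> u\<close>, while opposite orientations exchange inside and
  outside.\<close>

lemma loops_through_arc_compare:
  fixes \<gamma> \<delta> \<delta>' :: "real \<Rightarrow> complex"
  assumes J: "simple_path (\<gamma> +++ \<delta>)" "pathfinish (\<gamma> +++ \<delta>) = pathstart (\<gamma> +++ \<delta>)"
    and start: "pathstart \<delta> = pathfinish \<gamma>"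
    and J': "simple_path (\<gamma> +++ \<delta>')" "pathfinish (\<gamma> +++ \<delta>') = pathstart (\<gamma> +++ \<delta>')"
    and start': "pathstart \<delta>' = pathfinish \<gamma>"
    and "path \<gamma>" and k: "k \<in> {1, -1}" "k' \<in> {1, -1}"
    and wJ: "\<And>w. w \<in> inside (path_image (\<gamma> +++ \<delta>)) \<Longrightarrow> winding_number (\<gamma> +++ \<delta>) w = k"
    and wJ': "\<And>w. w \<in> inside (path_image (\<gamma> +++ \<delta>')) \<Longrightarrow> winding_number (\<gamma> +++ \<delta>') w = k'"
    and u: "0 < u" "u < 1"
  obtains \<eta> where "0 < \<eta>" "\<And>w. w \<in> ball (\<gamma> u) \<eta> \<Longrightarrow> w \<in> inside (path_image (\<gamma> +++ \<delta>'))
     \<longleftrightarrow> w \<in> (if k' = k then inside (path_image (\<gamma> +++ \<delta>)) else outside (path_image (\<gamma> +++ \<delta>)))"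
proof -
  let ?J = "\<gamma> +++ \<delta>" and ?J' = "\<gamma> +++ \<delta>'"
  have "path \<delta>" "path \<delta>'" using J J' start start' \<open>path \<gamma>\<close> by (metis path_join simple_path_imp_path)+
  have im: "path_image ?J = path_image \<gamma> \<union> path_image \<delta>" "path_image ?J' = path_image \<gamma> \<union> path_image \<delta>'"
    using start start' by (simp_all add: path_image_join)
  have nin: "\<gamma> u \<notin> path_image \<delta>" "\<gamma> u \<notin> path_image \<delta>'"
    using loop_interior_point_notin J J' start start' u by blast+
  define D where "D w = winding_number \<delta>' w - winding_number \<delta> w" for w
  have contD: "continuous (at (\<gamma> u)) D"
    unfolding D_def using nin \<open>path \<delta>\<close> \<open>path \<delta>'\<close> by (intro continuous_intros continuous_at_winding_number)
  let ?S = "- (path_image ?J \<union> path_image ?J')"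
  have Deq: "D w = winding_number ?J' w - winding_number ?J w" if "w \<in> ?S" for w
    using that \<open>path \<gamma>\<close> \<open>path \<delta>\<close> \<open>path \<delta>'\<close> start start' unfolding D_def
    by (simp add: winding_number_join path_image_join)
  have "D w \<in> \<int>" if "w \<in> ?S" for w
    using that J J' by (auto simp: Deq integer_winding_number simple_path_imp_path simp del: pathstart_join pathfinish_join intro!: Ints_diff)
  then obtain \<eta> where \<eta>: "0 < \<eta>" "\<And>w w'. w \<in> ?S \<inter> ball (\<gamma> u) \<eta> \<Longrightarrow> w' \<in> ?S \<inter> ball (\<gamma> u) \<eta> \<Longrightarrow> D w = D w'"
    using continuous_integer_valued_locally_constant[OF contD] by metis
  have "closed (path_image \<delta> \<union> path_image \<delta>')" using \<open>path \<delta>\<close> \<open>path \<delta>'\<close> by (simp add: closed_Un closed_path_image)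
  then obtain \<eta>' where \<eta>': "0 < \<eta>'" "ball (\<gamma> u) \<eta>' \<inter> (path_image \<delta> \<union> path_image \<delta>') = {}"
    using nin by (metis closed_def ComplI UnE open_contains_ball disjoint_eq_subset_Compl)
  define e where "e = min \<eta> \<eta>'"
  have e: "0 < e" "ball (\<gamma> u) e \<subseteq> ball (\<gamma> u) \<eta>" "ball (\<gamma> u) e \<inter> (path_image \<delta> \<union> path_image \<delta>') = {}"
    using \<eta>(1) \<eta>' by (auto simp: e_def)
  have val: "winding_number ?J w = (if w \<in> inside (path_image ?J) then k else 0)" if "w \<notin> path_image ?J" for w
  proof -
    have "w \<in> inside (path_image ?J) \<or> w \<in> outside (path_image ?J)" using that inside_Un_outside by blast
    then show ?thesis
      using wJ winding_number_zero_in_outside[OF simple_path_imp_path[OF J(1)] J(2), of w] by metis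
  qed
  have val': "winding_number ?J' w = (if w \<in> inside (path_image ?J') then k' else 0)" if "w \<notin> path_image ?J'" for w
  proof -
    have "w \<in> inside (path_image ?J') \<or> w \<in> outside (path_image ?J')" using that inside_Un_outside by blast
    then show ?thesis
      using wJ' winding_number_zero_in_outside[OF simple_path_imp_path[OF J'(1)] J'(2), of w] by metis
  qed
  have S: "w \<in> ?S" if "w \<in> ball (\<gamma> u) e" "w \<notin> path_image \<gamma>" for w
    using that e(3) im by blast
  have "\<gamma> u \<in> path_image ?J" using u im by (auto simp: path_image_def)
  then have "\<gamma> u \<in> closure (inside (path_image ?J))" "\<gamma> u \<in> closure (outside (path_image ?J))"
    using Jordan_inside_outside[OF J] by (metis DiffD1 frontier_def)+
  then obtain w1 w2 where w: "w1 \<in> inside (path_image ?J)" "w1 \<in> ball (\<gamma> u) e"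
    "w2 \<in> outside (path_image ?J)" "w2 \<in> ball (\<gamma> u) e"
    using e(1) unfolding closure_approachable by (metis dist_commute mem_ball)
  have nJ: "w1 \<notin> path_image ?J" "w2 \<notin> path_image ?J" "w2 \<notin> inside (path_image ?J)"
    using w inside_no_overlap outside_no_overlap inside_Int_outside by blast+
  have S12: "w1 \<in> ?S" "w2 \<in> ?S" using S w nJ im by blast+
  have "D w1 = D w2" using \<eta>(2)[of w1 w2] S12 w e(2) by blast
  \<comment> \<open>Inside the first loop the difference is \<open>-k\<close> or
    \<open>k' - k\<close>, outside it is \<open>0\<close> or \<open>k'\<close>. The only common
    value is \<open>0\<close> if \<open>k' = k\<close> and \<open>k'\<close> if
    \<open>k' = -k\<close>.\<close>
  then have "D w1 = (if k' = k then 0 else k')"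
    using Deq[OF S12(1)] Deq[OF S12(2)] val[OF nJ(1)] val[OF nJ(2)] val'[of w1] val'[of w2] S12 w nJ k
    by (auto split: if_splits)
  then have *: "winding_number ?J' w - winding_number ?J w = (if k' = k then 0 else k')"
    if "w \<in> ball (\<gamma> u) e" "w \<notin> path_image \<gamma>" for w
  proof -
    have "D w = D w1" using \<eta>(2)[of w w1] S12 S[OF that] w(2) that(1) e(2) by blast
    then show ?thesis using Deq[OF S[OF that]] \<open>D w1 = (if k' = k then 0 else k')\<close> by simp
  qed
  show thesis
  proof (rule that[OF e(1)])
    fix w assume we: "w \<in> ball (\<gamma> u) e"
    show "w \<in> inside (path_image ?J') \<longleftrightarrow> w \<in> (if k' = k then inside (path_image ?J) else outside (path_image ?J))"
    proof (cases "w \<in> path_image \<gamma>")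
      case True
      then have "w \<in> path_image ?J" "w \<in> path_image ?J'" using im by auto
      then have "w \<notin> inside (path_image ?J')" "w \<notin> inside (path_image ?J)" "w \<notin> outside (path_image ?J)"
        using inside_no_overlap outside_no_overlap by blast+
      then show ?thesis by simp
    next
      case False
      then have "w \<notin> path_image ?J" "w \<notin> path_image ?J'" using S[OF we] by auto
      moreover have "w \<in> outside (path_image ?J) \<longleftrightarrow> w \<notin> inside (path_image ?J)"
        using calculation inside_Un_outside[of "path_image ?J"] inside_Int_outside[of "path_image ?J"] by blast
      ultimately show ?thesis using *[OF we False] val[of w] val'[of w] k by (auto split: if_splits)
    qed
  qed
qed

text \<open>An arc \<open>\<rho>\<close> leaves the midpoint of \<open>\<gamma>\<close> into the inside of the given loop and runs off to a large circle
  without meeting \<open>\<gamma>\<close> again. A loop through \<open>\<gamma>\<close> that avoids \<open>\<rho>\<close> and the circle has the initial part of \<open>\<rho>\<close>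
  on its outside, hence the opposite orientation.\<close>

lemma loop_of_opposite_orientation:
  fixes \<gamma> \<delta> :: "real \<Rightarrow> complex"
  assumes "arc \<gamma>" and J: "simple_path (\<gamma> +++ \<delta>)" "pathfinish (\<gamma> +++ \<delta>) = pathstart (\<gamma> +++ \<delta>)"
    and start: "pathstart \<delta> = pathfinish \<gamma>"
    and k: "k \<in> {1, -1}" "\<And>w. w \<in> inside (path_image (\<gamma> +++ \<delta>)) \<Longrightarrow> winding_number (\<gamma> +++ \<delta>) w = k"
  obtains \<delta>' where "simple_path (\<gamma> +++ \<delta>')" "pathfinish (\<gamma> +++ \<delta>') = pathstart (\<gamma> +++ \<delta>')"
    "pathstart \<delta>' = pathfinish \<gamma>"
    "\<And>w. w \<in> inside (path_image (\<gamma> +++ \<delta>')) \<Longrightarrow> winding_number (\<gamma> +++ \<delta>') w = - k"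
proof -
  define J where "J = \<gamma> +++ \<delta>"
  define m where "m = \<gamma> (1/2)"
  have Jm: "J (1/4) = m" by (simp add: J_def m_def joinpaths_def)
  have sJ: "simple_path J" "pathfinish J = pathstart J" using assms J_def by auto
  have "path \<gamma>" using \<open>arc \<gamma>\<close> arc_imp_path by blast
  have imJ: "path_image J = path_image \<gamma> \<union> path_image \<delta>" using start by (simp add: J_def path_image_join)
  note JO = Jordan_inside_outside[OF sJ]
  have m_g: "m \<in> path_image \<gamma>" by (auto simp: m_def path_image_def)
  have mJ: "m \<in> path_image J" using m_g imJ by auto
  have cl: "m \<in> closure (inside (path_image J))"
    using JO mJ by (metis DiffD1 frontier_def)
  obtain g where g: "path g" "pathstart g = m" "path_image g - {m} \<subseteq> inside (path_image J)" "pathfinish g \<in> inside (path_image J)"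
  proof -
    have "m \<notin> inside (path_image J)" using mJ inside_no_overlap by blast
    then show thesis
      using accessible_point[of "inside (path_image J)" m 1 thesis]
        loop_side_locally_connected_at[OF sJ, of "1/4", unfolded Jm] JO cl that by auto
  qed
  have dis: "path_image J \<inter> inside (path_image J) = {}" using inside_no_overlap by blast
  obtain M where M: "path_image \<gamma> \<union> path_image g \<subseteq> ball 0 M" "0 < M"
    using bounded_subset_ballD[of "path_image \<gamma> \<union> path_image g" 0] bounded_path_image \<open>path \<gamma>\<close> g(1) by auto
  obtain h where h: "path h" "path_image h \<subseteq> - path_image \<gamma>" "pathstart h = pathfinish g" "pathfinish h = of_real M"
  proof -
    have "path_connected (- path_image \<gamma>)" using path_connected_arc_complement[OF \<open>arc \<gamma>\<close>] by simp
    moreover have "pathfinish g \<in> - path_image \<gamma>" using g(4) dis imJ by auto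
    moreover have "complex_of_real M \<in> - path_image \<gamma>" using M by auto
    ultimately show thesis using that unfolding path_connected_def by metis
  qed
  have G: "path (g +++ h)" "pathstart (g +++ h) = m" "pathfinish (g +++ h) = of_real M"
    "path_image (g +++ h) = path_image g \<union> path_image h"
    using g h by (auto simp: path_image_join)
  have "m \<in> ball 0 M" using M m_g by auto
  then have "pathstart (g +++ h) \<in> closure (ball 0 M)" "pathfinish (g +++ h) \<notin> ball 0 M"
    using G M closure_subset by auto
  \<comment> \<open>The path is cut where it first leaves the ball, so that \<open>\<rho>\<close>
    will meet the complement of the ball in the single point \<open>q\<close>. Janiszewski's theorem
    then applies to the union \<open>T\<close>.\<close>
  then obtain k' where k': "path k'" "pathstart k' = m" "path_image k' \<subseteq> path_image g \<union> path_image h"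
    "path_image k' - {pathfinish k'} \<subseteq> interior (ball 0 M)" "pathfinish k' \<in> frontier (ball 0 M)"
    using exists_path_subpath_to_frontier[OF G(1), of "ball 0 M"] G by metis
  define q where "q = pathfinish k'"
  have q: "norm q = M" using k'(5) M(2) by (simp add: q_def)
  then have "m \<noteq> q" using \<open>m \<in> ball 0 M\<close> by auto
  then obtain \<rho> where \<rho>: "arc \<rho>" "path_image \<rho> \<subseteq> path_image k'" "pathstart \<rho> = m" "pathfinish \<rho> = q"
    using path_contains_arc[OF k'(1,2), of q] q_def by metis
  define T where "T = path_image \<rho> \<union> - ball 0 M"
  have "closed T" unfolding T_def using closed_arc_image[OF \<rho>(1)] by auto
  have \<rho>g: "path_image \<gamma> \<inter> path_image \<rho> = {m}"
  proof
    have "path_image \<gamma> \<inter> (path_image g - {m}) = {}" using g(3) dis imJ by blast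
    then show "path_image \<gamma> \<inter> path_image \<rho> \<subseteq> {m}" using \<rho>(2) k'(3) h(2) by blast
    show "{m} \<subseteq> path_image \<gamma> \<inter> path_image \<rho>" using m_g \<rho>(3) pathstart_in_path_image[of \<rho>] by auto
  qed
  then have gT: "path_image \<gamma> \<inter> T = {m}" using M(1) by (auto simp: T_def)
  have "path_image \<rho> \<inter> - ball 0 M = {q}"
    using \<rho>(2,4) k'(4) q pathfinish_in_path_image[of \<rho>] by (auto simp: q_def)
  then have "connected (- T)"
    unfolding T_def using connected_arc_complement[OF \<rho>(1)] compact_arc_image[OF \<rho>(1)]
    by (intro Janiszewski_connected) auto
  have "pathstart \<gamma> \<noteq> m" "pathfinish \<gamma> \<noteq> m"
    using \<open>arc \<gamma>\<close> unfolding arc_def inj_on_def m_def pathstart_def pathfinish_def by force+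
  then have "pathstart \<gamma> \<notin> T" "pathfinish \<gamma> \<notin> T" using gT by blast+
  then obtain \<delta>' where \<delta>': "arc \<delta>'" "pathstart \<delta>' = pathfinish \<gamma>" "pathfinish \<delta>' = pathstart \<gamma>"
    "path_image \<gamma> \<inter> path_image \<delta>' \<subseteq> {pathstart \<gamma>, pathfinish \<gamma>}" "path_image \<delta>' \<inter> T = {}"
    using closing_arc_avoiding[OF \<open>arc \<gamma>\<close> \<open>closed T\<close> _ \<open>connected (- T)\<close>] gT by auto
  define J' where "J' = \<gamma> +++ \<delta>'"
  have sJ': "simple_path J'" "pathfinish J' = pathstart J'"
    unfolding J'_def using \<delta>' \<open>arc \<gamma>\<close> by (auto intro!: simple_path_join_loop)
  have imJ': "path_image J' = path_image \<gamma> \<union> path_image \<delta>'" using \<delta>' by (simp add: J'_def path_image_join)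
  have "path_image J' \<subseteq> ball 0 M" using imJ' M(1) \<delta>'(5) by (auto simp: T_def)
  then have "- ball 0 M \<subseteq> outside (path_image J')" by (intro outside_subset_convex) auto
  then have qo: "q \<in> outside (path_image J')" using q by auto
  have rho_out: "path_image \<rho> - {m} \<subseteq> outside (path_image J')"
  proof
    fix w assume w: "w \<in> path_image \<rho> - {m}"
    have eq: "path_image \<rho> - {m} = \<rho> ` {0<..1}"
    proof -
      have "{0..1} = insert 0 {0<..(1::real)}" by auto
      then have "path_image \<rho> = insert m (\<rho> ` {0<..1})" using \<rho>(3) by (simp add: path_image_def pathstart_def)
      moreover have "m \<notin> \<rho> ` {0<..1}"
        using \<rho>(1,3) unfolding arc_def pathstart_def by (auto dest: inj_onD)
      ultimately show ?thesis by auto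
    qed
    have "connected (path_image \<rho> - {m})"
      unfolding eq using arc_imp_path[OF \<rho>(1)] unfolding path_def
      by (intro connected_continuous_image) (auto elim: continuous_on_subset)
    moreover have "path_image \<rho> - {m} \<subseteq> - path_image J'" using imJ' \<delta>'(5) \<rho>g by (auto simp: T_def)
    moreover have "q \<in> path_image \<rho> - {m}" using \<rho>(4) \<open>m \<noteq> q\<close> pathfinish_in_path_image[of \<rho>] by auto
    ultimately have "connected_component (- path_image J') q w"
      using w unfolding connected_component_def by blast
    then show "w \<in> outside (path_image J')" using qo outside_same_component by blast
  qed
  obtain k1 where k1: "k1 \<in> {1, -1}" "\<And>w. w \<in> inside (path_image J') \<Longrightarrow> winding_number J' w = k1"
    using simple_closed_path_winding_number_inside[OF sJ'(1)] by (metis insertCI)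
  have "k1 \<noteq> k"
  proof
    assume "k1 = k"
    then obtain \<eta> where \<eta>: "0 < \<eta>" "\<And>w. w \<in> ball m \<eta> \<Longrightarrow> w \<in> inside (path_image J') \<longleftrightarrow> w \<in> inside (path_image J)"
      using loops_through_arc_compare[OF J start sJ'[unfolded J'_def] \<delta>'(2) \<open>path \<gamma>\<close> k(1) k1(1) k(2) k1(2)[unfolded J'_def], of "1/2"]
      unfolding J_def J'_def m_def by auto
    \<comment> \<open>Near \<open>m\<close> the arc \<open>\<rho>\<close> can only come from
      \<open>g\<close>, hence lies inside \<open>J\<close>: the path \<open>h\<close> avoids
      \<open>\<gamma>\<close> and therefore a whole ball around \<open>m\<close>.\<close>
    have "closed (path_image h)" "m \<notin> path_image h" using h(1,2) m_g by (auto simp: closed_path_image)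
    then obtain \<eta>' where \<eta>': "0 < \<eta>'" "ball m \<eta>' \<inter> path_image h = {}"
      by (metis closed_def ComplI open_contains_ball disjoint_eq_subset_Compl)
    define e where "e = min \<eta> \<eta>'"
    have e: "0 < e" "e \<le> \<eta>" "e \<le> \<eta>'" using \<eta> \<eta>' by (auto simp: e_def)
    obtain w where w: "w \<in> path_image \<rho> - {m}" "w \<in> ball m e"
    proof -
      have "continuous_on {0..1} \<rho>" using \<rho>(1) by (simp add: arc_def path_def)
      then obtain d where d: "d > 0" "\<And>u. u \<in> {0..1} \<Longrightarrow> dist u 0 < d \<Longrightarrow> dist (\<rho> u) (\<rho> 0) < e"
        using e(1) unfolding continuous_on_iff by (metis atLeastAtMost_iff order_refl zero_le_one)
      define u where "u = min (d/2) 1"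
      have u: "0 < u" "u \<le> 1" "u < d" using d by (auto simp: u_def)
      then have "\<rho> u \<noteq> \<rho> 0" using \<rho>(1) unfolding arc_def inj_on_def by force
      then show thesis using that[of "\<rho> u"] d(2)[of u] u \<rho>(3) by (auto simp: path_image_def pathstart_def dist_commute)
    qed
    have "w \<in> inside (path_image J)"
      using w \<rho>(2) k'(3) g(3) \<eta>'(2) e(3) by (auto simp: disjoint_iff)
    then have "w \<in> inside (path_image J')" using \<eta>(2)[of w] w(2) e(2) by simp
    moreover have "w \<in> outside (path_image J')" using w rho_out by auto
    ultimately show False using inside_Int_outside by blast
  qed
  then have "k1 = - k" using k(1) k1(1) by auto
  then show thesis using that[of \<delta>'] sJ' \<delta>'(2) k1(2) unfolding J'_def by auto
qed

lemma arc_on_loop_of_orientation: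
  fixes \<gamma> :: "real \<Rightarrow> complex"
  assumes "arc \<gamma>" "k \<in> {1, -1}"
  obtains \<delta> where "simple_path (\<gamma> +++ \<delta>)" "pathfinish (\<gamma> +++ \<delta>) = pathstart (\<gamma> +++ \<delta>)"
    "pathstart \<delta> = pathfinish \<gamma>"
    "\<And>w. w \<in> inside (path_image (\<gamma> +++ \<delta>)) \<Longrightarrow> winding_number (\<gamma> +++ \<delta>) w = k"
proof -
  obtain \<delta> where \<delta>: "arc \<delta>" "pathstart \<delta> = pathfinish \<gamma>" "pathfinish \<delta> = pathstart \<gamma>"
    "path_image \<gamma> \<inter> path_image \<delta> \<subseteq> {pathstart \<gamma>, pathfinish \<gamma>}"
    using closing_arc_avoiding[OF assms(1), of "{}"] by auto
  have J: "simple_path (\<gamma> +++ \<delta>)" "pathfinish (\<gamma> +++ \<delta>) = pathstart (\<gamma> +++ \<delta>)"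
    using \<delta> assms(1) by (auto intro!: simple_path_join_loop)
  obtain k' where k': "k' \<in> {1, -1}" "\<And>w. w \<in> inside (path_image (\<gamma> +++ \<delta>)) \<Longrightarrow> winding_number (\<gamma> +++ \<delta>) w = k'"
    using simple_closed_path_winding_number_inside[OF J(1)] by (metis insertCI)
  show thesis
  proof (cases "k' = k")
    case True
    then show thesis using that J \<delta>(2) k'(2) by blast
  next
    case False
    then have "k = - k'" using k'(1) assms(2) by auto
    then show thesis using loop_of_opposite_orientation[OF assms(1) J \<delta>(2) k'] that by metis
  qed
qed

section \<open>Sides of an edge\<close>

text \<open>The value of d at 0 does not enter \<open>g +++ d\<close>, so a factorisation of a loop need not have matching ends.\<close>

lemma joinpaths_change_start:
  assumes "J = g +++ d"
  obtains d' where "J = g +++ d'" "pathstart d' = pathfinish g"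
proof (rule that)
  show "J = g +++ (\<lambda>t. if t = 0 then g 1 else d t)"
    using assms by (auto simp: joinpaths_def fun_eq_iff)
  show "pathstart (\<lambda>t. if t = 0 then g 1 else d t) = pathfinish g"
    by (simp add: pathstart_def pathfinish_def)
qed

locale embedded_graph =
  fixes G :: "('v,'e) pgraph"
  assumes plane: "plane_graph G"
begin

lemma finite_verts: "finite (verts G)" and finite_edges: "finite (edges G)"
  using plane by (simp_all add: plane_graph_def)

lemma src_in: "e \<in> edges G \<Longrightarrow> src G e \<in> verts G" and tgt_in: "e \<in> edges G \<Longrightarrow> tgt G e \<in> verts G"
  using plane by (simp_all add: plane_graph_def)

lemma pathstart_ecurve: "e \<in> edges G \<Longrightarrow> pathstart (ecurve G e) = vpos G (src G e)"
  and pathfinish_ecurve: "e \<in> edges G \<Longrightarrow> pathfinish (ecurve G e) = vpos G (tgt G e)"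
  and ecurve_cases: "e \<in> edges G \<Longrightarrow> if src G e = tgt G e then simple_path (ecurve G e) else arc (ecurve G e)"
  using plane by (simp_all add: plane_graph_def)

lemma arc_ecurve: "e \<in> edges G \<Longrightarrow> src G e \<noteq> tgt G e \<Longrightarrow> arc (ecurve G e)"
  using ecurve_cases[of e] by simp

lemma simple_path_ecurve: "e \<in> edges G \<Longrightarrow> simple_path (ecurve G e)"
  using ecurve_cases[of e] arc_imp_simple_path by (auto split: if_splits)

lemma verts_connected: "u \<in> verts G \<Longrightarrow> v \<in> verts G \<Longrightarrow> (u, v) \<in> (uedge G)\<^sup>*"
  using plane by (simp add: plane_graph_def)

lemma path_ecurve: "e \<in> edges G \<Longrightarrow> path (ecurve G e)"
  using simple_path_ecurve simple_path_imp_path by blast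

lemma path_image_ecurve_subset: "e \<in> edges G \<Longrightarrow> path_image (ecurve G e) \<subseteq> gset G"
  by (auto simp: gset_def)

lemma compact_gset: "compact (gset G)"
  unfolding gset_def using finite_verts finite_edges path_ecurve
  by (auto intro!: compact_Un compact_UN compact_path_image intro: finite_imp_compact)

lemma open_compl_gset: "open (- gset G)"
  using compact_gset by (simp add: compact_imp_closed open_Compl)

lemma open_region: "Q \<in> regions G \<Longrightarrow> open Q"
  unfolding regions_def using open_components[OF open_compl_gset] by blast

lemma connected_region: "Q \<in> regions G \<Longrightarrow> connected Q"
  unfolding regions_def using in_components_connected by blast

lemma region_nonempty: "Q \<in> regions G \<Longrightarrow> Q \<noteq> {}"
  unfolding regions_def using in_components_nonempty by blast

lemma region_subset: "Q \<in> regions G \<Longrightarrow> Q \<subseteq> - gset G"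
  unfolding regions_def using in_components_subset by blast

lemma regions_eqI: "Q \<in> regions G \<Longrightarrow> R \<in> regions G \<Longrightarrow> w \<in> Q \<Longrightarrow> w \<in> R \<Longrightarrow> Q = R"
  unfolding regions_def using components_nonoverlap by blast

text \<open>An open set that meets the closure of \<open>R\<close> meets \<open>R\<close>. Faces are
  closures of regions, so a face may stand for its region.\<close>

lemma closure_region_inj:
  assumes "Q \<in> regions G" "R \<in> regions G" "closure Q = closure R"
  shows "Q = R"
proof -
  have "Q \<inter> closure R \<noteq> {}"
    using assms(3) closure_subset[of Q] region_nonempty[OF assms(1)] by blast
  then have "Q \<inter> R \<noteq> {}" using open_region[OF assms(1)] by (simp add: open_Int_closure_eq_empty)
  then show ?thesis using regions_eqI assms(1,2) by blast
qed

lemma ball_meets_only_edge: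
  assumes "e \<in> edges G" "0 < u" "u < 1"
  obtains \<epsilon> where "0 < \<epsilon>" "ball (ecurve G e u) \<epsilon> \<inter> gset G \<subseteq> path_image (ecurve G e)"
proof -
  let ?K = "vpos G ` verts G \<union> (\<Union>e'\<in>edges G - {e}. path_image (ecurve G e'))"
  have "closed ?K" using finite_verts finite_edges path_ecurve
    by (auto intro!: closed_Un closed_UN closed_path_image intro: finite_imp_closed)
  moreover have x: "ecurve G e u \<notin> vpos G ` verts G"
    using assms plane by (auto simp: plane_graph_def)
  have "ecurve G e u \<notin> ?K"
  proof
    assume "ecurve G e u \<in> ?K"
    then obtain e' where "e' \<in> edges G" "e' \<noteq> e" "ecurve G e u \<in> path_image (ecurve G e')" using x by blast
    moreover have "ecurve G e u \<in> path_image (ecurve G e)" using assms by (auto simp: path_image_def)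
    ultimately show False using x assms plane unfolding plane_graph_def by blast
  qed
  ultimately obtain \<epsilon> where "0 < \<epsilon>" "ball (ecurve G e u) \<epsilon> \<subseteq> - ?K"
    by (meson ComplI closed_def open_contains_ball)
  then show thesis by (intro that[of \<epsilon>]) (auto simp: gset_def)
qed

text \<open>Close to an interior point of \<open>e\<close> the graph is contained in
  \<open>e\<close>, hence in \<open>J\<close>, so points of \<open>S\<close> near it are joined
  within the complement of the graph. \<open>J\<close> is left general to cover an edge completed to
  a loop as well as a loop edge itself.\<close>

lemma loop_side_in_region:
  assumes e: "e \<in> edges G" "0 < u" "u < 1"
    and J: "simple_path J" "pathfinish J = pathstart J" "0 < v" "v < 1" "J v = ecurve G e u"
    and sub: "path_image (ecurve G e) \<subseteq> path_image J"
    and S: "S = inside (path_image J) \<or> S = outside (path_image J)"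
  shows "\<exists>Q\<in>regions G. \<exists>\<eta>>0. S \<inter> ball (ecurve G e u) \<eta> \<subseteq> Q"
proof -
  let ?x = "ecurve G e u"
  obtain \<epsilon> where \<epsilon>: "0 < \<epsilon>" "ball ?x \<epsilon> \<inter> gset G \<subseteq> path_image (ecurve G e)"
    using ball_meets_only_edge[OF e] .
  have SJ: "S \<inter> path_image J = {}" using S inside_no_overlap outside_no_overlap by blast
  obtain \<delta> where \<delta>: "0 < \<delta>" "\<And>x y. x\<in>S \<inter> ball ?x \<delta> \<Longrightarrow> y\<in>S \<inter> ball ?x \<delta> \<Longrightarrow> connected_component (S \<inter> ball ?x \<epsilon>) x y"
    using loop_side_locally_connected_at[OF J(1-4) \<epsilon>(1) S] J(5) by auto
  have "?x \<in> path_image J" using J(3-5) by (auto simp: path_image_def intro: image_eqI[of _ _ v])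
  then have "?x \<in> closure S"
    using S Jordan_inside_outside[OF J(1,2)] by (metis DiffD1 frontier_def)
  then obtain w where w: "w \<in> S \<inter> ball ?x \<delta>"
    using \<delta>(1) unfolding closure_approachable by (metis IntI dist_commute mem_ball)
  have sub': "S \<inter> ball ?x \<epsilon> \<subseteq> - gset G" using \<epsilon>(2) SJ sub by blast
  have "connected_component (- gset G) w y" if "y \<in> S \<inter> ball ?x \<delta>" for y
    using \<delta>(2)[OF w that] sub' connected_component_of_subset by blast
  moreover from this[OF w] have "w \<in> - gset G" by (meson connected_component_in)
  ultimately show ?thesis
    using \<delta>(1) unfolding regions_def
    by (intro bexI[of _ "connected_component_set (- gset G) w"] exI[of _ \<delta>]) (auto simp: components_iff)
qed

text \<open>The region found at the parameter \<open>u\<close> is locally constant in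
  \<open>u\<close>, because the side \<open>S\<close> has points close to both \<open>u\<close> and
  a neighbouring \<open>v\<close>. Connectedness of the open unit interval makes it globally
  constant.\<close>

lemma edge_loop_side_in_region:
  assumes e: "e \<in> edges G"
    and J: "simple_path (ecurve G e +++ \<delta>)" "pathfinish (ecurve G e +++ \<delta>) = pathstart (ecurve G e +++ \<delta>)"
      "pathstart \<delta> = pathfinish (ecurve G e)"
    and S: "S = inside (path_image (ecurve G e +++ \<delta>)) \<or> S = outside (path_image (ecurve G e +++ \<delta>))"
  shows "\<exists>Q\<in>regions G. \<forall>u\<in>{0<..<1}. \<exists>\<eta>>0. S \<inter> ball (ecurve G e u) \<eta> \<subseteq> Q"
proof -
  let ?\<gamma> = "ecurve G e"
  have sub: "path_image ?\<gamma> \<subseteq> path_image (?\<gamma> +++ \<delta>)" using J(3) by (simp add: path_image_join)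
  have "\<exists>Q\<in>regions G. \<exists>\<eta>>0. S \<inter> ball (?\<gamma> u) \<eta> \<subseteq> Q" if "u \<in> {0<..<1}" for u
    using that loop_side_in_region[OF e _ _ J(1,2) _ _ _ sub S, of u "u/2"] by (simp add: joinpaths_def)
  then obtain Q \<eta> where Q: "\<And>u. u \<in> {0<..<1} \<Longrightarrow> Q u \<in> regions G" "\<And>u. u \<in> {0<..<1} \<Longrightarrow> \<eta> u > 0"
    "\<And>u. u \<in> {0<..<1} \<Longrightarrow> S \<inter> ball (?\<gamma> u) (\<eta> u) \<subseteq> Q u"
    by metis
  have ev: "eventually (\<lambda>v. Q u = Q v) (at u within {0<..<1})" if u: "u \<in> {0<..<1}" for u
  proof -
    have "continuous_on {0<..<1} ?\<gamma>"
      using path_ecurve[OF e] unfolding path_def by (rule continuous_on_subset) auto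
    then have "(?\<gamma> \<longlongrightarrow> ?\<gamma> u) (at u within {0<..<1})"
      using u by (auto simp: continuous_on_def)
    then have "eventually (\<lambda>v. dist (?\<gamma> v) (?\<gamma> u) < \<eta> u) (at u within {0<..<1})"
      using Q(2)[OF u] by (simp add: tendsto_iff)
    moreover have "eventually (\<lambda>v. v \<in> {0<..<1}) (at u within {0<..<1})"
      by (simp add: eventually_at_filter)
    ultimately show ?thesis
    proof eventually_elim
      case (elim v)
      have "?\<gamma> v \<in> path_image (?\<gamma> +++ \<delta>)" using sub elim(2) by (auto simp: path_image_def)
      then have "?\<gamma> v \<in> closure S"
        using S Jordan_inside_outside[OF J(1,2)] by (metis DiffD1 frontier_def)
      \<comment> \<open>This radius puts \<open>w\<close> in the ball of \<open>v\<close> and, by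
        the triangle inequality, in the ball of \<open>u\<close>.\<close>
      moreover have "0 < min (\<eta> v) (\<eta> u - dist (?\<gamma> v) (?\<gamma> u))" using elim Q(2) by auto
      ultimately obtain w where w: "w \<in> S" "dist w (?\<gamma> v) < min (\<eta> v) (\<eta> u - dist (?\<gamma> v) (?\<gamma> u))"
        unfolding closure_approachable by blast
      have "w \<in> Q v" using Q(3)[OF elim(2)] w by (auto simp: dist_commute)
      moreover have "dist (?\<gamma> u) w < \<eta> u" using w(2) dist_triangle[of w "?\<gamma> u" "?\<gamma> v"] by (simp add: dist_commute)
      then have "w \<in> Q u" using Q(3)[OF u] w(1) by auto
      ultimately show ?case using Q(1) u elim(2) regions_eqI by blast
    qed
  qed
  have half: "(1/2::real) \<in> {0<..<1}" by simp
  have "Q u = Q (1/2)" if "u \<in> {0<..<1}" for u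
    by (rule connected_local_const[OF _ that half]) (use ev in auto)
  then show ?thesis using Q half by (intro bexI[of _ "Q (1/2)"]) (metis, blast)
qed

text \<open>One counterclockwise loop along \<open>e\<close> serves as a reference. The definition
  of sides looks only at the midpoint, but gluing regions along edges requires the statement at
  every interior point of the edge.\<close>

definition edge_sides :: "'e \<Rightarrow> complex set \<Rightarrow> complex set \<Rightarrow> (real \<Rightarrow> complex) \<Rightarrow> bool" where
  "edge_sides e L R \<delta> \<longleftrightarrow> L \<in> regions G \<and> R \<in> regions G \<and>
     (let J = ecurve G e +++ \<delta> in simple_path J \<and> pathfinish J = pathstart J \<and>
     pathstart \<delta> = pathfinish (ecurve G e) \<and> (\<forall>w\<in>inside (path_image J). winding_number J w = 1) \<and>
     (\<forall>u\<in>{0<..<1}. \<exists>\<eta>>0. inside (path_image J) \<inter> ball (ecurve G e u) \<eta> \<subseteq> L \<and>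
                           outside (path_image J) \<inter> ball (ecurve G e u) \<eta> \<subseteq> R))"

lemma edge_sides_exist:
  assumes "e \<in> edges G" "src G e \<noteq> tgt G e"
  obtains L R \<delta> where "edge_sides e L R \<delta>"
proof -
  have arc: "arc (ecurve G e)" using arc_ecurve assms by blast
  obtain \<delta> where \<delta>: "simple_path (ecurve G e +++ \<delta>)" "pathfinish (ecurve G e +++ \<delta>) = pathstart (ecurve G e +++ \<delta>)"
    "pathstart \<delta> = pathfinish (ecurve G e)"
    "\<And>w. w \<in> inside (path_image (ecurve G e +++ \<delta>)) \<Longrightarrow> winding_number (ecurve G e +++ \<delta>) w = 1"
    using arc_on_loop_of_orientation[OF arc, of 1] by blast
  let ?J = "ecurve G e +++ \<delta>"
  obtain L where L: "L \<in> regions G" "\<And>u. u \<in> {0<..<1} \<Longrightarrow> \<exists>\<eta>>0. inside (path_image ?J) \<inter> ball (ecurve G e u) \<eta> \<subseteq> L"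
    using edge_loop_side_in_region[OF assms(1) \<delta>(1-3) disjI1[OF refl]] by blast
  obtain R where R: "R \<in> regions G" "\<And>u. u \<in> {0<..<1} \<Longrightarrow> \<exists>\<eta>>0. outside (path_image ?J) \<inter> ball (ecurve G e u) \<eta> \<subseteq> R"
    using edge_loop_side_in_region[OF assms(1) \<delta>(1-3) disjI2[OF refl]] by blast
  have "\<exists>\<eta>>0. inside (path_image ?J) \<inter> ball (ecurve G e u) \<eta> \<subseteq> L \<and> outside (path_image ?J) \<inter> ball (ecurve G e u) \<eta> \<subseteq> R"
    if u: "u \<in> {0<..<1}" for u
  proof -
    obtain a b where "a > 0" "inside (path_image ?J) \<inter> ball (ecurve G e u) a \<subseteq> L"
      "b > 0" "outside (path_image ?J) \<inter> ball (ecurve G e u) b \<subseteq> R"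
      using L(2)[OF u] R(2)[OF u] by blast
    then show ?thesis by (intro exI[of _ "min a b"]) auto
  qed
  then show thesis using that[of L R \<delta>] L(1) R(1) \<delta> unfolding edge_sides_def Let_def by blast
qed

text \<open>Any other loop along \<open>e\<close> is compared with the reference loop: near the
  midpoint its inside is the inside of the reference if the orientations agree and the outside if
  they are opposite. Hence exactly one region lies on each side.\<close>

lemma side_region_iff:
  assumes e: "e \<in> edges G" "src G e \<noteq> tgt G e" and es: "edge_sides e L R \<delta>" and Q: "Q \<in> regions G"
    and k: "k \<in> {1, -1}"
  shows "side_region G k e Q \<longleftrightarrow> Q = (if k = 1 then L else R)"
proof -
  let ?J = "ecurve G e +++ \<delta>" and ?m = "ecurve G e (1/2)"
  have J: "simple_path ?J" "pathfinish ?J = pathstart ?J" "pathstart \<delta> = pathfinish (ecurve G e)"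
    "\<And>w. w\<in>inside (path_image ?J) \<Longrightarrow> winding_number ?J w = 1"
    and LR: "L \<in> regions G" "R \<in> regions G"
    and loc: "\<forall>u\<in>{0<..<1}. \<exists>\<eta>>0. inside (path_image ?J) \<inter> ball (ecurve G e u) \<eta> \<subseteq> L \<and>
                           outside (path_image ?J) \<inter> ball (ecurve G e u) \<eta> \<subseteq> R"
    using es unfolding edge_sides_def Let_def by blast+
  have half: "(1/2::real) \<in> {0<..<1}" by simp
  obtain \<eta> where \<eta>: "\<eta> > 0" "inside (path_image ?J) \<inter> ball ?m \<eta> \<subseteq> L" "outside (path_image ?J) \<inter> ball ?m \<eta> \<subseteq> R"
    using loc[rule_format, OF half] by blast
  have arc: "arc (ecurve G e)" using arc_ecurve e by blast
  have path: "path (ecurve G e)" using path_ecurve e by blast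
  let ?Q = "if k = 1 then L else R"
  have key: "\<exists>\<eta>>0. inside (path_image (ecurve G e +++ d)) \<inter> ball ?m \<eta> \<subseteq> ?Q"
    if d: "simple_path (ecurve G e +++ d)" "pathfinish (ecurve G e +++ d) = pathstart (ecurve G e +++ d)"
      "pathstart d = pathfinish (ecurve G e)"
      "\<And>w. w\<in>inside (path_image (ecurve G e +++ d)) \<Longrightarrow> winding_number (ecurve G e +++ d) w = k" for d
  proof -
    obtain \<eta>' where \<eta>': "0 < \<eta>'" "\<And>w. w \<in> ball ?m \<eta>' \<Longrightarrow> w \<in> inside (path_image (ecurve G e +++ d))
     \<longleftrightarrow> w \<in> (if k = 1 then inside (path_image ?J) else outside (path_image ?J))"
      using loops_through_arc_compare[OF J(1-3) d(1-3) path _ k J(4) d(4), of "1/2"] by auto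
    show ?thesis
      by (rule exI[of _ "min \<eta> \<eta>'"]) (use \<eta> \<eta>' in \<open>auto split: if_splits\<close>)
  qed
  show ?thesis
  proof
    assume "side_region G k e Q"
    then obtain J' d0 where J': "simple_path J'" "pathfinish J' = pathstart J'" "J' = ecurve G e +++ d0"
      "\<And>w. w\<in>inside (path_image J') \<Longrightarrow> winding_number J' w = k"
      "\<And>\<epsilon>. \<epsilon> > 0 \<Longrightarrow> \<exists>w\<in>Q \<inter> inside (path_image J'). dist w ?m < \<epsilon>"
      using e(2) unfolding side_region_def by auto
    obtain d where d: "J' = ecurve G e +++ d" "pathstart d = pathfinish (ecurve G e)"
      using joinpaths_change_start[OF J'(3)] .
    obtain \<eta>' where \<eta>': "0 < \<eta>'" "inside (path_image J') \<inter> ball ?m \<eta>' \<subseteq> ?Q"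
      using key[of d] J'(1,2,4) d by auto
    obtain w where "w \<in> Q" "w \<in> inside (path_image J')" "dist w ?m < \<eta>'" using J'(5)[OF \<eta>'(1)] by blast
    then have "w \<in> Q" "w \<in> ?Q" using \<eta>'(2) by (auto simp: dist_commute)
    then show "Q = ?Q" using Q LR regions_eqI by (cases "k = 1") auto
  next
    assume QQ: "Q = ?Q"
    obtain d where d: "simple_path (ecurve G e +++ d)" "pathfinish (ecurve G e +++ d) = pathstart (ecurve G e +++ d)"
      "pathstart d = pathfinish (ecurve G e)"
      "\<And>w. w\<in>inside (path_image (ecurve G e +++ d)) \<Longrightarrow> winding_number (ecurve G e +++ d) w = k"
      using arc_on_loop_of_orientation[OF arc k] by blast
    let ?J' = "ecurve G e +++ d"
    obtain \<eta>' where \<eta>': "0 < \<eta>'" "inside (path_image ?J') \<inter> ball ?m \<eta>' \<subseteq> Q"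
      using key[OF d] QQ by auto
    have "?m \<in> path_image ?J'" using d(3) by (auto simp: path_image_join) (auto simp: path_image_def)
    then have cl: "?m \<in> closure (inside (path_image ?J'))"
      using Jordan_inside_outside[OF d(1,2)] by (metis DiffD1 frontier_def)
    have "\<exists>w\<in>Q \<inter> inside (path_image ?J'). dist w ?m < \<epsilon>" if pos: "\<epsilon> > 0" for \<epsilon>
    proof -
      obtain w where "w \<in> inside (path_image ?J')" "dist w ?m < min \<epsilon> \<eta>'"
        using cl pos \<eta>'(1) unfolding closure_approachable by (metis min_less_iff_conj)
      then show ?thesis using \<eta>'(2) by (intro bexI[of _ w]) (auto simp: dist_commute)
    qed
    then show "side_region G k e Q"
      unfolding side_region_def using d e(2) by (intro exI[of _ ?J']) auto
  qed
qed

end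

section \<open>Winding numbers of closed walks\<close>

text \<open>Signed walks are lists of edges, each with a flag telling whether it is traversed forwards.\<close>

fun ssrc :: "('v,'e) pgraph \<Rightarrow> 'e \<times> bool \<Rightarrow> 'v" where
  "ssrc G (e, b) = (if b then src G e else tgt G e)"

fun stgt :: "('v,'e) pgraph \<Rightarrow> 'e \<times> bool \<Rightarrow> 'v" where
  "stgt G (e, b) = (if b then tgt G e else src G e)"

primrec swalk :: "('v,'e) pgraph \<Rightarrow> 'v \<Rightarrow> ('e \<times> bool) list \<Rightarrow> 'v \<Rightarrow> bool" where
  "swalk G a [] b \<longleftrightarrow> a = b \<and> a \<in> verts G"
| "swalk G a (x # l) b \<longleftrightarrow> fst x \<in> edges G \<and> ssrc G x = a \<and> swalk G (stgt G x) l b"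

primrec scurve :: "('v,'e) pgraph \<Rightarrow> 'v \<Rightarrow> ('e \<times> bool) list \<Rightarrow> real \<Rightarrow> complex" where
  "scurve G a [] = linepath (vpos G a) (vpos G a)"
| "scurve G a (x # l) = (if snd x then ecurve G (fst x) else reversepath (ecurve G (fst x))) +++ scurve G (stgt G x) l"

definition sgnb :: "bool \<Rightarrow> int" where "sgnb b = (if b then 1 else -1)"

definition ecount :: "('e \<times> bool) list \<Rightarrow> 'e \<Rightarrow> int" where
  "ecount l e = (\<Sum>x\<leftarrow>l. if fst x = e then sgnb (snd x) else 0)"

text \<open>The summands belong to curves that need not be closed, so they are not integers in
  general. Keeping them separate allows the contribution of a single edge to be isolated.\<close>

definition swind :: "('v,'e) pgraph \<Rightarrow> ('e \<times> bool) list \<Rightarrow> complex \<Rightarrow> complex" where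
  "swind G l w = (\<Sum>x\<leftarrow>l. of_int (sgnb (snd x)) * winding_number (ecurve G (fst x)) w)"

lemma swind_Cons [simp]: "swind G (x # l) w = of_int (sgnb (snd x)) * winding_number (ecurve G (fst x)) w + swind G l w"
  and swind_Nil [simp]: "swind G [] w = 0"
  by (simp_all add: swind_def)

lemma swind_split:
  "swind G l w = of_int (ecount l e) * winding_number (ecurve G e) w + swind G (filter (\<lambda>x. fst x \<noteq> e) l) w"
  by (induction l) (auto simp: ecount_def algebra_simps)

lemma swalk_edges: "swalk G a l b \<Longrightarrow> fst ` set l \<subseteq> edges G"
  by (induction l arbitrary: a) auto

context embedded_graph
begin

lemma scurve_props:
  assumes "swalk G a l b"
  shows "path (scurve G a l)" "pathstart (scurve G a l) = vpos G a" "pathfinish (scurve G a l) = vpos G b"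
    "path_image (scurve G a l) \<subseteq> gset G"
    "w \<notin> gset G \<Longrightarrow> winding_number (scurve G a l) w = swind G l w"
proof -
  have "path (scurve G a l) \<and> pathstart (scurve G a l) = vpos G a \<and> pathfinish (scurve G a l) = vpos G b \<and>
    path_image (scurve G a l) \<subseteq> gset G \<and> (w \<notin> gset G \<longrightarrow> winding_number (scurve G a l) w = swind G l w)" for w
    using assms
  proof (induction l arbitrary: a)
    case Nil
    then have "w \<notin> gset G \<Longrightarrow> winding_number (linepath (vpos G a) (vpos G a)) w = 0"
      by (intro winding_number_trivial) (auto simp: gset_def)
    moreover have "path_image (linepath (vpos G a) (vpos G a)) \<subseteq> gset G" "vpos G a = vpos G b"
      using Nil by (auto simp: gset_def path_image_def)
    ultimately show ?case unfolding scurve.simps swind_Nil using path_linepath pathstart_linepath pathfinish_linepath by metis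
  next
    case (Cons x l)
    obtain e b' where x: "x = (e, b')" by (cases x)
    let ?c = "if b' then ecurve G e else reversepath (ecurve G e)" and ?r = "scurve G (stgt G x) l"
    have e: "e \<in> edges G" and a: "ssrc G x = a" using Cons.prems x by auto
    have c: "path ?c" "pathstart ?c = vpos G a" "pathfinish ?c = vpos G (stgt G x)" "path_image ?c \<subseteq> gset G"
      using e a path_ecurve pathstart_ecurve pathfinish_ecurve path_image_ecurve_subset by (auto simp: x)
    have eq: "scurve G a (x # l) = ?c +++ ?r" by (simp add: x)
    have r: "path ?r" "pathstart ?r = vpos G (stgt G x)" "pathfinish ?r = vpos G b" "path_image ?r \<subseteq> gset G"
      "w \<notin> gset G \<Longrightarrow> winding_number ?r w = swind G l w"
      using Cons.IH[of "stgt G x"] Cons.prems by auto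
    have "winding_number (?c +++ ?r) w = swind G (x # l) w" if "w \<notin> gset G"
    proof -
      have "winding_number (?c +++ ?r) w = winding_number ?c w + winding_number ?r w"
        using c r that path_image_ecurve_subset[OF e] by (intro winding_number_join) (auto split: if_splits)
      moreover have "w \<notin> path_image (ecurve G e)" using that path_image_ecurve_subset[OF e] by blast
      then have "winding_number ?c w = of_int (sgnb b') * winding_number (ecurve G e) w"
        using path_ecurve[OF e] by (simp add: winding_number_reversepath sgnb_def)
      ultimately show ?thesis using r(5)[OF that] by (simp add: x)
    qed
    moreover have "path_image (?c +++ ?r) \<subseteq> gset G" using c r by (simp add: path_image_join)
    ultimately show ?case unfolding eq using c(1-3) r(1-3) by simp
  qed
  then show "path (scurve G a l)" "pathstart (scurve G a l) = vpos G a" "pathfinish (scurve G a l) = vpos G b"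
    "path_image (scurve G a l) \<subseteq> gset G"
    "w \<notin> gset G \<Longrightarrow> winding_number (scurve G a l) w = swind G l w" by auto
qed

text \<open>The region touching the loop from inside cannot cross it, so it is bounded, and whatever
  the orientation of the loop it is on one of its sides. A loop edge would thus lie on a boundary
  path of a bounded face; such paths repeat no vertex, which is how loops are ruled out.\<close>

lemma loop_edge_has_bounded_side:
  assumes e: "e \<in> edges G" "src G e = tgt G e"
  obtains Q where "Q \<in> regions G" "bounded Q" "side_region G 1 e Q \<or> side_region G (-1) e Q"
proof -
  let ?J = "ecurve G e" and ?m = "ecurve G e (1/2)"
  have J: "simple_path ?J" "pathfinish ?J = pathstart ?J"
    using e simple_path_ecurve pathstart_ecurve pathfinish_ecurve by auto
  obtain Q \<eta> where Q: "Q \<in> regions G" "\<eta> > 0" "inside (path_image ?J) \<inter> ball ?m \<eta> \<subseteq> Q"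
    using loop_side_in_region[OF e(1), of "1/2" ?J "1/2" "inside (path_image ?J)"] J by auto
  have "?m \<in> path_image ?J" by (auto simp: path_image_def)
  then have cl: "?m \<in> closure (inside (path_image ?J))"
    using Jordan_inside_outside[OF J] by (metis DiffD1 frontier_def)
  have near: "\<exists>w\<in>Q \<inter> inside (path_image ?J). dist w ?m < \<epsilon>" if pos: "\<epsilon> > 0" for \<epsilon>
  proof -
    obtain w where "w \<in> inside (path_image ?J)" "dist w ?m < min \<epsilon> \<eta>"
      using cl pos Q(2) unfolding closure_approachable by (metis min_less_iff_conj)
    then show ?thesis using Q(3) by (intro bexI[of _ w]) (auto simp: dist_commute)
  qed
  have "Q \<subseteq> inside (path_image ?J)"
  proof
    fix y assume y: "y \<in> Q"
    obtain w where w: "w \<in> Q" "w \<in> inside (path_image ?J)" using near[of 1] by auto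
    have "Q \<subseteq> - path_image ?J" using region_subset[OF Q(1)] path_image_ecurve_subset[OF e(1)] by blast
    then have "connected_component (- path_image ?J) w y"
      using connected_region[OF Q(1)] w y unfolding connected_component_def by blast
    then show "y \<in> inside (path_image ?J)" using w inside_same_component by blast
  qed
  then have "bounded Q" using Jordan_inside_outside[OF J] bounded_subset by blast
  moreover have "side_region G 1 e Q \<or> side_region G (-1) e Q"
    using simple_closed_path_winding_number_inside[OF J(1)]
  proof cases
    case 1
    then have "side_region G 1 e Q" unfolding side_region_def using J e(2) near by (intro exI[of _ ?J]) auto
    then show ?thesis by simp
  next
    case 2
    then have "side_region G (-1) e Q" unfolding side_region_def using J e(2) near by (intro exI[of _ ?J]) auto
    then show ?thesis by simp
  qed
  ultimately show thesis using that Q(1) by blast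
qed

definition ext_region :: "complex set" where
  "ext_region = (THE R. R \<in> regions G \<and> \<not> bounded R)"

lemma ext_region: "ext_region \<in> regions G" "\<not> bounded ext_region"
  and ext_region_unique: "Q \<in> regions G \<Longrightarrow> \<not> bounded Q \<Longrightarrow> Q = ext_region"
proof -
  have b: "bounded (- (- gset G))" using compact_gset by (simp add: compact_imp_bounded)
  have ex1: "\<exists>!R. R \<in> regions G \<and> \<not> bounded R"
    using cobounded_unbounded_components[OF b] cobounded_unique_unbounded_components[OF b]
    unfolding regions_def by (metis DIM_complex order_refl)
  from theI'[OF this] show "ext_region \<in> regions G" "\<not> bounded ext_region" by (auto simp: ext_region_def)
  then show "Q \<in> regions G \<Longrightarrow> \<not> bounded Q \<Longrightarrow> Q = ext_region" using ex1 by blast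
qed

lemma ext_face_eq: "ext_face G = closure ext_region"
  by (simp add: ext_face_def ext_region_def)

lemma interior_faces_eq: "interior_faces G = closure ` (regions G - {ext_region})"
  unfolding interior_faces_def using ext_region ext_region_unique by blast

end

section \<open>Left and right regions of the edges, and connectedness of the dual graph\<close>

locale loopless_plane_graph = embedded_graph G for G :: "('v,'e) pgraph" +
  assumes loopless: "e \<in> edges G \<Longrightarrow> src G e \<noteq> tgt G e"
begin

definition sides :: "'e \<Rightarrow> complex set \<times> complex set \<times> (real \<Rightarrow> complex)" where
  "sides e = (SOME (L, R, \<delta>). edge_sides e L R \<delta>)"

definition lreg :: "'e \<Rightarrow> complex set" where "lreg e = fst (sides e)"
definition rreg :: "'e \<Rightarrow> complex set" where "rreg e = fst (snd (sides e))"
definition closing :: "'e \<Rightarrow> real \<Rightarrow> complex" where "closing e = snd (snd (sides e))"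

lemma edge_sides: "e \<in> edges G \<Longrightarrow> edge_sides e (lreg e) (rreg e) (closing e)"
proof -
  assume "e \<in> edges G"
  then obtain L R \<delta> where "edge_sides e L R \<delta>" using edge_sides_exist loopless by metis
  then have "case (L, R, \<delta>) of (L, R, \<delta>) \<Rightarrow> edge_sides e L R \<delta>" by simp
  then have "case sides e of (L, R, \<delta>) \<Rightarrow> edge_sides e L R \<delta>" unfolding sides_def by (rule someI)
  then show ?thesis by (simp add: lreg_def rreg_def closing_def split: prod.splits)
qed

lemma lreg_in: "e \<in> edges G \<Longrightarrow> lreg e \<in> regions G" and rreg_in: "e \<in> edges G \<Longrightarrow> rreg e \<in> regions G"
  using edge_sides by (auto simp: edge_sides_def)

lemma left_of_iff: "e \<in> edges G \<Longrightarrow> left_of G e F \<longleftrightarrow> F = closure (lreg e)"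
  unfolding left_of_def using side_region_iff[OF _ loopless edge_sides, of e _ 1] lreg_in by auto

lemma right_of_iff: "e \<in> edges G \<Longrightarrow> right_of G e F \<longleftrightarrow> F = closure (rreg e)"
  unfolding right_of_def using side_region_iff[OF _ loopless edge_sides, of e _ "-1"] rreg_in by auto

lemma edge_sides_loop:
  assumes "e \<in> edges G"
  shows "simple_path (ecurve G e +++ closing e)"
    "pathfinish (ecurve G e +++ closing e) = pathstart (ecurve G e +++ closing e)"
    "pathstart (closing e) = pathfinish (ecurve G e)"
    "\<And>w. w \<in> inside (path_image (ecurve G e +++ closing e)) \<Longrightarrow> winding_number (ecurve G e +++ closing e) w = 1"
    "\<And>u. u \<in> {0<..<1} \<Longrightarrow> \<exists>\<eta>>0. inside (path_image (ecurve G e +++ closing e)) \<inter> ball (ecurve G e u) \<eta> \<subseteq> lreg e \<and>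
                           outside (path_image (ecurve G e +++ closing e)) \<inter> ball (ecurve G e u) \<eta> \<subseteq> rreg e"
  using edge_sides[OF assms] unfolding edge_sides_def Let_def by blast+

lemma point_cases:
  assumes "w \<notin> vpos G ` verts G"
  obtains Q where "Q \<in> regions G" "w \<in> Q" | e u where "e \<in> edges G" "0 < u" "u < 1" "w = ecurve G e u"
proof (cases "w \<in> gset G")
  case False
  then have "w \<in> \<Union> (components (- gset G))" by (simp add: Union_components)
  then show thesis using that(1) unfolding regions_def by blast
next
  case True
  then obtain e u where e: "e \<in> edges G" "u \<in> {0..1}" "w = ecurve G e u" using assms by (auto simp: gset_def path_image_def)
  then have "u \<noteq> 0" "u \<noteq> 1" using assms pathstart_ecurve[OF e(1)] pathfinish_ecurve[OF e(1)] src_in tgt_in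
    unfolding pathstart_def pathfinish_def by auto
  then show thesis using that(2)[of e u] e by auto
qed

lemma edge_point_unique:
  assumes "e \<in> edges G" "0 < u" "u < 1" "e' \<in> edges G" "0 < u'" "u' < 1" "ecurve G e u = ecurve G e' u'"
  shows "e = e'"
proof (rule ccontr)
  assume "e \<noteq> e'"
  then have "path_image (ecurve G e) \<inter> path_image (ecurve G e') \<subseteq> vpos G ` verts G"
    using assms plane by (simp add: plane_graph_def)
  moreover have "ecurve G e u \<in> path_image (ecurve G e)" "ecurve G e' u' \<in> path_image (ecurve G e')"
    using assms(2,3,5,6) by (auto simp: path_image_def)
  ultimately have "ecurve G e u \<in> vpos G ` verts G" using assms(7) by auto
  then show False using assms(1-3) plane by (auto simp: plane_graph_def)
qed

text \<open>Regions of \<open>A\<close> glued along open edges. The vertices are left out, as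
  removing finitely many points keeps the plane connected. Testing the left region suffices because
  the sets \<open>A\<close> of interest contain both sides of an edge or neither.\<close>

definition region_hull :: "complex set set \<Rightarrow> complex set" where
  "region_hull A = \<Union>A \<union> {ecurve G e u | e u. e \<in> edges G \<and> 0 < u \<and> u < 1 \<and> lreg e \<in> A}"

text \<open>A small ball around an edge point that avoids the vertices and the closing path consists
  of points of the edge, of the inside and of the outside of the reference loop; the latter two
  kinds lie in \<open>lreg e\<close> and \<open>rreg e\<close>.\<close>

lemma open_region_hull:
  assumes A: "A \<subseteq> regions G" and bal: "\<And>e. e \<in> edges G \<Longrightarrow> lreg e \<in> A \<longleftrightarrow> rreg e \<in> A"
  shows "open (region_hull A)"
  unfolding open_contains_ball
proof
  fix x assume "x \<in> region_hull A"
  then consider Q where "Q \<in> A" "x \<in> Q" | e u where "e \<in> edges G" "0 < u" "u < 1" "lreg e \<in> A" "x = ecurve G e u"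
    by (auto simp: region_hull_def)
  then show "\<exists>\<epsilon>>0. ball x \<epsilon> \<subseteq> region_hull A"
  proof cases
    case 1
    then obtain \<epsilon> where "\<epsilon> > 0" "ball x \<epsilon> \<subseteq> Q" using A open_region open_contains_ball by (meson subsetD)
    then show ?thesis using 1 by (intro exI[of _ \<epsilon>]) (auto simp: region_hull_def)
  next
    case 2
    note e = 2
    let ?J = "ecurve G e +++ closing e"
    note J = edge_sides_loop[OF e(1)]
    obtain \<eta> where \<eta>: "\<eta> > 0" "inside (path_image ?J) \<inter> ball x \<eta> \<subseteq> lreg e" "outside (path_image ?J) \<inter> ball x \<eta> \<subseteq> rreg e"
      using J(5)[of u] e by auto
    have "path (closing e)" using J(1,3) by (metis path_join path_ecurve e(1) simple_path_imp_path)
    then have "closed (path_image (closing e) \<union> vpos G ` verts G)"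
      using finite_verts by (simp add: closed_Un closed_path_image finite_imp_closed)
    moreover have "x \<notin> path_image (closing e) \<union> vpos G ` verts G"
      using loop_interior_point_notin[OF J(1-3) e(2,3)] e plane by (auto simp: plane_graph_def)
    ultimately obtain \<eta>' where \<eta>': "\<eta>' > 0" "ball x \<eta>' \<subseteq> - (path_image (closing e) \<union> vpos G ` verts G)"
      by (meson ComplI closed_def open_contains_ball)
    have "ball x (min \<eta> \<eta>') \<subseteq> region_hull A"
    proof
      fix y assume y: "y \<in> ball x (min \<eta> \<eta>')"
      show "y \<in> region_hull A"
      proof (cases "y \<in> path_image ?J")
        case True
        then have "y \<in> path_image (ecurve G e)" using y \<eta>'(2) J(3) by (auto simp: path_image_join)
        then obtain v where v: "v \<in> {0..1}" "y = ecurve G e v" by (auto simp: path_image_def)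
        have "y \<notin> vpos G ` verts G" using y \<eta>'(2) by auto
        then have "v \<noteq> 0" "v \<noteq> 1" using v pathstart_ecurve[OF e(1)] pathfinish_ecurve[OF e(1)] src_in[OF e(1)] tgt_in[OF e(1)]
          unfolding pathstart_def pathfinish_def by auto
        then have "0 < v" "v < 1" using v(1) by auto
        then show ?thesis using v(2) e(1,4) unfolding region_hull_def by blast
      next
        case False
        then have "y \<in> inside (path_image ?J) \<or> y \<in> outside (path_image ?J)" using inside_Un_outside by blast
        then have "y \<in> lreg e \<or> y \<in> rreg e" using \<eta> y by auto
        then show ?thesis using e bal[OF e(1)] by (auto simp: region_hull_def)
      qed
    qed
    then show ?thesis using \<eta>(1) \<eta>'(1) by (intro exI[of _ "min \<eta> \<eta>'"]) auto
  qed
qed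

text \<open>Otherwise the hulls of \<open>A\<close> and of the remaining regions would separate the
  plane minus the finite set of vertices.\<close>

lemma regions_dual_connected:
  assumes A: "A \<subseteq> regions G" "A \<noteq> {}" and bal: "\<And>e. e \<in> edges G \<Longrightarrow> lreg e \<in> A \<longleftrightarrow> rreg e \<in> A"
  shows "A = regions G"
proof (rule ccontr)
  assume "A \<noteq> regions G"
  define B where "B = regions G - A"
  have B: "B \<subseteq> regions G" "B \<noteq> {}" using A \<open>A \<noteq> regions G\<close> by (auto simp: B_def)
  have balB: "lreg e \<in> B \<longleftrightarrow> rreg e \<in> B" if "e \<in> edges G" for e
    using bal[OF that] lreg_in[OF that] rreg_in[OF that] by (auto simp: B_def)
  have conn: "connected (- vpos G ` verts G)"
    using connected_open_delete_finite[of "UNIV :: complex set" "vpos G ` verts G"] finite_verts connected_UNIV by (simp add: Compl_eq_Diff_UNIV)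
  have notv: "ecurve G e u \<notin> vpos G ` verts G" if "e \<in> edges G" "0 < u" "u < 1" for e u
    using that plane by (auto simp: plane_graph_def)
  have sub: "- vpos G ` verts G \<subseteq> region_hull A \<union> region_hull B"
  proof
    fix w assume "w \<in> - vpos G ` verts G"
    then have "w \<notin> vpos G ` verts G" by simp
    then show "w \<in> region_hull A \<union> region_hull B"
    proof (cases rule: point_cases)
      case (1 Q)
      then show ?thesis unfolding region_hull_def B_def by blast
    next
      case (2 e u)
      then show ?thesis using lreg_in[of e] unfolding region_hull_def B_def by blast
    qed
  qed
  have disj: "region_hull A \<inter> region_hull B \<inter> - vpos G ` verts G = {}"
  proof -
    have "False" if wA: "w \<in> region_hull A" and wB: "w \<in> region_hull B" for w
    proof -
      have gs: "ecurve G e u \<in> gset G" if "e \<in> edges G" "0 < u" "u < 1" for e u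
        using that path_image_ecurve_subset[OF that(1)] by (auto simp: path_image_def)
      have nog: "w \<notin> gset G" if "Q \<in> regions G" "w \<in> Q" for Q
        using that region_subset by blast
      consider Q where "Q \<in> A" "w \<in> Q" | e u where "e \<in> edges G" "0 < u" "u < 1" "lreg e \<in> A" "w = ecurve G e u"
        using wA unfolding region_hull_def by blast
      then show False
      proof cases
        case 1
        then show False using wB A(1) gs nog[of Q] regions_eqI[of Q] unfolding region_hull_def B_def by blast
      next
        case 2
        then show False using wB gs[of e u] nog edge_point_unique[of e u] unfolding region_hull_def B_def by blast
      qed
    qed
    then show ?thesis by blast
  qed
  have nev: "region_hull C \<inter> - vpos G ` verts G \<noteq> {}" if C: "C \<subseteq> regions G" "C \<noteq> {}" for C
  proof -
    obtain Q w where Q: "Q \<in> C" "w \<in> Q" using C region_nonempty by blast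
    then have "w \<notin> vpos G ` verts G" using region_subset[of Q] C(1) by (auto simp: gset_def)
    moreover have "w \<in> region_hull C" using Q unfolding region_hull_def by blast
    ultimately show ?thesis by blast
  qed
  have oA: "open (region_hull A)" by (rule open_region_hull[OF A(1) bal])
  have oB: "open (region_hull B)" by (rule open_region_hull[OF B(1) balB])
  show False using connectedD[OF conn oA oB disj sub] nev[OF A] nev[OF B] by blast
qed

text \<open>Subtracting \<open>ecount l e\<close> times the winding number of the reference loop of
  \<open>e\<close> removes the curve of \<open>e\<close> altogether. What is left is continuous at
  the midpoint of \<open>e\<close>, and being an integer it is locally constant. So the jump across
  \<open>e\<close> is \<open>ecount l e\<close> times that of the reference loop.\<close>

lemma closed_swalk_winding:
  assumes l: "swalk G a l a"
  obtains n :: "complex set \<Rightarrow> int" where "n ext_region = 0"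
    "\<And>e. e \<in> edges G \<Longrightarrow> n (lreg e) - n (rreg e) = ecount l e"
    "\<And>Q w. Q \<in> regions G \<Longrightarrow> w \<in> Q \<Longrightarrow> swind G l w = of_int (n Q)"
proof -
  let ?c = "scurve G a l"
  note c = scurve_props[OF l]
  have loop: "pathfinish ?c = pathstart ?c" using c by simp
  have "\<exists>k::int. \<forall>w\<in>Q. swind G l w = of_int k" if Q: "Q \<in> regions G" for Q
  proof -
    have dis: "Q \<inter> path_image ?c = {}" "Q \<inter> gset G = {}" using c(4) region_subset[OF Q] by blast+
    then obtain z where z: "\<And>w. w \<in> Q \<Longrightarrow> winding_number ?c w = z"
      using winding_number_constant[OF c(1) loop connected_region[OF Q]] unfolding constant_on_def by blast
    obtain w where w: "w \<in> Q" using region_nonempty[OF Q] by blast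
    have "winding_number ?c w \<in> \<int>" using integer_winding_number[OF c(1) loop] w dis by blast
    then obtain k where "z = of_int k" using z[OF w] by (auto elim: Ints_cases)
    then show ?thesis using z c(5) dis by (metis disjoint_iff)
  qed
  then obtain n :: "complex set \<Rightarrow> int" where n: "\<And>Q w. Q \<in> regions G \<Longrightarrow> w \<in> Q \<Longrightarrow> swind G l w = of_int (n Q)"
    by metis
  show thesis
  proof (rule that[of n])
    obtain B where B: "\<And>z. B \<le> norm z \<Longrightarrow> winding_number ?c z = 0"
      using winding_number_zero_at_infinity[OF c(1) loop] by blast
    obtain w where w: "w \<in> ext_region" "B \<le> norm w"
      using ext_region(2) unfolding bounded_iff by (meson linear)
    have "w \<notin> gset G" using w region_subset ext_region(1) by blast
    then have "swind G l w = 0" using B w c(5) by metis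
    then show "n ext_region = 0" using n[OF ext_region(1) w(1)] by simp
  next
    fix e assume e: "e \<in> edges G"
    let ?J = "ecurve G e +++ closing e" and ?m = "ecurve G e (1/2)"
    let ?l = "filter (\<lambda>x. fst x \<noteq> e) l"
    note J = edge_sides_loop[OF e]
    have pc: "path (closing e)" using J(1,3) by (metis path_join path_ecurve e simple_path_imp_path)
    define D where "D w = swind G ?l w - of_int (ecount l e) * winding_number (closing e) w" for w
    have sub: "fst ` set l \<subseteq> edges G" using swalk_edges[OF l] .
    have cs: "continuous (at ?m) (swind G l')" if "fst ` set l' \<subseteq> edges G - {e}" for l'
      using that
    proof (induction l')
      case Nil then show ?case by (simp add: swind_def)
    next
      case (Cons x l')
      have fx: "fst x \<in> edges G" "fst x \<noteq> e" using Cons by auto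
      have "?m \<notin> path_image (ecurve G (fst x))"
      proof
        assume "?m \<in> path_image (ecurve G (fst x))"
        moreover have "?m \<in> path_image (ecurve G e)" by (auto simp: path_image_def)
        moreover have "path_image (ecurve G e) \<inter> path_image (ecurve G (fst x)) \<subseteq> vpos G ` verts G"
          using fx e plane by (simp add: plane_graph_def)
        ultimately have "?m \<in> vpos G ` verts G" by blast
        then show False using e plane by (auto simp: plane_graph_def)
      qed
      then have "continuous (at ?m) (winding_number (ecurve G (fst x)))"
        using continuous_at_winding_number path_ecurve fx by blast
      then show ?case using Cons by (auto intro!: continuous_intros)
    qed
    have contD: "continuous (at ?m) D"
      unfolding D_def using loop_interior_point_notin[OF J(1-3), of "1/2"] pc sub
      by (intro continuous_intros cs continuous_at_winding_number) auto
    have Deq: "D w = swind G l w - of_int (ecount l e) * winding_number ?J w"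
      if "w \<notin> gset G" "w \<notin> path_image ?J" for w
      using that J(3) pc path_ecurve[OF e] path_image_ecurve_subset[OF e]
      by (simp add: D_def swind_split[of G l w e] winding_number_join path_image_join algebra_simps)
    have "D w \<in> \<int>" if "w \<in> - (gset G \<union> path_image ?J)" for w
    proof -
      have "swind G l w \<in> \<int>"
        using that c(4,5) integer_winding_number[OF c(1) loop, of w] by auto
      moreover have "winding_number ?J w \<in> \<int>"
        using that integer_winding_number[OF simple_path_imp_path[OF J(1)] J(2)] by blast
      ultimately show ?thesis using that Deq[of w] by (simp add: Ints_diff Ints_mult)
    qed
    then obtain \<eta> where \<eta>: "0 < \<eta>" "\<And>w w'. w \<in> - (gset G \<union> path_image ?J) \<inter> ball ?m \<eta>
        \<Longrightarrow> w' \<in> - (gset G \<union> path_image ?J) \<inter> ball ?m \<eta> \<Longrightarrow> D w = D w'"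
      using continuous_integer_valued_locally_constant[OF contD] by metis
    obtain \<eta>' where \<eta>': "\<eta>' > 0" "inside (path_image ?J) \<inter> ball ?m \<eta>' \<subseteq> lreg e" "outside (path_image ?J) \<inter> ball ?m \<eta>' \<subseteq> rreg e"
      using J(5)[of "1/2"] by auto
    have "?m \<in> path_image ?J" using J(3) by (auto simp: path_image_join) (auto simp: path_image_def)
    then have "?m \<in> closure (inside (path_image ?J))" "?m \<in> closure (outside (path_image ?J))"
      using Jordan_inside_outside[OF J(1,2)] by (metis DiffD1 frontier_def)+
    moreover have "0 < min \<eta> \<eta>'" using \<eta> \<eta>' by simp
    ultimately obtain w1 w2 where w: "w1 \<in> inside (path_image ?J)" "w1 \<in> ball ?m (min \<eta> \<eta>')"
      "w2 \<in> outside (path_image ?J)" "w2 \<in> ball ?m (min \<eta> \<eta>')"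
      unfolding closure_approachable by (metis dist_commute mem_ball)
    have wr: "w1 \<in> lreg e" "w2 \<in> rreg e" using w \<eta>' by auto
    have ng: "w1 \<notin> gset G" "w2 \<notin> gset G" using wr region_subset lreg_in[OF e] rreg_in[OF e] by blast+
    have nJ: "w1 \<notin> path_image ?J" "w2 \<notin> path_image ?J" using w inside_no_overlap outside_no_overlap by blast+
    have "D w1 = D w2" using \<eta>(2)[of w1 w2] w ng nJ by auto
    then have "swind G l w1 - of_int (ecount l e) * winding_number ?J w1 = swind G l w2 - of_int (ecount l e) * winding_number ?J w2"
      using Deq ng nJ by metis
    moreover have "winding_number ?J w1 = 1" using J(4) w by blast
    moreover have "winding_number ?J w2 = 0"
      using winding_number_zero_in_outside[OF simple_path_imp_path[OF J(1)] J(2) w(3)] .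
    ultimately have "(of_int (n (lreg e) - n (rreg e)) :: complex) = of_int (ecount l e)"
      using n[OF lreg_in[OF e] wr(1)] n[OF rreg_in[OF e] wr(2)] by (simp add: algebra_simps)
    then show "n (lreg e) - n (rreg e) = ecount l e" using of_int_eq_iff by blast
  qed (use n in auto)
qed

end

section \<open>Circulations and potentials\<close>

text \<open>Passing to images shrinks the finite set until \<open>g\<close> is onto, hence
  bijective; what remains are the periodic points.\<close>

lemma finite_self_map_core:
  assumes "finite A" "A \<noteq> {}" "g ` A \<subseteq> A"
  obtains C where "C \<subseteq> A" "C \<noteq> {}" "bij_betw g C C"
  using assms
proof (induction A arbitrary: thesis rule: finite_psubset_induct)
  case (psubset A)
  show ?case
  proof (cases "g ` A = A")
    case True
    then have "inj_on g A" using psubset by (simp add: eq_card_imp_inj_on)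
    then have "bij_betw g A A" using True by (simp add: bij_betw_def)
    then show ?thesis using psubset.prems(1)[OF subset_refl] psubset.prems(2) by blast
  next
    case False
    then have "g ` A \<subset> A" using psubset by blast
    then show ?thesis using psubset.IH[of "g ` A"] psubset.prems by (metis image_is_empty image_mono order_trans psubset_imp_subset)
  qed
qed

lemma count_list_distinct: "distinct xs \<Longrightarrow> count_list xs x = (if x \<in> set xs then 1 else 0)"
  by (induction xs) auto

lemma walk_append: "walk G a (p @ q) b \<longleftrightarrow> (\<exists>c. walk G a p c \<and> walk G c q b)"
  if "\<And>e. e \<in> edges G \<Longrightarrow> src G e \<in> verts G"
proof (induction p arbitrary: a)
  case Nil
  then show ?case using that by (cases q) auto
next
  case (Cons e p)
  then show ?case by auto
qed

lemma walk_edges: "walk G a p b \<Longrightarrow> set p \<subseteq> edges G"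
  by (induction p arbitrary: a) auto

lemma walk_end_unique: "walk G a p b \<Longrightarrow> walk G a p b' \<Longrightarrow> b = b'"
  by (induction p arbitrary: a) auto

lemma walk_end_in: "walk G a p b \<Longrightarrow> b \<in> verts G"
  by (induction p arbitrary: a) auto

lemma walk_src_cases: "walk G a p b \<Longrightarrow> e \<in> set p \<Longrightarrow> src G e = a \<or> src G e \<in> tgt G ` set p"
  by (induction p arbitrary: a) auto

lemma walk_constant:
  assumes "walk G a p b" "\<And>e. e \<in> set p \<Longrightarrow> h (src G e) = h (tgt G e)"
  shows "h b = h a" "\<And>e. e \<in> set p \<Longrightarrow> h (src G e) = h a"
  using assms by (induction p arbitrary: a) auto

lemma swalk_append: "swalk G a l b \<Longrightarrow> swalk G b l' c \<Longrightarrow> swalk G a (l @ l') c"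
  by (induction l arbitrary: a) auto

lemma walk_imp_swalk: "walk G a p b \<Longrightarrow> swalk G a (map (\<lambda>e. (e, True)) p) b"
  by (induction p arbitrary: a) auto

definition srev :: "('e \<times> bool) list \<Rightarrow> ('e \<times> bool) list" where
  "srev l = rev (map (\<lambda>x. (fst x, \<not> snd x)) l)"

text \<open>The integral of the edge function \<open>d\<close> along a signed walk.\<close>

definition ssum :: "('e \<Rightarrow> int) \<Rightarrow> ('e \<times> bool) list \<Rightarrow> int" where
  "ssum d l = (\<Sum>x\<leftarrow>l. sgnb (snd x) * d (fst x))"

lemma ssum_append: "ssum d (l @ l') = ssum d l + ssum d l'"
  by (simp add: ssum_def)

lemma ssum_Cons_True: "ssum d ((e, True) # l) = d e + ssum d l"
  by (simp add: ssum_def sgnb_def)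

lemma ssum_srev: "ssum d (srev l) = - ssum d l"
  by (induction l) (auto simp: ssum_def srev_def sgnb_def)

lemma ecount_eq_ssum: "ecount l e = ssum (\<lambda>e'. if e' = e then 1 else 0) l"
  unfolding ecount_def ssum_def by (rule arg_cong[of _ _ sum_list]) auto

lemma ecount_walk: "ecount (map (\<lambda>e. (e, True)) p) e = int (count_list p e)"
  by (induction p) (auto simp: ecount_def sgnb_def)

lemma ecount_walk_srev:
  "ecount (map (\<lambda>e. (e, True)) p @ srev (map (\<lambda>e. (e, True)) q)) e = int (count_list p e) - int (count_list q e)"
  by (simp add: ecount_eq_ssum ssum_append ssum_srev) (simp add: ecount_eq_ssum[symmetric] ecount_walk)

lemma ssum_eq_sum_ecount:
  assumes "finite E" "fst ` set l \<subseteq> E"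
  shows "ssum d l = (\<Sum>e\<in>E. ecount l e * d e)"
  using assms(2)
proof (induction l)
  case Nil then show ?case by (simp add: ssum_def ecount_def)
next
  case (Cons x l)
  have "(\<Sum>e\<in>E. ecount (x # l) e * d e) = (\<Sum>e\<in>E. (if fst x = e then sgnb (snd x) * d e else 0) + ecount l e * d e)"
    by (intro sum.cong) (auto simp: ecount_def algebra_simps)
  also have "\<dots> = sgnb (snd x) * d (fst x) + (\<Sum>e\<in>E. ecount l e * d e)"
    using Cons.prems assms(1) by (simp add: sum.distrib)
  finally show ?case using Cons by (simp add: ssum_def)
qed

text \<open>Here the faces are abstract. Plane topology enters through \<open>winding\<close>, the
  face function of a closed signed walk, and \<open>dual_connected\<close>, by which no nonempty set
  of bounded faces is cut off from the rest of the dual graph.\<close>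

locale anchored_graph =
  fixes G :: "('v,'e) pgraph" and s t :: 'v and Faces :: "'f set" and ext :: 'f
    and L R :: "'e \<Rightarrow> 'f" and dm cd :: "'f \<Rightarrow> 'e list" and fs ft :: "'f \<Rightarrow> 'v" and D C :: "'e list"
  assumes fin_V: "finite (verts G)" and fin_E: "finite (edges G)"
    and src_V: "\<And>e. e \<in> edges G \<Longrightarrow> src G e \<in> verts G" and tgt_V: "\<And>e. e \<in> edges G \<Longrightarrow> tgt G e \<in> verts G"
    and V_connected: "\<And>u v. u \<in> verts G \<Longrightarrow> v \<in> verts G \<Longrightarrow> (u, v) \<in> (uedge G)\<^sup>*"
    and ext_notin: "ext \<notin> Faces"
    and L_in: "\<And>e. e \<in> edges G \<Longrightarrow> L e \<in> insert ext Faces" and R_in: "\<And>e. e \<in> edges G \<Longrightarrow> R e \<in> insert ext Faces"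
    and dm_path: "\<And>F. F \<in> Faces \<Longrightarrow> spath G (fs F) (dm F) (ft F)"
    and cd_path: "\<And>F. F \<in> Faces \<Longrightarrow> spath G (fs F) (cd F) (ft F)"
    and set_dm: "\<And>F. F \<in> Faces \<Longrightarrow> set (dm F) = {e \<in> edges G. R e = F}"
    and set_cd: "\<And>F. F \<in> Faces \<Longrightarrow> set (cd F) = {e \<in> edges G. L e = F}"
    and D_path: "spath G s D t" and C_path: "spath G s C t"
    and set_D: "set D = {e \<in> edges G. L e = ext}" and set_C: "set C = {e \<in> edges G. R e = ext}"
    and out_edge: "\<And>v. v \<in> verts G \<Longrightarrow> v \<noteq> t \<Longrightarrow> \<exists>e\<in>edges G. src G e = v"
    and in_edge: "\<And>v. v \<in> verts G \<Longrightarrow> v \<noteq> s \<Longrightarrow> \<exists>e\<in>edges G. tgt G e = v"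
    and winding: "\<And>a l. swalk G a l a \<Longrightarrow>
        \<exists>n :: 'f \<Rightarrow> int. n ext = 0 \<and> (\<forall>e\<in>edges G. n (L e) - n (R e) = ecount l e)"
    and dual_connected: "\<And>A. A \<subseteq> Faces \<Longrightarrow> A \<noteq> {} \<Longrightarrow> \<exists>e\<in>edges G. (L e \<in> A) \<noteq> (R e \<in> A)"
begin

lemma walk_app: "walk G a (p @ q) b \<longleftrightarrow> (\<exists>c. walk G a p c \<and> walk G c q b)"
  by (rule walk_append) (rule src_V)

lemma walk_start_in: "walk G a p b \<Longrightarrow> a \<in> verts G"
  using src_V by (cases p) auto

lemma s_in: "s \<in> verts G"
  using D_path walk_start_in[of s D t] by (simp add: spath_def)

lemma dm_edge: "F \<in> Faces \<Longrightarrow> \<exists>e\<in>edges G. R e = F"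
  using dm_path[of F] set_dm[of F] unfolding spath_def by (metis (mono_tags, lifting) all_not_in_conv mem_Collect_eq set_empty)

lemma cd_edge: "F \<in> Faces \<Longrightarrow> \<exists>e\<in>edges G. L e = F"
  using cd_path[of F] set_cd[of F] unfolding spath_def by (metis (mono_tags, lifting) all_not_in_conv mem_Collect_eq set_empty)

lemma fin_F: "finite Faces"
proof (rule finite_subset)
  show "Faces \<subseteq> R ` edges G" using dm_edge by force
qed (use fin_E in simp)

text \<open>An edge belongs to the codomain of its left face and to the domain of its right face, so
  \<open>L e\<close> is directly above \<open>R e\<close>. The condition includes edges bordering
  the exterior: a set of bounded faces that is up-closed has no edge with the exterior above
  it.\<close>

definition up_closed :: "'f set \<Rightarrow> bool" where
  "up_closed A \<longleftrightarrow> (\<forall>e\<in>edges G. R e \<in> A \<longrightarrow> L e \<in> A)"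

definition down_closed :: "'f set \<Rightarrow> bool" where
  "down_closed A \<longleftrightarrow> (\<forall>e\<in>edges G. L e \<in> A \<longrightarrow> R e \<in> A)"

text \<open>For bounded faces this is weaker than \<open>up_closed\<close>, as one face of
  \<open>A\<close> above each face is enough. It still suffices to construct a circulation.\<close>

definition no_top :: "'f set \<Rightarrow> bool" where
  "no_top A \<longleftrightarrow> (\<forall>F\<in>A. \<exists>e\<in>edges G. R e = F \<and> L e \<in> A)"

definition no_bottom :: "'f set \<Rightarrow> bool" where
  "no_bottom A \<longleftrightarrow> (\<forall>F\<in>A. \<exists>e\<in>edges G. L e = F \<and> R e \<in> A)"

lemma up_closed_no_top: "A \<subseteq> Faces \<Longrightarrow> up_closed A \<Longrightarrow> no_top A"
  unfolding up_closed_def no_top_def using dm_edge by blast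

lemma down_closed_no_bottom: "A \<subseteq> Faces \<Longrightarrow> down_closed A \<Longrightarrow> no_bottom A"
  unfolding down_closed_def no_bottom_def using cd_edge by blast

text \<open>For every face one edge leading to another face of \<open>A\<close> is chosen. On the
  core of the resulting self-map the chosen edges form disjoint cycles of the dual graph, and
  \<open>d\<close> is their indicator. \<open>P\<close> and \<open>Q\<close> stand for the two sides
  in either order.\<close>

lemma dual_circulation_aux:
  fixes P Q :: "'e \<Rightarrow> 'f"
  assumes "finite A" "A \<noteq> {}" and step: "\<forall>F\<in>A. \<exists>e\<in>edges G. P e = F \<and> Q e \<in> A"
  obtains d :: "'e \<Rightarrow> int" where "\<And>e. 0 \<le> d e" "\<exists>e\<in>edges G. 0 < d e"
    "\<And>e. e \<in> edges G \<Longrightarrow> d e \<noteq> 0 \<Longrightarrow> P e \<in> A \<and> Q e \<in> A"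
    "\<And>F. sum d {e \<in> edges G. P e = F} = sum d {e \<in> edges G. Q e = F}"
proof -
  obtain up where up: "\<And>F. F \<in> A \<Longrightarrow> up F \<in> edges G" "\<And>F. F \<in> A \<Longrightarrow> P (up F) = F" "\<And>F. F \<in> A \<Longrightarrow> Q (up F) \<in> A"
    using step by metis
  have "(Q \<circ> up) ` A \<subseteq> A" using up by auto
  then obtain B where B: "B \<subseteq> A" "B \<noteq> {}" "bij_betw (Q \<circ> up) B B"
    using finite_self_map_core[OF assms(1,2)] by metis
  define d where "d e = (if e \<in> up ` B then 1 else 0 :: int)" for e
  have sumd: "sum d S = int (card (S \<inter> up ` B))" if "finite S" for S
    using that by (simp add: d_def sum.If_cases)
  have "sum d {e \<in> edges G. P e = F} = sum d {e \<in> edges G. Q e = F}" for F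
  proof (cases "F \<in> B")
    case True
    then obtain F' where F': "F' \<in> B" "Q (up F') = F" using B(3) unfolding bij_betw_def by force
    have "{e \<in> edges G. P e = F} \<inter> up ` B = {up F}" using True up B(1) by auto
    moreover have "{e \<in> edges G. Q e = F} \<inter> up ` B = {up F'}"
      using F' up B unfolding bij_betw_def inj_on_def by auto
    ultimately show ?thesis using fin_E by (simp add: sumd)
  next
    case False
    then have "{e \<in> edges G. P e = F} \<inter> up ` B = {}" using up B(1) by auto
    moreover have "{e \<in> edges G. Q e = F} \<inter> up ` B = {}" using False B(3) unfolding bij_betw_def by auto
    ultimately show ?thesis using fin_E by (simp add: sumd)
  qed
  moreover have "\<exists>e\<in>edges G. 0 < d e" using B(1,2) up(1) by (auto simp: d_def)
  moreover have "P e \<in> A \<and> Q e \<in> A" if de: "d e \<noteq> 0" for e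
  proof -
    obtain F where "F \<in> B" "e = up F" using de by (auto simp: d_def split: if_splits)
    then show ?thesis using up B(1) by auto
  qed
  ultimately show thesis by (intro that[of d]) (auto simp: d_def)
qed

lemma dual_circulation:
  assumes "A \<subseteq> Faces" "A \<noteq> {}" "no_top A \<or> no_bottom A"
  obtains d :: "'e \<Rightarrow> int" where "\<And>e. 0 \<le> d e" "\<exists>e\<in>edges G. 0 < d e"
    "\<And>e. e \<in> edges G \<Longrightarrow> d e \<noteq> 0 \<Longrightarrow> L e \<in> A \<and> R e \<in> A"
    "\<And>F. sum d {e \<in> edges G. L e = F} = sum d {e \<in> edges G. R e = F}"
proof -
  have "finite A" using assms(1) fin_F finite_subset by blast
  show thesis
    using assms(3) unfolding no_top_def no_bottom_def
  proof
    assume A: "\<forall>F\<in>A. \<exists>e\<in>edges G. R e = F \<and> L e \<in> A"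
    show thesis
    proof (rule dual_circulation_aux[OF \<open>finite A\<close> assms(2) A])
      fix d :: "'e \<Rightarrow> int"
      assume "\<And>e. 0 \<le> d e" "\<exists>e\<in>edges G. 0 < d e" "\<And>e. e \<in> edges G \<Longrightarrow> d e \<noteq> 0 \<Longrightarrow> R e \<in> A \<and> L e \<in> A"
        "\<And>F. sum d {e \<in> edges G. R e = F} = sum d {e \<in> edges G. L e = F}"
      then show thesis by (intro that[of d]) simp_all
    qed
  next
    assume A: "\<forall>F\<in>A. \<exists>e\<in>edges G. L e = F \<and> R e \<in> A"
    show thesis by (rule dual_circulation_aux[OF \<open>finite A\<close> assms(2) A]) (rule that)
  qed
qed

text \<open>Summation by parts: writing \<open>ecount l e\<close> as a jump of a face function
  \<open>n\<close> and grouping by faces, each \<open>n F\<close> is multiplied by the net flow of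
  \<open>d\<close> at \<open>F\<close>, which is 0.\<close>

lemma dual_circulation_vanishes:
  fixes d :: "'e \<Rightarrow> int"
  assumes d: "\<And>F. sum d {e \<in> edges G. L e = F} = sum d {e \<in> edges G. R e = F}" and l: "swalk G a l a"
  shows "ssum d l = 0"
proof -
  obtain n :: "'f \<Rightarrow> int" where n: "\<And>e. e \<in> edges G \<Longrightarrow> n (L e) - n (R e) = ecount l e"
    using winding[OF l] by blast
  have fin: "finite (insert ext Faces)" using fin_F by simp
  have group: "(\<Sum>e\<in>edges G. n (X e) * d e) = (\<Sum>F\<in>insert ext Faces. n F * sum d {e \<in> edges G. X e = F})"
    if "X ` edges G \<subseteq> insert ext Faces" for X
  proof -
    have "(\<Sum>e\<in>edges G. n (X e) * d e) = (\<Sum>F\<in>insert ext Faces. \<Sum>e\<in>{e \<in> edges G. X e = F}. n (X e) * d e)"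
      using sum.group[OF fin_E fin that, of "\<lambda>e. n (X e) * d e"] by simp
    also have "\<dots> = (\<Sum>F\<in>insert ext Faces. n F * sum d {e \<in> edges G. X e = F})"
      by (intro sum.cong refl) (simp add: sum_distrib_left)
    finally show ?thesis .
  qed
  have "ssum d l = (\<Sum>e\<in>edges G. ecount l e * d e)"
    using ssum_eq_sum_ecount[OF fin_E swalk_edges[OF l]] .
  also have "\<dots> = (\<Sum>e\<in>edges G. n (L e) * d e) - (\<Sum>e\<in>edges G. n (R e) * d e)"
    unfolding sum_subtractf[symmetric] by (intro sum.cong refl) (simp add: n[symmetric] algebra_simps)
  also have "\<dots> = 0"
  proof -
    have "L ` edges G \<subseteq> insert ext Faces" "R ` edges G \<subseteq> insert ext Faces" using L_in R_in by blast+
    then show ?thesis using group[of L] group[of R] d by simp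
  qed
  finally show ?thesis .
qed

lemma swalk_srev: "swalk G a l b \<Longrightarrow> swalk G b (srev l) a"
proof (induction l arbitrary: a)
  case Nil
  then show ?case by (auto simp: srev_def)
next
  case (Cons x l)
  obtain e c where x: "x = (e, c)" by (cases x)
  have "swalk G (stgt G x) [(e, \<not> c)] a" using Cons.prems src_V tgt_V by (auto simp: x)
  moreover have "srev (x # l) = srev l @ [(e, \<not> c)]" by (simp add: srev_def x)
  ultimately show ?case using Cons swalk_append by fastforce
qed

lemma swalk_exists: "u \<in> verts G \<Longrightarrow> v \<in> verts G \<Longrightarrow> \<exists>l. swalk G u l v"
proof -
  assume u: "u \<in> verts G" and "v \<in> verts G"
  then have "(u, v) \<in> (uedge G)\<^sup>*" using V_connected by blast
  then show ?thesis
  proof (induction rule: rtrancl_induct)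
    case base
    then show ?case using u by (intro exI[of _ "[]"]) simp
  next
    case (step y z)
    then obtain l where l: "swalk G u l y" by blast
    from step(2) have "\<exists>e\<in>edges G. (y, z) = (src G e, tgt G e) \<or> (y, z) = (tgt G e, src G e)"
      unfolding uedge_def by blast
    then obtain e where "e \<in> edges G" "(y, z) = (src G e, tgt G e) \<or> (y, z) = (tgt G e, src G e)" by blast
    then obtain b where "e \<in> edges G" "ssrc G (e, b) = y" "stgt G (e, b) = z"
      by (metis (full_types) prod.inject ssrc.simps stgt.simps)
    then have "swalk G y [(e, b)] z" using src_V tgt_V by (auto split: if_splits)
    then show ?case using swalk_append[OF l] by blast
  qed
qed

text \<open>Since \<open>d\<close> integrates to 0 along closed signed walks, its integral along a
  signed walk from \<open>s\<close> depends only on the end; \<open>w\<close> fixes one walk for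
  each vertex.\<close>

lemma potential_exists:
  fixes d :: "'e \<Rightarrow> int"
  assumes d: "\<And>F. sum d {e \<in> edges G. L e = F} = sum d {e \<in> edges G. R e = F}"
  obtains h :: "'v \<Rightarrow> int" where "\<And>e. e \<in> edges G \<Longrightarrow> h (tgt G e) - h (src G e) = d e"
proof -
  obtain w where w: "\<And>v. v \<in> verts G \<Longrightarrow> swalk G s (w v) v" using swalk_exists[OF s_in] by metis
  show thesis
  proof (rule that[of "\<lambda>v. ssum d (w v)"])
    fix e assume e: "e \<in> edges G"
    have "swalk G (src G e) [(e, True)] (tgt G e)" using e tgt_V by auto
    then have "swalk G s (w (src G e) @ [(e, True)] @ srev (w (tgt G e))) s"
      using w src_V[OF e] tgt_V[OF e] swalk_srev swalk_append by metis
    from dual_circulation_vanishes[OF d this]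
    show "ssum d (w (tgt G e)) - ssum d (w (src G e)) = d e"
      by (simp add: ssum_append ssum_srev ssum_Cons_True)
  qed
qed

lemma forward_cycle:
  assumes U: "U \<subseteq> verts G" "U \<noteq> {}" "\<And>v. v \<in> U \<Longrightarrow> \<exists>e\<in>edges G. src G e = v \<and> tgt G e \<in> U"
  obtains a p where "walk G a p a" "p \<noteq> []" "\<And>e. e \<in> set p \<Longrightarrow> src G e \<in> U"
proof -
  obtain out where out: "\<And>v. v \<in> U \<Longrightarrow> out v \<in> edges G \<and> src G (out v) = v \<and> tgt G (out v) \<in> U" using U(3) by metis
  define f where "f v = tgt G (out v)" for v
  obtain v0 where v0: "v0 \<in> U" using U(2) by blast
  have fU: "(f ^^ i) v \<in> U" if "v \<in> U" for i v using that out by (induction i) (auto simp: f_def)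
  have wk: "walk G v (map (\<lambda>i. out ((f ^^ i) v)) [0..<k]) ((f ^^ k) v)" if "v \<in> U" for k v
  proof (induction k)
    case 0
    then show ?case using that U(1) by auto
  next
    case (Suc k)
    have "walk G ((f ^^ k) v) [out ((f ^^ k) v)] ((f ^^ Suc k) v)"
      using out fU[OF that] U(1) by (auto simp: f_def)
    then show ?case using Suc by (auto simp: walk_app simp del: funpow.simps)
  qed
  have "\<not> inj_on (\<lambda>i. (f ^^ i) v0) (UNIV :: nat set)"
    using fU[OF v0] finite_subset[OF U(1) fin_V] by (metis finite_imageD finite_subset image_subsetI infinite_UNIV_nat)
  then obtain i j where ij: "i < j" "(f ^^ i) v0 = (f ^^ j) v0" unfolding inj_on_def by (metis linorder_neqE_nat)
  define v where "v = (f ^^ i) v0"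
  have "(f ^^ (j - i)) v = v" using ij by (metis funpow_add comp_apply le_add_diff_inverse2 less_imp_le v_def)
  then have "walk G v (map (\<lambda>m. out ((f ^^ m) v)) [0..<j-i]) v" using wk[of v "j-i"] fU[OF v0] v_def by auto
  moreover have "v \<in> U" using fU[OF v0] v_def by auto
  moreover have "src G e \<in> U" if "e \<in> set (map (\<lambda>m. out ((f ^^ m) v)) [0..<j-i])" for e
    using that out fU[OF \<open>v \<in> U\<close>] by auto
  ultimately show thesis using that[of v "map (\<lambda>m. out ((f ^^ m) v)) [0..<j-i]"] ij(1) by simp
qed

lemma backward_cycle:
  assumes U: "U \<subseteq> verts G" "U \<noteq> {}" "\<And>v. v \<in> U \<Longrightarrow> \<exists>e\<in>edges G. tgt G e = v \<and> src G e \<in> U"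
  obtains a p where "walk G a p a" "p \<noteq> []" "\<And>e. e \<in> set p \<Longrightarrow> src G e \<in> U"
proof -
  obtain inn where inn: "\<And>v. v \<in> U \<Longrightarrow> inn v \<in> edges G \<and> tgt G (inn v) = v \<and> src G (inn v) \<in> U" using U(3) by metis
  define f where "f v = src G (inn v)" for v
  obtain v0 where v0: "v0 \<in> U" using U(2) by blast
  have fU: "(f ^^ i) v \<in> U" if "v \<in> U" for i v using that inn by (induction i) (auto simp: f_def)
  have wk: "walk G ((f ^^ k) v) (rev (map (\<lambda>i. inn ((f ^^ i) v)) [0..<k])) v" if "v \<in> U" for k v
  proof (induction k)
    case 0
    then show ?case using that U(1) by auto
  next
    case (Suc k)
    moreover have "(f ^^ Suc k) v = src G (inn ((f ^^ k) v))" by (simp add: f_def)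
    ultimately show ?case using inn[OF fU[OF that, of k]] by simp
  qed
  have "\<not> inj_on (\<lambda>i. (f ^^ i) v0) (UNIV :: nat set)"
    using fU[OF v0] finite_subset[OF U(1) fin_V] by (metis finite_imageD finite_subset image_subsetI infinite_UNIV_nat)
  then obtain i j where ij: "i < j" "(f ^^ i) v0 = (f ^^ j) v0" unfolding inj_on_def by (metis linorder_neqE_nat)
  define v where "v = (f ^^ i) v0"
  have "(f ^^ (j - i)) v = v" using ij by (metis funpow_add comp_apply le_add_diff_inverse2 less_imp_le v_def)
  then have "walk G v (rev (map (\<lambda>m. inn ((f ^^ m) v)) [0..<j-i])) v" using wk[of v "j-i"] fU[OF v0] v_def by auto
  moreover have "v \<in> U" using fU[OF v0] v_def by auto
  moreover have "src G e \<in> U" if "e \<in> set (rev (map (\<lambda>m. inn ((f ^^ m) v)) [0..<j-i]))" for e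
    using that inn fU[OF \<open>v \<in> U\<close>] by auto
  ultimately show thesis using that[of v "rev (map (\<lambda>m. inn ((f ^^ m) v)) [0..<j-i])"] ij(1) by simp
qed

text \<open>The last two conclusions locate the cycle: \<open>h\<close> varies only across edges
  with both sides in \<open>A\<close>, and the cycle avoids the level of \<open>s\<close>. Together
  they will keep it away from the outer boundary of \<open>A\<close>.\<close>

lemma potential_and_cycle:
  assumes "A \<subseteq> Faces" "A \<noteq> {}" "no_top A \<or> no_bottom A"
  obtains h :: "'v \<Rightarrow> int" and a p where "walk G a p a" "p \<noteq> []" "\<And>e. e \<in> set p \<Longrightarrow> h (src G e) \<noteq> h s"
    "\<And>e. e \<in> edges G \<Longrightarrow> L e \<notin> A \<or> R e \<notin> A \<Longrightarrow> h (src G e) = h (tgt G e)"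
proof -
  obtain d :: "'e \<Rightarrow> int" where d: "\<And>e. 0 \<le> d e" "\<exists>e\<in>edges G. 0 < d e"
    "\<And>e. e \<in> edges G \<Longrightarrow> d e \<noteq> 0 \<Longrightarrow> L e \<in> A \<and> R e \<in> A"
    "\<And>F. sum d {e \<in> edges G. L e = F} = sum d {e \<in> edges G. R e = F}"
    by (rule dual_circulation[OF assms]) (rule that)
  obtain h :: "'v \<Rightarrow> int" where h: "\<And>e. e \<in> edges G \<Longrightarrow> h (tgt G e) - h (src G e) = d e"
    by (rule potential_exists[OF d(4)]) (rule that)
  have const: "h (src G e) = h (tgt G e)" if "e \<in> edges G" "L e \<notin> A \<or> R e \<notin> A" for e
  proof -
    have "d e = 0" using d(3)[OF that(1)] that(2) by blast
    then show ?thesis using h[OF that(1)] by simp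
  qed
  have mono: "h (src G e) \<le> h (tgt G e)" if "e \<in> edges G" for e
    using h[OF that] d(1)[of e] by simp
  \<comment> \<open>The edges of \<open>D\<close> have the exterior on their left, which is not in
    \<open>A\<close>, so \<open>h\<close> is constant along \<open>D\<close>.\<close>
  have ht: "h t = h s"
  proof (rule walk_constant(1)[of G s D t h])
    show "walk G s D t" using D_path by (simp add: spath_def)
    show "h (src G e) = h (tgt G e)" if "e \<in> set D" for e
      using that const set_D ext_notin assms(1) by auto
  qed
  obtain e0 where e0: "e0 \<in> edges G" "h (src G e0) < h (tgt G e0)" using d(2) h by force
  \<comment> \<open>If the head of \<open>e0\<close> is above the level of \<open>s\<close>, its
    superlevel set misses \<open>t\<close> and monotonicity keeps outgoing edges inside. Otherwise
    the tail of \<open>e0\<close> is strictly below that level, its sublevel set misses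
    \<open>s\<close>, and incoming edges stay inside.\<close>
  show thesis
  proof (cases "h (tgt G e0) > h s")
    case True
    let ?U = "{v \<in> verts G. h v \<ge> h (tgt G e0)}"
    have U: "\<exists>e\<in>edges G. src G e = v \<and> tgt G e \<in> ?U" if v: "v \<in> ?U" for v
    proof -
      have "v \<noteq> t" using v True ht by auto
      then obtain e where "e \<in> edges G" "src G e = v" using out_edge v by auto
      then show ?thesis using mono[of e] tgt_V v by (intro bexI[of _ e]) auto
    qed
    have sub: "?U \<subseteq> verts G" and ne: "?U \<noteq> {}" using tgt_V e0 by auto
    obtain a p where p: "walk G a p a" "p \<noteq> []" "\<And>e. e \<in> set p \<Longrightarrow> src G e \<in> ?U"
      by (rule forward_cycle[OF sub ne U]) (assumption, rule that)
    have "h (src G e) \<noteq> h s" if "e \<in> set p" for e using p(3)[OF that] True by auto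
    then show thesis using that[of a p h] p(1,2) const by simp
  next
    case False
    let ?U = "{v \<in> verts G. h v \<le> h (src G e0)}"
    have U: "\<exists>e\<in>edges G. tgt G e = v \<and> src G e \<in> ?U" if v: "v \<in> ?U" for v
    proof -
      have "v \<noteq> s" using v False e0 by auto
      then obtain e where "e \<in> edges G" "tgt G e = v" using in_edge v by auto
      then show ?thesis using mono[of e] src_V v by (intro bexI[of _ e]) auto
    qed
    have sub: "?U \<subseteq> verts G" and ne: "?U \<noteq> {}" using src_V e0 by auto
    obtain a p where p: "walk G a p a" "p \<noteq> []" "\<And>e. e \<in> set p \<Longrightarrow> src G e \<in> ?U"
      by (rule backward_cycle[OF sub ne U]) (assumption, rule that)
    have "h (src G e) \<noteq> h s" if "e \<in> set p" for e using p(3)[OF that] False e0(2) by auto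
    then show thesis using that[of a p h] p(1,2) const by simp
  qed
qed

section \<open>Acyclicity\<close>


text \<open>The faces reachable from the exterior in the undirected dual graph without entering
  \<open>A\<close>. The bounded faces not reached are \<open>A\<close> and its holes, which
  \<open>fill\<close> adds to \<open>A\<close>.\<close>

inductive_set outer :: "'f set \<Rightarrow> 'f set" for A where
  outer_ext: "ext \<in> outer A"
| outer_R: "L e \<in> outer A \<Longrightarrow> e \<in> edges G \<Longrightarrow> R e \<notin> A \<Longrightarrow> R e \<in> outer A"
| outer_L: "R e \<in> outer A \<Longrightarrow> e \<in> edges G \<Longrightarrow> L e \<notin> A \<Longrightarrow> L e \<in> outer A"

lemma outer_disjoint: "A \<subseteq> Faces \<Longrightarrow> x \<in> outer A \<Longrightarrow> x \<notin> A"
  by (erule outer.cases) (use ext_notin in auto)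

lemma outer_mono: "x \<in> outer A \<Longrightarrow> B \<subseteq> A \<Longrightarrow> x \<in> outer B"
  by (induction rule: outer.induct) (auto intro: outer.intros)

definition fill :: "'f set \<Rightarrow> 'f set" where
  "fill A = Faces - outer A"

lemma subset_fill: "A \<subseteq> Faces \<Longrightarrow> A \<subseteq> fill A"
  using outer_disjoint by (auto simp: fill_def)

lemma outer_fill: "x \<in> outer A \<Longrightarrow> x \<in> outer (fill A)"
  by (induction rule: outer.induct) (auto intro: outer.intros simp: fill_def)

lemma fill_fill: "A \<subseteq> Faces \<Longrightarrow> fill (fill A) = fill A"
  using outer_fill[of _ A] outer_mono[of _ "fill A" A] subset_fill[of A] by (auto simp: fill_def)

text \<open>If \<open>L e\<close> were outer, crossing \<open>e\<close> would make
  \<open>R e\<close> outer unless \<open>R e\<close> lies in \<open>A\<close>; but then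
  \<open>L e\<close> lies in \<open>A\<close> as well and cannot be outer.\<close>

lemma up_closed_fill: "A \<subseteq> Faces \<Longrightarrow> up_closed A \<Longrightarrow> up_closed (fill A)"
  unfolding up_closed_def
proof clarify
  fix e assume A: "A \<subseteq> Faces" "\<forall>e\<in>edges G. R e \<in> A \<longrightarrow> L e \<in> A" and e: "e \<in> edges G" "R e \<in> fill A"
  show "L e \<in> fill A"
  proof (rule ccontr)
    assume "L e \<notin> fill A"
    then have "L e \<in> outer A" using L_in[OF e(1)] outer_ext by (auto simp: fill_def)
    moreover have "R e \<in> A" using outer_R[OF calculation e(1)] e(2) by (auto simp: fill_def)
    ultimately show False using A outer_disjoint e(1) by blast
  qed
qed

lemma down_closed_fill: "A \<subseteq> Faces \<Longrightarrow> down_closed A \<Longrightarrow> down_closed (fill A)"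
  unfolding down_closed_def
proof clarify
  fix e assume A: "A \<subseteq> Faces" "\<forall>e\<in>edges G. L e \<in> A \<longrightarrow> R e \<in> A" and e: "e \<in> edges G" "L e \<in> fill A"
  show "R e \<in> fill A"
  proof (rule ccontr)
    assume "R e \<notin> fill A"
    then have "R e \<in> outer A" using R_in[OF e(1)] outer_ext by (auto simp: fill_def)
    moreover have "L e \<in> A" using outer_L[OF calculation e(1)] e(2) by (auto simp: fill_def)
    ultimately show False using A outer_disjoint e(1) by blast
  qed
qed

lemma closed_walk_level_set:
  assumes p: "walk G a p a" "p \<noteq> []"
  obtains n :: "'f \<Rightarrow> int" and A where "n ext = 0" "A \<subseteq> Faces" "A \<noteq> {}" "up_closed A \<or> down_closed A"
    "\<And>F. F \<in> A \<Longrightarrow> n F \<noteq> 0" "\<And>e. e \<in> edges G \<Longrightarrow> n (L e) \<noteq> n (R e) \<longleftrightarrow> e \<in> set p"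
proof -
  obtain n :: "'f \<Rightarrow> int" where n: "n ext = 0"
    "\<And>e. e \<in> edges G \<Longrightarrow> n (L e) - n (R e) = ecount (map (\<lambda>e. (e, True)) p) e"
    using winding[OF walk_imp_swalk[OF p(1)]] by blast
  have jump: "n (L e) - n (R e) = int (count_list p e)" if "e \<in> edges G" for e
    using n(2)[OF that] by (simp add: ecount_walk)
  have iff: "n (L e) \<noteq> n (R e) \<longleftrightarrow> e \<in> set p" if "e \<in> edges G" for e
    using jump[OF that] by (metis count_list_0_iff eq_iff_diff_eq_0 of_nat_eq_0_iff)
  obtain e0 where e0: "e0 \<in> set p" "e0 \<in> edges G" using p walk_edges by (metis hd_in_set subsetD)
  then have "int (count_list p e0) > 0" by (metis count_list_0_iff gr0I of_nat_0_less_iff)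
  \<comment> \<open>The value grows from right to left by at least 1 across an edge of the walk and
    is unchanged across all others. The thresholds 1 and -1 exclude the exterior, whose value is
    0.\<close>
  then have "n (L e0) \<ge> 1 \<or> n (R e0) \<le> -1" using jump[OF e0(2)] by linarith
  then show thesis
  proof
    assume a: "n (L e0) \<ge> 1"
    let ?A = "{F \<in> Faces. n F \<ge> 1}"
    have "L e0 \<in> ?A" using a n(1) L_in[OF e0(2)] by auto
    moreover have "up_closed ?A" unfolding up_closed_def
    proof clarify
      fix e assume e: "e \<in> edges G" "n (R e) \<ge> 1"
      then have "n (L e) \<ge> 1" using jump[OF e(1)] by linarith
      then show "L e \<in> Faces \<and> n (L e) \<ge> 1" using n(1) L_in[OF e(1)] by auto
    qed
    ultimately show thesis using that[of n ?A] n(1) iff by auto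
  next
    assume a: "n (R e0) \<le> -1"
    let ?A = "{F \<in> Faces. n F \<le> -1}"
    have "R e0 \<in> ?A" using a n(1) R_in[OF e0(2)] by auto
    moreover have "down_closed ?A" unfolding down_closed_def
    proof clarify
      fix e assume e: "e \<in> edges G" "n (L e) \<le> -1"
      then have "n (R e) \<le> -1" using jump[OF e(1)] by linarith
      then show "R e \<in> Faces \<and> n (R e) \<le> -1" using n(1) R_in[OF e(1)] by auto
    qed
    ultimately show thesis using that[of n ?A] n(1) iff by auto
  qed
qed

text \<open>The two boundary paths of a face start at the same vertex, and \<open>h\<close> is
  constant along both when the face is not in \<open>A\<close>. For the exterior that vertex is
  \<open>s\<close>.\<close>

lemma face_sides_constant:
  fixes h :: "'v \<Rightarrow> int"
  assumes x: "x \<in> insert ext Faces" "x \<notin> A"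
    and h: "\<And>e. e \<in> edges G \<Longrightarrow> L e \<notin> A \<or> R e \<notin> A \<Longrightarrow> h (src G e) = h (tgt G e)"
  obtains c where "\<And>e. e \<in> edges G \<Longrightarrow> L e = x \<or> R e = x \<Longrightarrow> h (src G e) = c" "x = ext \<Longrightarrow> c = h s"
proof -
  have path: "h (src G e) = h a" if p: "spath G a p b" "\<And>e. e \<in> set p \<Longrightarrow> e \<in> edges G \<and> (L e = x \<or> R e = x)" "e \<in> set p" for a p b e
  proof (rule walk_constant(2)[of G a p b h])
    show "walk G a p b" using p(1) by (simp add: spath_def)
    show "h (src G e) = h (tgt G e)" if "e \<in> set p" for e using p(2)[OF that] h[of e] x(2) by auto
  qed (use p(3) in simp)
  show thesis
  proof (cases "x = ext")
    case True
    show thesis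
    proof (rule that[of "h s"])
      fix e assume "e \<in> edges G" "L e = x \<or> R e = x"
      then have "e \<in> set D \<or> e \<in> set C" using set_D set_C True by auto
      then show "h (src G e) = h s" using path[OF D_path] path[OF C_path] set_D set_C True by auto
    qed simp
  next
    case False
    then have F: "x \<in> Faces" using x by auto
    show thesis
    proof (rule that[of "h (fs x)"])
      fix e assume "e \<in> edges G" "L e = x \<or> R e = x"
      then have "e \<in> set (dm x) \<or> e \<in> set (cd x)" using set_dm[OF F] set_cd[OF F] by auto
      then show "h (src G e) = h (fs x)" using path[OF dm_path[OF F]] path[OF cd_path[OF F]] set_dm[OF F] set_cd[OF F] by auto
    qed (use False in simp)
  qed
qed

text \<open>Consecutive faces on a route from the exterior share the edge that is crossed, so the
  constant of one face passes on to the next.\<close>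

lemma outer_sides_constant:
  fixes h :: "'v \<Rightarrow> int"
  assumes "A \<subseteq> Faces"
    and h: "\<And>e. e \<in> edges G \<Longrightarrow> L e \<notin> A \<or> R e \<notin> A \<Longrightarrow> h (src G e) = h (tgt G e)"
    and "x \<in> outer A"
  shows "\<forall>e\<in>edges G. L e = x \<or> R e = x \<longrightarrow> h (src G e) = h s"
  using assms(3)
proof induction
  case outer_ext
  have x: "ext \<in> insert ext Faces" "ext \<notin> A" using assms(1) ext_notin by auto
  obtain c where c: "\<And>e. e \<in> edges G \<Longrightarrow> L e = ext \<or> R e = ext \<Longrightarrow> h (src G e) = c" "ext = ext \<Longrightarrow> c = h s"
    by (rule face_sides_constant[OF x h]) (assumption+, rule that)
  then show ?case by simp
next
  case (outer_R e)
  have "h (src G e) = h s" using outer_R.IH outer_R.hyps(2) by blast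
  moreover obtain c where "\<And>e'. e' \<in> edges G \<Longrightarrow> L e' = R e \<or> R e' = R e \<Longrightarrow> h (src G e') = c"
    by (rule face_sides_constant[OF R_in[OF outer_R.hyps(2)] outer_R.hyps(3) h]) (assumption+, rule that)
  ultimately show ?case using outer_R.hyps(2) by metis
next
  case (outer_L e)
  have "h (src G e) = h s" using outer_L.IH outer_L.hyps(2) by blast
  moreover obtain c where "\<And>e'. e' \<in> edges G \<Longrightarrow> L e' = L e \<or> R e' = L e \<Longrightarrow> h (src G e') = c"
    by (rule face_sides_constant[OF L_in[OF outer_L.hyps(2)] outer_L.hyps(3) h]) (assumption+, rule that)
  ultimately show ?case using outer_L.hyps(2) by metis
qed

text \<open>A minimal filled closed set of faces would contain a directed cycle in its interior; the level set of
  the winding number of that cycle, once filled, is again such a set, so by minimality it is the whole set,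
  although its boundary lies strictly inside.\<close>

lemma no_closed_face_set:
  assumes "A \<subseteq> Faces" "up_closed A \<or> down_closed A"
  shows "A = {}"
proof (rule ccontr)
  assume "A \<noteq> {}"
  define P where "P A \<longleftrightarrow> A \<subseteq> Faces \<and> A \<noteq> {} \<and> (up_closed A \<or> down_closed A) \<and> fill A = A" for A
  have Pfill: "P (fill B)" if "B \<subseteq> Faces" "B \<noteq> {}" "up_closed B \<or> down_closed B" for B
    using that fill_fill[of B] subset_fill[of B] up_closed_fill[of B] down_closed_fill[of B]
    unfolding P_def by (auto simp: fill_def)
  have "\<exists>A. P A" using Pfill[OF assms(1) \<open>A \<noteq> {}\<close> assms(2)] by blast
  then obtain A where A: "P A" and least: "\<And>B. P B \<Longrightarrow> card A \<le> card B"
    by (metis (full_types) ex_has_least_nat)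
  have A1: "A \<subseteq> Faces" "A \<noteq> {}" "up_closed A \<or> down_closed A" "fill A = A" using A by (auto simp: P_def)
  have "no_top A \<or> no_bottom A" using A1 up_closed_no_top down_closed_no_bottom by blast
  then obtain h :: "'v \<Rightarrow> int" and a p where p: "walk G a p a" "p \<noteq> []" "\<And>e. e \<in> set p \<Longrightarrow> h (src G e) \<noteq> h s"
    and h: "\<And>e. e \<in> edges G \<Longrightarrow> L e \<notin> A \<or> R e \<notin> A \<Longrightarrow> h (src G e) = h (tgt G e)"
    using potential_and_cycle[OF A1(1,2)] by metis
  obtain n :: "'f \<Rightarrow> int" and B where n: "n ext = 0" and B: "B \<subseteq> Faces" "B \<noteq> {}" "up_closed B \<or> down_closed B"
    and nB: "\<And>F. F \<in> B \<Longrightarrow> n F \<noteq> 0" and np: "\<And>e. e \<in> edges G \<Longrightarrow> n (L e) \<noteq> n (R e) \<longleftrightarrow> e \<in> set p"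
    using closed_walk_level_set[OF p(1,2)] by metis
  \<comment> \<open>The cycle runs through vertices off the level of \<open>s\<close>, whereas edges
    bordering an outer face start on that level.\<close>
  have side: "L e \<notin> outer A" "R e \<notin> outer A" if "e \<in> set p" for e
  proof -
    have "e \<in> edges G" using that walk_edges[OF p(1)] by blast
    then show "L e \<notin> outer A" "R e \<notin> outer A" using outer_sides_constant[OF A1(1) h] p(3)[OF that] by blast+
  qed
  \<comment> \<open>A route from the exterior through outer faces crosses no edge of the cycle, so
    the winding number stays 0 along it.\<close>
  have n0: "n x = 0" if "x \<in> outer A" for x
    using that
  proof induction
    case outer_ext then show ?case using n by simp
  next
    case (outer_R e) then show ?case using np[OF outer_R(2)] side by metis
  next
    case (outer_L e) then show ?case using np[OF outer_L(2)] side by metis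
  qed
  have "B \<subseteq> A"
  proof
    fix F assume "F \<in> B"
    then have "F \<in> Faces" "F \<notin> outer A" using B(1) nB n0 by blast+
    then have "F \<in> fill A" by (simp add: fill_def)
    then show "F \<in> A" using A1(4) by simp
  qed
  have outAB: "outer A \<subseteq> outer B" using outer_mono[OF _ \<open>B \<subseteq> A\<close>] by blast
  then have "fill B \<subseteq> fill A" by (auto simp: fill_def)
  then have "fill B \<subseteq> A" using A1(4) by simp
  moreover have "finite A" using A1(1) fin_F finite_subset by blast
  ultimately have fB: "fill B = A" using least[OF Pfill[OF B]] card_seteq by metis
  have mem: "x \<in> A \<or> x \<in> outer A" if "x \<in> insert ext Faces" for x
    using that A1(4) outer_ext by (auto simp: fill_def)
  have disj: "x \<notin> outer B" if "x \<in> A" for x using that fB by (auto simp: fill_def)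
  obtain e where e: "e \<in> edges G" "(L e \<in> A) \<noteq> (R e \<in> A)" using dual_connected[OF A1(1,2)] by blast
  show False
  proof (cases "L e \<in> A")
    case True
    then have R: "R e \<in> outer A" using e mem[OF R_in[OF e(1)]] by blast
    then have "R e \<in> outer B" using outAB by blast
    then have "L e \<in> B" using outer_L[of e B] e(1) disj[OF True] by blast
    then have "n (L e) \<noteq> n (R e)" using nB n0[OF R] by metis
    then show False using np[OF e(1)] side R by blast
  next
    case False
    then have R: "L e \<in> outer A" "R e \<in> A" using e mem[OF L_in[OF e(1)]] by blast+
    then have "L e \<in> outer B" using outAB by blast
    then have "R e \<in> B" using outer_R[of e B] e(1) disj[OF R(2)] by blast
    then have "n (L e) \<noteq> n (R e)" using nB n0[OF R(1)] by metis
    then show False using np[OF e(1)] side R(1) by blast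
  qed
qed

lemma no_directed_cycle: "walk G a p a \<Longrightarrow> p = []"
proof (rule ccontr)
  assume p: "walk G a p a" "p \<noteq> []"
  show False
    by (rule closed_walk_level_set[OF p]) (use no_closed_face_set in blast)
qed

lemma no_endless_face_set:
  assumes "A \<subseteq> Faces" "no_top A \<or> no_bottom A"
  shows "A = {}"
proof (rule ccontr)
  assume "A \<noteq> {}"
  show False
    by (rule potential_and_cycle[OF assms(1) \<open>A \<noteq> {}\<close> assms(2)]) (use no_directed_cycle in blast)
qed

section \<open>Winding numbers of paths\<close>


text \<open>Without directed cycles a walk from \<open>c\<close> can use an edge leaving
  \<open>c\<close> only as its first edge, so the two walks agree edge by edge.\<close>

lemma walk_prefix:
  assumes "walk G c q d" "walk G c y b" "set q \<subseteq> set y"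
  shows "\<exists>v. y = q @ v"
  using assms
proof (induction q arbitrary: c y)
  case Nil
  then show ?case by simp
next
  case (Cons f q)
  then obtain g y' where y: "y = g # y'" by (cases y) auto
  have fg: "f = g"
  proof (rule ccontr)
    assume "f \<noteq> g"
    then have "f \<in> set y'" using Cons.prems y by auto
    then obtain y1 y2 where "y' = y1 @ f # y2" by (meson split_list)
    then have "walk G c ((g # y1) @ f # y2) b" using Cons.prems y by simp
    then obtain c' where "walk G c (g # y1) c'" "walk G c' (f # y2) b" unfolding walk_app by blast
    then have "walk G c (g # y1) c" using Cons.prems(1) by auto
    then show False using no_directed_cycle by blast
  qed
  have "f \<notin> set q"
  proof
    assume "f \<in> set q"
    then obtain q1 q2 where "q = q1 @ f # q2" by (meson split_list)
    then have "walk G c ((f # q1) @ f # q2) d" using Cons.prems by simp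
    then obtain c' where "walk G c (f # q1) c'" "walk G c' (f # q2) d" unfolding walk_app by blast
    then have "walk G c (f # q1) c" by auto
    then show False using no_directed_cycle by blast
  qed
  then have "set q \<subseteq> set y'" using Cons.prems(3) y fg by auto
  then show ?case using Cons y fg by auto
qed

lemma walk_distinct: "walk G a p b \<Longrightarrow> distinct p"
proof (induction p arbitrary: a)
  case (Cons f q)
  have "f \<notin> set q"
  proof
    assume "f \<in> set q"
    then obtain q1 q2 where "q = q1 @ f # q2" by (meson split_list)
    then have "walk G a ((f # q1) @ f # q2) b" using Cons.prems by simp
    then obtain c' where "walk G a (f # q1) c'" "walk G c' (f # q2) b" unfolding walk_app by blast
    then have "walk G a (f # q1) a" by auto
    then show False using no_directed_cycle by blast
  qed
  then show ?case using Cons by auto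
qed simp

lemma walk_eqI:
  assumes "walk G a p b" "walk G a q b'" "set p = set q"
  shows "p = q"
proof -
  have "set p \<subseteq> set q" using assms(3) by simp
  then obtain v where v: "q = p @ v" using walk_prefix[OF assms(1,2)] by blast
  have "distinct (p @ v)" using walk_distinct[OF assms(2)] v by simp
  moreover have "set v \<subseteq> set p" using assms(3) v by (metis set_append Un_upper2)
  ultimately have "v = []" by (cases v) auto
  then show ?thesis using v by simp
qed

text \<open>Needed for the domain of a face: once all its edges lie on \<open>p\<close>, it is a
  segment of \<open>p\<close> and can be replaced.\<close>

lemma walk_contains_walk:
  assumes p: "walk G a p b" and q: "walk G c q d" "q \<noteq> []" "set q \<subseteq> set p"
  obtains u v where "p = u @ q @ v" "walk G a u c" "walk G d v b"
proof -
  obtain e q' where q': "q = e # q'" using q(2) by (cases q) auto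
  then have "e \<in> set p" using q(3) by auto
  then obtain u y where py: "p = u @ e # y" by (meson split_list)
  then obtain c' where u: "walk G a u c'" and ey: "walk G c' (e # y) b" using p walk_app by blast
  have c': "c' = c" using ey q(1) q' by auto
  have "set q \<subseteq> set (e # y)"
  proof
    fix g assume g: "g \<in> set q"
    \<comment> \<open>An edge \<open>g\<close> of \<open>q\<close> placed before \<open>e\<close> on
      \<open>p\<close> would close a cycle: from \<open>g\<close> along \<open>p\<close> to
      \<open>c\<close>, and back along \<open>q\<close> to the source of \<open>g\<close>.\<close>
    show "g \<in> set (e # y)"
    proof (rule ccontr)
      assume "g \<notin> set (e # y)"
      then have "g \<in> set u" using g q(3) py by auto
      then obtain u1 u2 where u12: "u = u1 @ g # u2" by (meson split_list)
      obtain q1 q2 where q12: "q = q1 @ g # q2" using g by (meson split_list)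
      obtain c1 where "walk G c1 (g # u2) c" using u u12 c' walk_app by blast
      then have "walk G (src G g) (g # u2) c" by auto
      moreover obtain c2 where "walk G c q1 c2" "walk G c2 (g # q2) d" using q(1) q12 walk_app by blast
      then have "walk G c q1 (src G g)" by auto
      ultimately have "walk G (src G g) ((g # u2) @ q1) (src G g)" unfolding walk_app by blast
      then show False using no_directed_cycle by blast
    qed
  qed
  then obtain v where v: "e # y = q @ v" using walk_prefix[OF q(1)] ey c' by blast
  then obtain d' where "walk G c q d'" "walk G d' v b" using ey c' walk_app by metis
  moreover have "d' = d" using calculation(1) q(1) walk_end_unique by metis
  ultimately show thesis using that[of u v] py v u c' by auto
qed

text \<open>The set where the two functions differ omits the exterior and contains both sides of an
  edge or neither, so dual connectedness makes it empty.\<close>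

lemma face_function_unique:
  fixes n n' :: "'f \<Rightarrow> int"
  assumes "n ext = 0" "n' ext = 0" "\<And>e. e \<in> edges G \<Longrightarrow> n (L e) - n (R e) = n' (L e) - n' (R e)" "F \<in> Faces"
  shows "n F = n' F"
proof (rule ccontr)
  assume "n F \<noteq> n' F"
  let ?A = "{F \<in> Faces. n F \<noteq> n' F}"
  have "?A \<noteq> {}" using assms(4) \<open>n F \<noteq> n' F\<close> by auto
  then obtain e where e: "e \<in> edges G" "(L e \<in> ?A) \<noteq> (R e \<in> ?A)" using dual_connected[of ?A] by blast
  have "L e \<in> ?A \<longleftrightarrow> n (L e) \<noteq> n' (L e)" "R e \<in> ?A \<longleftrightarrow> n (R e) \<noteq> n' (R e)"
    using L_in[OF e(1)] R_in[OF e(1)] assms(1,2) by auto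
  then show False using e assms(3)[OF e(1)] by auto
qed

text \<open>The winding number of \<open>p\<close> followed by the reverse of \<open>D\<close>,
  specified by its value on the exterior and its jumps. These determine it on bounded faces, so the
  choice is harmless there.\<close>

definition wind :: "'e list \<Rightarrow> 'f \<Rightarrow> int" where
  "wind p = (SOME n. n ext = 0 \<and> (\<forall>e\<in>edges G. n (L e) - n (R e) = int (count_list p e) - int (count_list D e)))"

lemma wind_exists:
  assumes "walk G s p t"
  shows "wind p ext = 0" "e \<in> edges G \<Longrightarrow> wind p (L e) - wind p (R e) = int (count_list p e) - int (count_list D e)"
proof -
  let ?l = "map (\<lambda>e. (e, True)) p @ srev (map (\<lambda>e. (e, True)) D)"
  have "swalk G s ?l s"
    using walk_imp_swalk[OF assms] swalk_srev[OF walk_imp_swalk, of s D t] D_path swalk_append by (auto simp: spath_def)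
  then obtain n where "n ext = 0 \<and> (\<forall>e\<in>edges G. n (L e) - n (R e) = ecount ?l e)" using winding by blast
  then have "\<exists>n. n ext = 0 \<and> (\<forall>e\<in>edges G. n (L e) - n (R e) = int (count_list p e) - int (count_list D e))"
    unfolding ecount_walk_srev by auto
  from someI_ex[OF this, folded wind_def]
  show "wind p ext = 0" "e \<in> edges G \<Longrightarrow> wind p (L e) - wind p (R e) = int (count_list p e) - int (count_list D e)"
    by auto
qed

lemma wind_unique:
  assumes "walk G s p t" "n ext = 0"
    "\<And>e. e \<in> edges G \<Longrightarrow> n (L e) - n (R e) = int (count_list p e) - int (count_list D e)" "F \<in> Faces"
  shows "wind p F = n F"
  using face_function_unique[of "wind p" n F] wind_exists[OF assms(1)] assms by simp

lemma D_walk: "walk G s D t" using D_path by (simp add: spath_def)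

lemma count_D: "e \<in> edges G \<Longrightarrow> count_list D e = (if L e = ext then 1 else 0)"
  using count_list_distinct[OF walk_distinct[OF D_walk]] set_D by auto

lemma wind_jump:
  assumes "walk G s p t" "e \<in> edges G"
  shows "wind p (L e) - wind p (R e) = (if e \<in> set p then 1 else 0) - (if L e = ext then 1 else 0)"
  using wind_exists(2)[OF assms] count_D[OF assms(2)] count_list_distinct[OF walk_distinct[OF assms(1)], of e] by simp

text \<open>Across an edge with the exterior on its left the value on the right is 0 or 1; across
  any other edge the value does not drop from right to left. Hence the faces of value at least 2
  form an up-closed set and those of value at most -1 a down-closed one.\<close>

lemma wind_01:
  assumes p: "walk G s p t" and F: "F \<in> Faces"
  shows "wind p F \<in> {0, 1}"
proof -
  have "{F \<in> Faces. wind p F \<ge> 2} = {}"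
  proof (rule no_closed_face_set)
    show "up_closed {F \<in> Faces. wind p F \<ge> 2} \<or> down_closed {F \<in> Faces. wind p F \<ge> 2}"
    proof (rule disjI1, unfold up_closed_def, clarify)
      fix e assume e: "e \<in> edges G" "wind p (R e) \<ge> 2"
      then have "L e \<noteq> ext" using wind_jump[OF p e(1)] wind_exists(1)[OF p] by (auto split: if_splits)
      then show "L e \<in> Faces \<and> wind p (L e) \<ge> 2"
        using wind_jump[OF p e(1)] e L_in[OF e(1)] by (auto split: if_splits)
    qed
  qed auto
  moreover have "{F \<in> Faces. wind p F \<le> -1} = {}"
  proof (rule no_closed_face_set)
    show "up_closed {F \<in> Faces. wind p F \<le> -1} \<or> down_closed {F \<in> Faces. wind p F \<le> -1}"
    proof (rule disjI2, unfold down_closed_def, clarify)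
      fix e assume e: "e \<in> edges G" "L e \<in> Faces" "wind p (L e) \<le> -1"
      then have "wind p (R e) \<le> -1" using wind_jump[OF p e(1)] ext_notin by (auto split: if_splits)
      moreover have "R e \<noteq> ext" using calculation wind_exists(1)[OF p] by auto
      ultimately show "R e \<in> Faces \<and> wind p (R e) \<le> -1" using R_in[OF e(1)] by auto
    qed
  qed auto
  ultimately have "\<not> wind p F \<ge> 2" "\<not> wind p F \<le> -1" using F by auto
  then show ?thesis by auto
qed

lemma wind_mono:
  assumes p: "walk G s p t" and e: "e \<in> edges G" "L e \<in> Faces"
  shows "wind p (R e) \<le> wind p (L e)"
  using wind_jump[OF p e(1)] e(2) ext_notin by (auto split: if_splits)

lemma wind_inj:
  assumes p: "walk G s p t" and q: "walk G s q t" and eq: "\<And>F. F \<in> Faces \<Longrightarrow> wind p F = wind q F"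
  shows "p = q"
proof (rule walk_eqI[OF p q])
  have *: "wind p x = wind q x" if "x \<in> insert ext Faces" for x
    using that eq wind_exists(1)[OF p] wind_exists(1)[OF q] by auto
  have "e \<in> set p \<longleftrightarrow> e \<in> set q" if "e \<in> edges G" for e
    using wind_jump[OF p that] wind_jump[OF q that] *[OF L_in[OF that]] *[OF R_in[OF that]] by (auto split: if_splits)
  then show "set p = set q" using walk_edges[OF p] walk_edges[OF q] by blast
qed

lemma wind_D: "F \<in> Faces \<Longrightarrow> wind D F = 0"
  using wind_unique[OF D_walk, of "\<lambda>_. 0" F] by simp

lemma count_dm: "F \<in> Faces \<Longrightarrow> e \<in> edges G \<Longrightarrow> count_list (dm F) e = (if R e = F then 1 else 0)"
  using count_list_distinct[OF walk_distinct, of "fs F" "dm F" "ft F" e] dm_path[of F] set_dm[of F] by (auto simp: spath_def)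

lemma count_cd: "F \<in> Faces \<Longrightarrow> e \<in> edges G \<Longrightarrow> count_list (cd F) e = (if L e = F then 1 else 0)"
  using count_list_distinct[OF walk_distinct, of "fs F" "cd F" "ft F" e] cd_path[of F] set_cd[of F] by (auto simp: spath_def)

lemma flip_walk:
  assumes "walk G a (u @ dm F @ v) b" "F \<in> Faces"
  shows "walk G a (u @ cd F @ v) b" "walk G a u (fs F)" "walk G (ft F) v b"
proof -
  obtain c d where *: "walk G a u c" "walk G c (dm F) d" "walk G d v b" using assms(1) walk_app by metis
  have dm: "walk G (fs F) (dm F) (ft F)" "dm F \<noteq> []" and cd: "walk G (fs F) (cd F) (ft F)"
    using dm_path cd_path assms(2) by (auto simp: spath_def)
  have "c = fs F" using *(2) dm by (cases "dm F") auto
  moreover from this have "d = ft F" using *(2) dm(1) walk_end_unique by metis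
  ultimately show "walk G a u (fs F)" "walk G (ft F) v b" using * by auto
  then show "walk G a (u @ cd F @ v) b" using cd walk_app by metis
qed

text \<open>Trading the domain of \<open>F\<close> for its codomain adds the boundary of
  \<open>F\<close>, whose face function is the indicator of \<open>F\<close>.\<close>

lemma wind_flip:
  assumes p: "walk G s (u @ dm F @ v) t" and F: "F \<in> Faces" and F': "F' \<in> Faces"
  shows "wind (u @ cd F @ v) F' = wind (u @ dm F @ v) F' + (if F' = F then 1 else 0)"
proof (rule wind_unique[OF flip_walk(1)[OF p F], of "\<lambda>F'. wind (u @ dm F @ v) F' + (if F' = F then 1 else 0)"])
  show "wind (u @ dm F @ v) ext + (if ext = F then 1 else 0) = 0" using wind_exists(1)[OF p] F ext_notin by auto
  show "wind (u @ dm F @ v) (L e) + (if L e = F then 1 else 0) - (wind (u @ dm F @ v) (R e) + (if R e = F then 1 else 0)) =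
         int (count_list (u @ cd F @ v) e) - int (count_list D e)" if "e \<in> edges G" for e
    using wind_exists(2)[OF p that] count_dm[OF F that] count_cd[OF F that] by auto
qed (use F' in simp)

text \<open>The values force every edge of the domain of \<open>F\<close> onto \<open>p\<close>.
  Where the exterior lies above, both values are 0, and the jump -1 due to \<open>D\<close> has to
  be compensated by \<open>p\<close>.\<close>

lemma flip_exists:
  assumes p: "walk G s p t" and F: "F \<in> Faces" "wind p F = 0"
    and above: "\<And>e. e \<in> edges G \<Longrightarrow> R e = F \<Longrightarrow> L e = ext \<or> wind p (L e) = 1"
  obtains u v where "p = u @ dm F @ v"
proof -
  have "set (dm F) \<subseteq> set p"
  proof
    fix e assume "e \<in> set (dm F)"
    then have e: "e \<in> edges G" "R e = F" using set_dm[OF F(1)] by auto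
    then show "e \<in> set p"
      using wind_jump[OF p e(1)] above[OF e] F(2) wind_exists(1)[OF p] by (auto split: if_splits)
  qed
  then show thesis using walk_contains_walk[OF p, of "fs F" "dm F" "ft F"] dm_path[OF F(1)] that unfolding spath_def by metis
qed

text \<open>Among the faces where \<open>wind p\<close> is 0 and \<open>g\<close> is 1 there is one
  with none of them directly above it. Monotonicity of \<open>g\<close> then gives value 1 of
  \<open>wind p\<close> on all bounded faces directly above it.\<close>

lemma available_flip:
  fixes g :: "'f \<Rightarrow> int"
  assumes p: "walk G s p t" and g: "\<And>F. F \<in> Faces \<Longrightarrow> g F \<in> {0, 1}"
    "\<And>e. e \<in> edges G \<Longrightarrow> L e \<in> Faces \<Longrightarrow> R e \<in> Faces \<Longrightarrow> g (R e) \<le> g (L e)"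
    and le: "\<And>F. F \<in> Faces \<Longrightarrow> wind p F \<le> g F" and F0: "F0 \<in> Faces" "wind p F0 \<noteq> g F0"
  obtains F u v where "F \<in> Faces" "wind p F = 0" "g F = 1" "p = u @ dm F @ v"
proof -
  define A where "A = {F \<in> Faces. wind p F = 0 \<and> g F = 1}"
  have "A \<subseteq> Faces" by (auto simp: A_def)
  have "F0 \<in> A" using F0 g(1)[of F0] le[of F0] wind_01[OF p, of F0] by (auto simp: A_def)
  then have "\<not> no_top A" using no_endless_face_set[OF \<open>A \<subseteq> Faces\<close>] by auto
  then obtain F where F: "F \<in> A" "\<And>e. e \<in> edges G \<Longrightarrow> R e = F \<Longrightarrow> L e \<notin> A" unfolding no_top_def by blast
  have FF: "F \<in> Faces" "wind p F = 0" "g F = 1" using F(1) by (auto simp: A_def)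
  have "L e = ext \<or> wind p (L e) = 1" if e: "e \<in> edges G" "R e = F" for e
  proof (cases "L e = ext")
    case False
    then have Le: "L e \<in> Faces" using L_in[OF e(1)] by auto
    then have "g (L e) = 1" using g(2)[OF e(1) Le] g(1)[OF Le] e(2) FF by auto
    then show ?thesis using F(2)[OF e] wind_01[OF p Le] Le by (auto simp: A_def)
  qed simp
  then obtain u v where "p = u @ dm F @ v" using flip_exists[OF p FF(1,2)] by metis
  then show thesis using that FF by blast
qed

end

section \<open>Normal forms of 2-cells\<close>

inductive_cases wt2_VC_E: "wt2 G (VC x y) a b"

text \<open>The multiplicity of each atomic cell, which turns out to be the difference of the face
  functions of target and source.\<close>

primrec atom_count :: "('e, 'c) tm2 \<Rightarrow> 'c \<Rightarrow> nat" where
  "atom_count (Id2 p) = (\<lambda>_. 0)"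
| "atom_count (At F) = (\<lambda>F'. if F' = F then 1 else 0)"
| "atom_count (LW u x) = atom_count x"
| "atom_count (RW x v) = atom_count x"
| "atom_count (VC x y) = (\<lambda>F. atom_count x F + atom_count y F)"

lemma disjoint_segments_split:
  assumes "u @ d @ v = u' @ d' @ v'" "set d \<inter> set d' = {}" "d \<noteq> []" "d' \<noteq> []"
  obtains m where "u' = u @ d @ m" "v = m @ d' @ v'" | m where "u = u' @ d' @ m" "v' = m @ d @ v"
proof -
  have split: "\<exists>m. us = d @ m \<and> v = m @ d' @ v'" if ds: "d @ v = us @ d' @ v'" "set d \<inter> set d' = {}" "d' \<noteq> []"
    for d v us d' v' :: "'a list"
  proof -
    obtain ws where "d = us @ ws \<and> ws @ v = d' @ v' \<or> d @ ws = us \<and> v = ws @ d' @ v'"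
      using ds(1) append_eq_append_conv2[of d v us "d' @ v'"] by auto
    then show ?thesis
    proof
      assume w: "d = us @ ws \<and> ws @ v = d' @ v'"
      \<comment> \<open>An overlap \<open>ws\<close> would begin with the first entry of
        \<open>d'\<close>, which would then be an entry of \<open>d\<close> as well.\<close>
      have "ws = []"
      proof (rule ccontr)
        assume "ws \<noteq> []"
        then have "hd ws = hd d'" using w ds(3) by (metis hd_append2)
        then show False using w ds(2,3) hd_in_set[OF \<open>ws \<noteq> []\<close>] hd_in_set[OF ds(3)] by auto
      qed
      then show ?thesis using w by auto
    qed auto
  qed
  obtain us where "u = u' @ us \<and> us @ d @ v = d' @ v' \<or> u @ us = u' \<and> d @ v = us @ d' @ v'"
    using assms(1) append_eq_append_conv2[of u "d @ v" u' "d' @ v'"] by auto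
  then show thesis
  proof
    assume u: "u = u' @ us \<and> us @ d @ v = d' @ v'"
    then obtain m where "us = d' @ m" "v' = m @ d @ v" using split[of d' v' us d v] assms(2,3) by auto
    then show thesis using that(2)[of m] u by auto
  next
    assume u: "u @ us = u' \<and> d @ v = us @ d' @ v'"
    then obtain m where "us = d @ m" "v = m @ d' @ v'" using split[of d v us d' v'] assms(2,4) by auto
    then show thesis using that(1)[of m] u by auto
  qed
qed

locale pasting_cells = anchored_graph G s t "interior_faces G" ext L R "cell_dom G" "cell_cod G" "cell_src G" "cell_tgt G" D C
  for G :: "('v,'e) pgraph" and s t ext L R D C
begin

abbreviation (input) "cells \<equiv> interior_faces G"

lemma cell_walks: "F \<in> cells \<Longrightarrow> walk G (cell_src G F) (cell_dom G F) (cell_tgt G F)"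
  "F \<in> cells \<Longrightarrow> walk G (cell_src G F) (cell_cod G F) (cell_tgt G F)"
  using dm_path cd_path by (auto simp: spath_def)

lemma wt2_walk: "wt2 G x a b \<Longrightarrow> walk G a (dom2 G x) b \<and> walk G a (cod2 G x) b"
  by (induction rule: wt2.induct) (auto simp: cell_walks walk_app)

lemma eq2_wt2:
  "eq2 G a b x y \<Longrightarrow> wt2 G x a b \<and> wt2 G y a b \<and> dom2 G x = dom2 G y \<and> cod2 G x = cod2 G y"
proof (induction rule: eq2.induct)
  case (vc_assoc x y z a b)
  then show ?case by (auto elim!: wt2_VC_E intro!: wt2.intros)
next
  case (vc_unitl x a b)
  then show ?case using wt2_walk by (auto intro!: wt2.intros)
next
  case (vc_unitr x a b)
  then show ?case using wt2_walk by (auto intro!: wt2.intros)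
next
  case (lw_id a u b p c)
  then have "walk G a (u @ p) c" using walk_app by blast
  then show ?case using lw_id by (auto intro: wt2.intros)
next
  case (rw_id a p b v c)
  then have "walk G a (p @ v) c" using walk_app by blast
  then show ?case using rw_id by (auto intro: wt2.intros)
next
  case (lw_vc a u b x y c)
  then show ?case by (auto elim!: wt2_VC_E intro: wt2.intros)
next
  case (rw_vc x y a b v c)
  then show ?case by (auto elim!: wt2_VC_E intro: wt2.intros)
next
  case (lw_nil x a b)
  have "walk G a [] a" using walk_start_in conjunct1[OF wt2_walk[OF lw_nil]] by simp
  then show ?case using lw_nil by (auto intro: wt2.intros)
next
  case (rw_nil x a b)
  have "walk G b [] b" using walk_end_in[OF conjunct1[OF wt2_walk[OF rw_nil]]] by simp
  then show ?case using rw_nil by (auto intro: wt2.intros)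
next
  case (lw_app a u b u' c x d)
  then have "walk G a (u @ u') c" using walk_app by blast
  then show ?case using lw_app by (auto intro: wt2.intros)
next
  case (rw_app x a b v c v' d)
  then have "walk G b (v @ v') d" using walk_app by blast
  then show ?case using rw_app by (auto intro: wt2.intros)
next
  case (interchange x a b y c)
  then show ?case using wt2_walk[of x a b] wt2_walk[of y b c] by (auto intro!: wt_vc wt_lw wt_rw intro: wt2.intros)
qed (auto intro: wt2.intros)

lemma atom_count_support: "wt2 G x a b \<Longrightarrow> F \<notin> cells \<Longrightarrow> atom_count x F = 0"
  by (induction rule: wt2.induct) auto

lemma atom_count_jump:
  assumes "wt2 G x a b" "e \<in> edges G"
  shows "int (count_list (cod2 G x) e) - int (count_list (dom2 G x) e) = int (atom_count x (L e)) - int (atom_count x (R e))"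
  using assms(1)
proof (induction rule: wt2.induct)
  case (wt_at F)
  then show ?case using count_dm[OF wt_at assms(2)] count_cd[OF wt_at assms(2)] by simp
qed auto

text \<open>A term changes its boundary path by the boundaries of its atoms, counted with
  multiplicity, and face functions are determined by their jumps. Multiplicities are natural
  numbers, so a 2-cell can only raise \<open>wind\<close>.\<close>

lemma hom2_wind:
  assumes x: "x \<in> hom2 G s t p q" and F: "F \<in> cells"
  shows "wind q F = wind p F + int (atom_count x F)"
proof -
  have wt: "wt2 G x s t" "dom2 G x = p" "cod2 G x = q" using x by (auto simp: hom2_def)
  then have p: "walk G s p t" and q: "walk G s q t" using wt2_walk by auto
  show ?thesis
  proof (rule wind_unique[OF q, of "\<lambda>F. wind p F + int (atom_count x F)"])
    show "wind p ext + int (atom_count x ext) = 0"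
      using wind_exists(1)[OF p] atom_count_support[OF wt(1) ext_notin] by simp
    show "wind p (L e) + int (atom_count x (L e)) - (wind p (R e) + int (atom_count x (R e))) =
         int (count_list q e) - int (count_list D e)" if "e \<in> edges G" for e
      using wind_exists(2)[OF p that] atom_count_jump[OF wt(1) that] wt by simp
  qed (use F in simp)
qed

abbreviation (input) "step u F v \<equiv> LW u (RW (At F) v)"

primrec chain :: "'e list \<Rightarrow> ('e list \<times> complex set \<times> 'e list) list \<Rightarrow> 'e list \<Rightarrow> bool" where
  "chain p [] q \<longleftrightarrow> p = q"
| "chain p (c # l) q \<longleftrightarrow> (case c of (u, F, v) \<Rightarrow> F \<in> cells \<and> p = u @ cell_dom G F @ v \<and> chain (u @ cell_cod G F @ v) l q)"

text \<open>The normal forms are right-nested vertical composites of atoms whiskered once on each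
  side, ending in an identity.\<close>

primrec nf :: "'e list \<Rightarrow> ('e list \<times> complex set \<times> 'e list) list \<Rightarrow> ('e, complex set) tm2" where
  "nf p [] = Id2 p"
| "nf p (c # l) = (case c of (u, F, v) \<Rightarrow> VC (step u F v) (nf (u @ cell_cod G F @ v) l))"

lemma wt2_step:
  assumes "F \<in> cells" "walk G a (u @ cell_dom G F @ v) b"
  shows "wt2 G (step u F v) a b"
  using flip_walk(2,3)[OF assms(2,1)] assms(1) by (auto intro: wt2.intros)

lemma nf_wt2:
  assumes "walk G a p b" "chain p l q"
  shows "wt2 G (nf p l) a b \<and> dom2 G (nf p l) = p \<and> cod2 G (nf p l) = q"
  using assms
proof (induction l arbitrary: p)
  case Nil
  then show ?case by (auto intro: wt2.intros)
next
  case (Cons c l)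
  obtain u F v where c: "c = (u, F, v)" by (cases c)
  have F: "F \<in> cells" "p = u @ cell_dom G F @ v" "chain (u @ cell_cod G F @ v) l q" using Cons.prems c by auto
  have w: "walk G a (u @ cell_dom G F @ v) b" using Cons.prems F by simp
  note IH = Cons.IH[OF flip_walk(1)[OF w F(1)] F(3)]
  then show ?case using wt2_step[OF F(1) w] F(2) by (auto simp: c intro!: wt_vc)
qed

lemma chain_walk: "walk G a p b \<Longrightarrow> chain p l q \<Longrightarrow> walk G a q b"
  using nf_wt2 wt2_walk by metis

lemma chain_append: "chain p l q \<Longrightarrow> chain q l' r \<Longrightarrow> chain p (l @ l') r"
  by (induction l arbitrary: p) auto

lemma eq2_VC_cong:
  assumes "eq2 G a b x x'" "eq2 G a b y y'" "cod2 G x = dom2 G y"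
  shows "eq2 G a b (VC x y) (VC x' y')"
  using eq2_wt2[OF assms(1)] eq2_wt2[OF assms(2)] assms by (intro eq_vc) (auto intro: wt2.intros)

lemma nf_append:
  assumes "walk G a p b" "chain p l q" "chain q l' r"
  shows "eq2 G a b (VC (nf p l) (nf q l')) (nf p (l @ l'))"
  using assms(1,2)
proof (induction l arbitrary: p)
  case Nil
  then have "wt2 G (nf q l') a b" "dom2 G (nf q l') = q" using nf_wt2 assms(3) by auto
  then show ?case using vc_unitl[of G "nf q l'" a b] Nil by simp
next
  case (Cons c l)
  obtain u F v where c: "c = (u, F, v)" by (cases c)
  have F: "F \<in> cells" "p = u @ cell_dom G F @ v" "chain (u @ cell_cod G F @ v) l q" using Cons.prems c by auto
  let ?p = "u @ cell_cod G F @ v"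
  have w: "walk G a (u @ cell_dom G F @ v) b" using Cons.prems F by simp
  have w': "walk G a ?p b" using flip_walk(1)[OF w F(1)] .
  have q: "walk G a q b" using chain_walk[OF w' F(3)] .
  have n1: "wt2 G (nf ?p l) a b" "dom2 G (nf ?p l) = ?p" "cod2 G (nf ?p l) = q" using nf_wt2[OF w' F(3)] by auto
  have n2: "wt2 G (nf q l') a b" "dom2 G (nf q l') = q" using nf_wt2[OF q assms(3)] by auto
  have st: "wt2 G (step u F v) a b" using wt2_step[OF F(1) w] .
  have 1: "eq2 G a b (VC (VC (step u F v) (nf ?p l)) (nf q l')) (VC (step u F v) (VC (nf ?p l) (nf q l')))"
    using st n1 n2 by (intro vc_assoc) (auto intro!: wt_vc)
  have 2: "eq2 G a b (VC (step u F v) (VC (nf ?p l) (nf q l'))) (VC (step u F v) (nf ?p (l @ l')))"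
    using Cons.IH[OF w' F(3)] st n1 by (intro eq2_VC_cong eq_refl) auto
  show ?case using eq_trans[OF 1 2] by (simp add: c)
qed

lemma nf_left_whisker:
  assumes "walk G a w a'" "walk G a' p b" "chain p l q"
  shows "eq2 G a b (LW w (nf p l)) (nf (w @ p) (map (\<lambda>(u, F, v). (w @ u, F, v)) l)) \<and>
    chain (w @ p) (map (\<lambda>(u, F, v). (w @ u, F, v)) l) (w @ q)"
  using assms(2,3)
proof (induction l arbitrary: p)
  case Nil
  then show ?case using lw_id[OF assms(1)] by auto
next
  case (Cons c l)
  obtain u F v where c: "c = (u, F, v)" by (cases c)
  have F: "F \<in> cells" "p = u @ cell_dom G F @ v" "chain (u @ cell_cod G F @ v) l q" using Cons.prems c by auto
  let ?p = "u @ cell_cod G F @ v"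
  have w: "walk G a' (u @ cell_dom G F @ v) b" using Cons.prems F by simp
  have w': "walk G a' ?p b" using flip_walk(1)[OF w F(1)] .
  have st: "wt2 G (step u F v) a' b" using wt2_step[OF F(1) w] .
  have n1: "wt2 G (nf ?p l) a' b" "dom2 G (nf ?p l) = ?p" "cod2 G (nf ?p l) = q" using nf_wt2[OF w' F(3)] by auto
  have 1: "eq2 G a b (LW w (VC (step u F v) (nf ?p l))) (VC (LW w (step u F v)) (LW w (nf ?p l)))"
    using assms(1) st n1 by (intro lw_vc) (auto intro!: wt_vc)
  have "eq2 G a b (LW w (step u F v)) (step (w @ u) F v)"
    using flip_walk(2,3)[OF w F(1)] F(1) assms(1) by (intro eq_sym[OF lw_app]) (auto intro: wt2.intros)
  then have 2: "eq2 G a b (VC (LW w (step u F v)) (LW w (nf ?p l))) (VC (step (w @ u) F v) (nf (w @ ?p) (map (\<lambda>(u, F, v). (w @ u, F, v)) l)))"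
    using Cons.IH[OF w' F(3)] n1 by (intro eq2_VC_cong) auto
  show ?case using eq_trans[OF 1 2] Cons.IH[OF w' F(3)] F by (simp add: c)
qed

lemma nf_right_whisker:
  assumes "walk G a p b" "walk G b w b'" "chain p l q"
  shows "eq2 G a b' (RW (nf p l) w) (nf (p @ w) (map (\<lambda>(u, F, v). (u, F, v @ w)) l)) \<and>
    chain (p @ w) (map (\<lambda>(u, F, v). (u, F, v @ w)) l) (q @ w)"
  using assms(1,3)
proof (induction l arbitrary: p)
  case Nil
  then show ?case using rw_id[OF _ assms(2)] by auto
next
  case (Cons c l)
  obtain u F v where c: "c = (u, F, v)" by (cases c)
  have F: "F \<in> cells" "p = u @ cell_dom G F @ v" "chain (u @ cell_cod G F @ v) l q" using Cons.prems c by auto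
  let ?p = "u @ cell_cod G F @ v"
  have w: "walk G a (u @ cell_dom G F @ v) b" using Cons.prems F by simp
  have w': "walk G a ?p b" using flip_walk(1)[OF w F(1)] .
  have uv: "walk G a u (cell_src G F)" "walk G (cell_tgt G F) v b" using flip_walk(2,3)[OF w F(1)] .
  have st: "wt2 G (step u F v) a b" using wt2_step[OF F(1) w] .
  have n1: "wt2 G (nf ?p l) a b" "dom2 G (nf ?p l) = ?p" "cod2 G (nf ?p l) = q" using nf_wt2[OF w' F(3)] by auto
  have 1: "eq2 G a b' (RW (VC (step u F v) (nf ?p l)) w) (VC (RW (step u F v) w) (RW (nf ?p l) w))"
    using assms(2) st n1 by (intro rw_vc) (auto intro!: wt_vc)
  have 2: "eq2 G a b' (RW (step u F v) w) (LW u (RW (RW (At F) v) w))"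
    using uv F(1) assms(2) by (intro lw_rw) (auto intro: wt2.intros)
  have 3: "eq2 G a b' (LW u (RW (RW (At F) v) w)) (step u F (v @ w))"
    using uv F(1) assms(2) by (intro eq_lw[OF _ eq_sym[OF rw_app]]) (auto intro: wt2.intros)
  have 4: "eq2 G a b' (VC (RW (step u F v) w) (RW (nf ?p l) w)) (VC (step u F (v @ w)) (nf (?p @ w) (map (\<lambda>(u, F, v). (u, F, v @ w)) l)))"
    using Cons.IH[OF w' F(3)] n1 by (intro eq2_VC_cong[OF eq_trans[OF 2 3]]) auto
  show ?case using eq_trans[OF 1 4] Cons.IH[OF w' F(3)] F by (simp add: c)
qed

text \<open>Whiskerings are pushed inward until they act on single atoms, and vertical composites
  are flattened.\<close>

lemma nf_exists:
  assumes "wt2 G x a b"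
  shows "\<exists>l. chain (dom2 G x) l (cod2 G x) \<and> eq2 G a b x (nf (dom2 G x) l)"
  using assms
proof (induction rule: wt2.induct)
  case (wt_id a p b)
  then show ?case by (intro exI[of _ "[]"]) (auto intro: eq_refl wt2.intros)
next
  case (wt_at F)
  have wt: "wt2 G (At F) (cell_src G F) (cell_tgt G F)" using wt_at by (rule wt2.wt_at)
  have e: "walk G (cell_src G F) [] (cell_src G F)" "walk G (cell_tgt G F) [] (cell_tgt G F)"
    using cell_walks[OF wt_at] walk_start_in walk_end_in by auto
  have rw: "wt2 G (RW (At F) []) (cell_src G F) (cell_tgt G F)" using wt e(2) by (rule wt2.wt_rw)
  then have 1: "eq2 G (cell_src G F) (cell_tgt G F) (step [] F []) (At F)"
    by (rule eq_trans[OF lw_nil rw_nil[OF wt]])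
  have 2: "eq2 G (cell_src G F) (cell_tgt G F) (VC (step [] F []) (Id2 (cell_cod G F))) (step [] F [])"
    using vc_unitr[OF wt2.wt_lw[OF e(1) rw]] by simp
  show ?case using eq_sym[OF eq_trans[OF 2 1]] wt_at by (intro exI[of _ "[([], F, [])]"]) auto
next
  case (wt_lw a u b x c)
  then obtain l where l: "chain (dom2 G x) l (cod2 G x)" "eq2 G b c x (nf (dom2 G x) l)" by blast
  have 1: "eq2 G a c (LW u x) (LW u (nf (dom2 G x) l))" by (rule eq_lw[OF wt_lw(1) l(2)])
  have "walk G b (dom2 G x) c" using wt2_walk[OF wt_lw(2)] by simp
  note 2 = nf_left_whisker[OF wt_lw(1) this l(1)]
  show ?case using eq_trans[OF 1 conjunct1[OF 2]] conjunct2[OF 2] by auto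
next
  case (wt_rw x a b v c)
  then obtain l where l: "chain (dom2 G x) l (cod2 G x)" "eq2 G a b x (nf (dom2 G x) l)" by blast
  have 1: "eq2 G a c (RW x v) (RW (nf (dom2 G x) l) v)" by (rule eq_rw[OF l(2) wt_rw(2)])
  have "walk G a (dom2 G x) b" using wt2_walk[OF wt_rw(1)] by simp
  note 2 = nf_right_whisker[OF this wt_rw(2) l(1)]
  show ?case using eq_trans[OF 1 conjunct1[OF 2]] conjunct2[OF 2] by auto
next
  case (wt_vc x a b y)
  then obtain l l' where l: "chain (dom2 G x) l (cod2 G x)" "eq2 G a b x (nf (dom2 G x) l)"
    and l': "chain (dom2 G y) l' (cod2 G y)" "eq2 G a b y (nf (dom2 G y) l')" by blast
  have 1: "eq2 G a b (VC x y) (VC (nf (dom2 G x) l) (nf (dom2 G y) l'))"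
    by (rule eq2_VC_cong[OF l(2) l'(2) wt_vc(3)])
  have 2: "eq2 G a b (VC (nf (dom2 G x) l) (nf (dom2 G y) l')) (nf (dom2 G x) (l @ l'))"
    using nf_append[of a "dom2 G x" b l "dom2 G y" l'] wt2_walk[OF wt_vc(1)] l(1) l'(1) wt_vc(3) by auto
  show ?case using chain_append[of "dom2 G x" l "cod2 G x" l' "cod2 G y"] l(1) l'(1) wt_vc(3) eq_trans[OF 1 2] by auto
qed

text \<open>The axiom is applied to \<open>F\<close> whiskered by \<open>u\<close> and to
  \<open>F'\<close> whiskered by \<open>m\<close> and \<open>v\<close>, so the middle segment
  belongs to the second cell. The rest regroups whiskers.\<close>

lemma step_interchange:
  assumes F: "F \<in> cells" "F' \<in> cells"
    and w: "walk G a (u @ cell_dom G F @ m @ cell_dom G F' @ v) b"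
  shows "eq2 G a b
    (VC (step u F (m @ cell_dom G F' @ v)) (step (u @ cell_cod G F @ m) F' v))
    (VC (step (u @ cell_dom G F @ m) F' v) (step u F (m @ cell_cod G F' @ v)))"
proof -
  have u: "walk G a u (cell_src G F)" and r: "walk G (cell_tgt G F) (m @ cell_dom G F' @ v) b"
    using flip_walk(2,3)[OF w F(1)] .
  have m: "walk G (cell_tgt G F) m (cell_src G F')" and v: "walk G (cell_tgt G F') v b"
    using flip_walk(2,3)[OF r F(2)] .
  have r': "walk G (cell_tgt G F) (m @ cell_cod G F' @ v) b" using flip_walk(1)[OF r F(2)] .
  have at: "wt2 G (At F) (cell_src G F) (cell_tgt G F)" "wt2 G (At F') (cell_src G F') (cell_tgt G F')"
    using F by (auto intro: wt2.intros)
  let ?x = "LW u (At F)" and ?y = "LW m (RW (At F') v)"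
  have x: "wt2 G ?x a (cell_tgt G F)" using u at by (auto intro: wt2.intros)
  have y: "wt2 G ?y (cell_tgt G F) b" "wt2 G (RW (At F') v) (cell_src G F') b" using m v at by (auto intro: wt2.intros)
  have wd: "walk G a (u @ cell_dom G F) (cell_tgt G F)" "walk G a (u @ cell_cod G F) (cell_tgt G F)"
    using u cell_walks[OF F(1)] walk_app by blast+
  have 1: "eq2 G a b (VC (RW ?x (m @ cell_dom G F' @ v)) (LW (u @ cell_cod G F) ?y))
      (VC (LW (u @ cell_dom G F) ?y) (RW ?x (m @ cell_cod G F' @ v)))"
    using interchange[OF x y(1)] by simp
  have R: "eq2 G a b (RW ?x z) (step u F z)" if "walk G (cell_tgt G F) z b" for z
    using lw_rw[OF u at(1) that] .
  have Lw: "eq2 G a b (LW z ?y) (step (z @ m) F' v)" if "walk G a z (cell_tgt G F)" for z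
    using eq_sym[OF lw_app[OF that m y(2)]] .
  have 2: "eq2 G a b (VC (RW ?x (m @ cell_dom G F' @ v)) (LW (u @ cell_cod G F) ?y))
     (VC (step u F (m @ cell_dom G F' @ v)) (step (u @ cell_cod G F @ m) F' v))"
    using R[OF r] Lw[OF wd(2)] by (intro eq2_VC_cong) auto
  have 3: "eq2 G a b (VC (LW (u @ cell_dom G F) ?y) (RW ?x (m @ cell_cod G F' @ v)))
    (VC (step (u @ cell_dom G F @ m) F' v) (step u F (m @ cell_cod G F' @ v)))"
    using R[OF r'] Lw[OF wd(1)] by (intro eq2_VC_cong) auto
  show ?thesis using eq_trans[OF eq_trans[OF eq_sym[OF 2] 1] 3] .
qed

section \<open>Existence of chains and equality of their composites\<close>

lemma chain_wind:
  assumes "walk G s p t" "chain p l q" "F' \<in> cells"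
  shows "wind q F' = wind p F' + int (count_list (map (fst \<circ> snd) l) F')"
  using assms(1,2)
proof (induction l arbitrary: p)
  case (Cons c l)
  obtain u F v where c: "c = (u, F, v)" by (cases c)
  have F: "F \<in> cells" "p = u @ cell_dom G F @ v" "chain (u @ cell_cod G F @ v) l q" using Cons.prems c by auto
  have w: "walk G s (u @ cell_dom G F @ v) t" using Cons.prems F by simp
  show ?case using Cons.IH[OF flip_walk(1)[OF w F(1)] F(3)] wind_flip[OF w F(1) assms(3)] by (auto simp: c F(2))
qed simp

text \<open>Every replacement raises the total of \<open>wind\<close> by one, so chains with the
  same ends have equal length.\<close>

lemma chain_length:
  assumes "walk G s p t" "chain p l q"
  shows "int (length l) = (\<Sum>F\<in>cells. wind q F - wind p F)"
  using assms
proof (induction l arbitrary: p)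
  case (Cons c l)
  obtain u F v where c: "c = (u, F, v)" by (cases c)
  have F: "F \<in> cells" "p = u @ cell_dom G F @ v" "chain (u @ cell_cod G F @ v) l q" using Cons.prems c by auto
  have w: "walk G s (u @ cell_dom G F @ v) t" using Cons.prems F by simp
  have "(\<Sum>F'\<in>cells. wind q F' - wind p F') =
    (\<Sum>F'\<in>cells. (wind q F' - wind (u @ cell_cod G F @ v) F') + (if F' = F then 1 else 0))"
    by (intro sum.cong refl) (simp add: F(2) wind_flip[OF w F(1)])
  also have "\<dots> = int (length l) + 1"
    using Cons.IH[OF flip_walk(1)[OF w F(1)] F(3)] fin_F F(1) by (simp add: sum.distrib)
  finally show ?case by simp
qed simp

text \<open>Induction on the number of faces still to be passed. The end \<open>q\<close> is
  produced together with the chain, because for a general monotone \<open>g\<close> no path with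
  that face function is known in advance.\<close>

lemma chain_exists:
  fixes g :: "complex set \<Rightarrow> int"
  assumes "walk G s p t" and g: "\<And>F. F \<in> cells \<Longrightarrow> g F \<in> {0, 1}"
    "\<And>e. e \<in> edges G \<Longrightarrow> L e \<in> cells \<Longrightarrow> R e \<in> cells \<Longrightarrow> g (R e) \<le> g (L e)"
    and "\<And>F. F \<in> cells \<Longrightarrow> wind p F \<le> g F"
  shows "\<exists>l q. chain p l q \<and> walk G s q t \<and> (\<forall>F\<in>cells. wind q F = g F)"
  using assms(1,4)
proof (induction "nat (\<Sum>F\<in>cells. g F - wind p F)" arbitrary: p rule: less_induct)
  case less
  show ?case
  proof (cases "\<forall>F\<in>cells. wind p F = g F")
    case True
    then show ?thesis using less.prems(1) by (intro exI[of _ "[]"] exI[of _ p]) auto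
  next
    case False
    then obtain F0 where F0: "F0 \<in> cells" "wind p F0 \<noteq> g F0" by blast
    obtain F u v where F: "F \<in> cells" "wind p F = 0" "g F = 1" "p = u @ cell_dom G F @ v"
      using available_flip[OF less.prems(1) g less.prems(2) F0] by blast
    let ?p = "u @ cell_cod G F @ v"
    have w: "walk G s (u @ cell_dom G F @ v) t" using less.prems F by simp
    have w': "walk G s ?p t" using flip_walk(1)[OF w F(1)] .
    have wp: "wind ?p F' = wind p F' + (if F' = F then 1 else 0)" if "F' \<in> cells" for F'
      using wind_flip[OF w F(1) that] F(4) by simp
    have le: "wind ?p F' \<le> g F'" if "F' \<in> cells" for F'
      using wp[OF that] less.prems(2)[OF that] F by auto
    have "(\<Sum>F'\<in>cells. g F' - wind p F') = (\<Sum>F'\<in>cells. (g F' - wind ?p F') + (if F' = F then 1 else 0))"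
      by (intro sum.cong refl) (simp add: wp)
    also have "\<dots> = (\<Sum>F'\<in>cells. g F' - wind ?p F') + 1" using fin_F F(1) by (simp add: sum.distrib)
    finally have "(\<Sum>F'\<in>cells. g F' - wind p F') = (\<Sum>F'\<in>cells. g F' - wind ?p F') + 1" .
    moreover have "(\<Sum>F'\<in>cells. g F' - wind ?p F') \<ge> 0" using le by (intro sum_nonneg) simp
    ultimately have "nat (\<Sum>F'\<in>cells. g F' - wind ?p F') < nat (\<Sum>F'\<in>cells. g F' - wind p F')" by simp
    from less.hyps[OF this w' le] obtain l q where
      "chain ?p l q" "walk G s q t" "\<forall>F\<in>cells. wind q F = g F" by blast
    then show ?thesis using F by (intro exI[of _ "(u, F, v) # l"] exI[of _ q]) auto
  qed
qed

lemma chain_between: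
  assumes p: "walk G s p t" and q: "walk G s q t" and le: "\<And>F. F \<in> cells \<Longrightarrow> wind p F \<le> wind q F"
  shows "\<exists>l. chain p l q"
proof -
  obtain l r where "chain p l r" "walk G s r t" "\<forall>F\<in>cells. wind r F = wind q F"
    using chain_exists[OF p, of "wind q"] wind_01[OF q] wind_mono[OF q] le by blast
  then show ?thesis using wind_inj[OF _ q, of r] by blast
qed

lemma nf_swap:
  assumes p: "walk G s (u @ cell_dom G F @ m @ cell_dom G F' @ v) t"
    and F: "F \<in> cells" "F' \<in> cells"
    and l3: "chain (u @ cell_cod G F @ m @ cell_cod G F' @ v) l3 q"
  shows "eq2 G s t (VC (step u F (m @ cell_dom G F' @ v)) (VC (step (u @ cell_cod G F @ m) F' v) (nf (u @ cell_cod G F @ m @ cell_cod G F' @ v) l3)))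
    (VC (step (u @ cell_dom G F @ m) F' v) (VC (step u F (m @ cell_cod G F' @ v)) (nf (u @ cell_cod G F @ m @ cell_cod G F' @ v) l3)))"
    (is "eq2 G s t (VC ?a (VC ?b ?n)) (VC ?c (VC ?d ?n))")
proof -
  have w1: "walk G s (u @ cell_cod G F @ m @ cell_dom G F' @ v) t" using flip_walk(1)[OF p F(1)] .
  have w2: "walk G s (u @ cell_dom G F @ m @ cell_cod G F' @ v) t"
    using flip_walk(1)[of s "u @ cell_dom G F @ m" F' v t] p F by simp
  have w3: "walk G s (u @ cell_cod G F @ m @ cell_cod G F' @ v) t" using flip_walk(1)[OF w2 F(1)] .
  have wt: "wt2 G ?a s t" "wt2 G ?b s t" "wt2 G ?c s t" "wt2 G ?d s t"
    using wt2_step[OF F(1) p] wt2_step[OF F(2), of s "u @ cell_cod G F @ m" v t] w1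
      wt2_step[OF F(2), of s "u @ cell_dom G F @ m" v t] p wt2_step[OF F(1) w2] by auto
  have n: "wt2 G ?n s t" "dom2 G ?n = u @ cell_cod G F @ m @ cell_cod G F' @ v" using nf_wt2[OF w3 l3] by auto
  have 1: "eq2 G s t (VC ?a (VC ?b ?n)) (VC (VC ?a ?b) ?n)"
    using wt n by (intro eq_sym[OF vc_assoc]) (auto intro!: wt_vc)
  have 2: "eq2 G s t (VC (VC ?a ?b) ?n) (VC (VC ?c ?d) ?n)"
    using n by (intro eq2_VC_cong[OF step_interchange[OF F p] eq_refl]) auto
  have 3: "eq2 G s t (VC (VC ?c ?d) ?n) (VC ?c (VC ?d ?n))"
    using wt n by (intro vc_assoc) (auto intro!: wt_vc)
  show ?thesis using eq_trans[OF eq_trans[OF 1 2] 3] .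
qed

text \<open>The two chains are compared through a third: performing both first replacements leads to
  a path \<open>?r\<close> still below \<open>q\<close>, and one chain from \<open>?r\<close> to
  \<open>q\<close> completes either order. Equal lengths make the induction hypothesis applicable on
  both sides.\<close>

lemma nf_unique:
  assumes "walk G s p t" "chain p l q" "chain p l' q"
  shows "eq2 G s t (nf p l) (nf p l')"
  using assms
proof (induction "length l" arbitrary: p l l' rule: less_induct)
  case less
  note p = less.prems(1) and l = less.prems(2) and l' = less.prems(3)
  have len: "length l' = length l" using chain_length[OF p l] chain_length[OF p l'] by simp
  show ?case
  proof (cases l)
    case Nil
    then show ?thesis using len p by (auto intro!: eq_refl wt2.intros)
  next
    case (Cons c l1)
    then obtain c' l2 where l2: "l' = c' # l2" using len by (cases l') auto
    obtain u F v where c: "c = (u, F, v)" by (cases c)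
    obtain u' F' v' where c': "c' = (u', F', v')" by (cases c')
    have F: "F \<in> cells" "p = u @ cell_dom G F @ v" "chain (u @ cell_cod G F @ v) l1 q" using l Cons c by auto
    have F': "F' \<in> cells" "p = u' @ cell_dom G F' @ v'" "chain (u' @ cell_cod G F' @ v') l2 q" using l' l2 c' by auto
    have w: "walk G s (u @ cell_dom G F @ v) t" "walk G s (u' @ cell_dom G F' @ v') t" using p F(2) F'(2) by auto
    have w1: "walk G s (u @ cell_cod G F @ v) t" "walk G s (u' @ cell_cod G F' @ v') t"
      using flip_walk(1)[OF w(1) F(1)] flip_walk(1)[OF w(2) F'(1)] .
    have IH: "eq2 G s t (nf p' k) (nf p' k')" if "walk G s p' t" "chain p' k q" "chain p' k' q" "length k = length l1" for p' k k'
      using less.hyps[of k p' k'] that Cons by simp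
    have ne: "cell_dom G F \<noteq> []" "cell_dom G F' \<noteq> []" using dm_path F(1) F'(1) by (auto simp: spath_def)
    have st: "wt2 G (step u F v) s t" "wt2 G (step u' F' v') s t" using wt2_step w F(1) F'(1) by auto
    show ?thesis
    proof (cases "F = F'")
      case True
      obtain e d where d: "cell_dom G F = e # d" using ne(1) by (cases "cell_dom G F") auto
      have eq: "u @ e # (d @ v) = u' @ e # (d @ v')" using F(2) F'(2) True d by simp
      \<comment> \<open>An edge occurs only once in a walk, so the position of the domain of
        \<open>F\<close> in \<open>p\<close> is determined.\<close>
      have "distinct (u @ e # (d @ v))" using walk_distinct[OF w(1)] d by simp
      then have "e \<notin> set u" "e \<notin> set (d @ v)" by auto
      then have "u = u' \<and> d @ v = d @ v'" using eq append_Cons_eq_iff[of e u "d @ v" u' "d @ v'"] by blast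
      then have uv: "u = u'" "v = v'" by auto
      have "eq2 G s t (nf (u @ cell_cod G F @ v) l1) (nf (u @ cell_cod G F @ v) l2)"
        using IH[OF w1(1) F(3), of l2] F'(3) True uv by auto
      then have "eq2 G s t (VC (step u F v) (nf (u @ cell_cod G F @ v) l1)) (VC (step u F v) (nf (u @ cell_cod G F @ v) l2))"
        using st(1) nf_wt2[OF w1(1) F(3)] by (intro eq2_VC_cong eq_refl) auto
      then show ?thesis using Cons l2 c c' True uv by simp
    next
      case False
      have key: "eq2 G s t (VC (step u1 F1 (m @ cell_dom G F2 @ v2)) (nf (u1 @ cell_cod G F1 @ m @ cell_dom G F2 @ v2) k1))
          (VC (step (u1 @ cell_dom G F1 @ m) F2 v2) (nf (u1 @ cell_dom G F1 @ m @ cell_cod G F2 @ v2) k2))"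
        if p1: "p = u1 @ cell_dom G F1 @ m @ cell_dom G F2 @ v2" and FF: "F1 \<in> cells" "F2 \<in> cells" "F1 \<noteq> F2"
          and k1: "chain (u1 @ cell_cod G F1 @ m @ cell_dom G F2 @ v2) k1 q" "length k1 = length l1"
          and k2: "chain (u1 @ cell_dom G F1 @ m @ cell_cod G F2 @ v2) k2 q" "length k2 = length l1"
        for u1 F1 m F2 v2 k1 k2
      proof -
        let ?p1 = "u1 @ cell_cod G F1 @ m @ cell_dom G F2 @ v2" and ?p2 = "u1 @ cell_dom G F1 @ m @ cell_cod G F2 @ v2"
        let ?r = "u1 @ cell_cod G F1 @ m @ cell_cod G F2 @ v2"
        have wp: "walk G s (u1 @ cell_dom G F1 @ m @ cell_dom G F2 @ v2) t" using p p1 by simp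
        have wp': "walk G s ((u1 @ cell_dom G F1 @ m) @ cell_dom G F2 @ v2) t" using wp by simp
        have wp1: "walk G s ?p1 t" using flip_walk(1)[OF wp FF(1)] .
        have wp1': "walk G s ((u1 @ cell_cod G F1 @ m) @ cell_dom G F2 @ v2) t" using wp1 by simp
        have wp2: "walk G s ?p2 t" using flip_walk(1)[OF wp' FF(2)] by simp
        have wr: "walk G s ?r t" using flip_walk(1)[OF wp2 FF(1)] .
        have q: "walk G s q t" using chain_walk[OF p l] .
        \<comment> \<open>On \<open>F2\<close> the bound comes from the chain that starts at
          \<open>?p2\<close>, on all other faces from the one that starts at
          \<open>?p1\<close>.\<close>
        have "wind ?r X \<le> wind q X" if X: "X \<in> cells" for X
        proof -
          have "wind ?r X = wind ?p1 X + (if X = F2 then 1 else 0)" using wind_flip[OF wp1' FF(2) X] by simp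
          moreover have "wind ?p1 X \<le> wind q X" using chain_wind[OF wp1 k1(1) X] by simp
          moreover have "wind ?p2 X \<le> wind q X" using chain_wind[OF wp2 k2(1) X] by simp
          moreover have "wind ?p1 X = wind p X + (if X = F1 then 1 else 0)" using wind_flip[OF wp FF(1) X] p1 by simp
          moreover have "wind ?p2 X = wind p X + (if X = F2 then 1 else 0)" using wind_flip[OF wp' FF(2) X] p1 by simp
          ultimately show ?thesis using FF(3) by auto
        qed
        then obtain l3 where l3: "chain ?r l3 q" using chain_between[OF wr q] by blast
        have nr: "wt2 G (nf ?r l3) s t" "dom2 G (nf ?r l3) = ?r" using nf_wt2[OF wr l3] by auto
        have c1: "chain ?p1 ((u1 @ cell_cod G F1 @ m, F2, v2) # l3) q" using l3 FF by simp
        have c2: "chain ?p2 ((u1, F1, m @ cell_cod G F2 @ v2) # l3) q" using l3 FF by simp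
        have 1: "eq2 G s t (nf ?p1 k1) (VC (step (u1 @ cell_cod G F1 @ m) F2 v2) (nf ?r l3))"
          using IH[OF wp1 k1(1) c1 k1(2)] by simp
        have 2: "eq2 G s t (nf ?p2 k2) (VC (step u1 F1 (m @ cell_cod G F2 @ v2)) (nf ?r l3))"
          using IH[OF wp2 k2(1) c2 k2(2)] by simp
        have 3: "eq2 G s t (VC (step u1 F1 (m @ cell_dom G F2 @ v2)) (nf ?p1 k1))
          (VC (step u1 F1 (m @ cell_dom G F2 @ v2)) (VC (step (u1 @ cell_cod G F1 @ m) F2 v2) (nf ?r l3)))"
          using 1 wt2_step[OF FF(1) wp] nf_wt2[OF wp1 k1(1)] by (intro eq2_VC_cong eq_refl) auto
        have 4: "eq2 G s t (VC (step (u1 @ cell_dom G F1 @ m) F2 v2) (nf ?p2 k2))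
          (VC (step (u1 @ cell_dom G F1 @ m) F2 v2) (VC (step u1 F1 (m @ cell_cod G F2 @ v2)) (nf ?r l3)))"
          using 2 wt2_step[OF FF(2) wp'] nf_wt2[OF wp2 k2(1)] by (intro eq2_VC_cong eq_refl) auto
        show ?thesis using eq_trans[OF eq_trans[OF 3 nf_swap[OF wp FF(1,2) l3]] eq_sym[OF 4]] .
      qed
      \<comment> \<open>An edge has a single face on its right, so domains of distinct faces share
        no edge.\<close>
      have "set (cell_dom G F) \<inter> set (cell_dom G F') = {}" using set_dm[OF F(1)] set_dm[OF F'(1)] False by auto
      then show ?thesis
      proof (rule disjoint_segments_split[OF trans[OF F(2)[symmetric] F'(2)] _ ne])
        fix m assume m: "u' = u @ cell_dom G F @ m" "v = m @ cell_dom G F' @ v'"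
        show ?thesis
          using key[of u F m F' v' l1 l2] F F' False m Cons l2 c c' len by simp
      next
        fix m assume m: "u = u' @ cell_dom G F' @ m" "v' = m @ cell_dom G F @ v"
        show ?thesis
          using eq_sym[OF key[of u' F' m F v l2 l1]] F F' False m Cons l2 c c' len by simp
      qed
    qed
  qed
qed

lemma hom2_unique:
  assumes "x \<in> hom2 G s t p q" "y \<in> hom2 G s t p q"
  shows "eq2 G s t x y"
proof -
  have x: "wt2 G x s t" "dom2 G x = p" "cod2 G x = q" and y: "wt2 G y s t" "dom2 G y = p" "cod2 G y = q"
    using assms by (auto simp: hom2_def)
  have p: "walk G s p t" using wt2_walk[OF x(1)] x by auto
  obtain l where l: "chain p l q" "eq2 G s t x (nf p l)" using nf_exists[OF x(1)] x by auto
  obtain l' where l': "chain p l' q" "eq2 G s t y (nf p l')" using nf_exists[OF y(1)] y by auto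
  show ?thesis using eq_trans[OF eq_trans[OF l(2) nf_unique[OF p l(1) l'(1)]] eq_sym[OF l'(2)]] .
qed

lemma hom2_nonempty_iff:
  assumes p: "walk G s p t" and q: "walk G s q t"
  shows "hom2 G s t p q \<noteq> {} \<longleftrightarrow> (\<forall>F\<in>cells. wind p F \<le> wind q F)"
proof
  assume "hom2 G s t p q \<noteq> {}"
  then obtain x where "x \<in> hom2 G s t p q" by blast
  then show "\<forall>F\<in>cells. wind p F \<le> wind q F" using hom2_wind by auto
next
  assume "\<forall>F\<in>cells. wind p F \<le> wind q F"
  then obtain l where l: "chain p l q" using chain_between[OF p q] by blast
  then have "nf p l \<in> hom2 G s t p q" using nf_wt2[OF p l] by (auto simp: hom2_def)
  then show "hom2 G s t p q \<noteq> {}" by blast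
qed

end

section \<open>Faces as closures of regions\<close>

lemma walk_src_prefix: "walk G a (p @ e # q) b \<Longrightarrow> src G e \<in> insert a (tgt G ` set p)"
  by (induction p arbitrary: a) auto

lemma spath_no_loop:
  assumes "spath G a p b" "e \<in> set p"
  shows "src G e \<noteq> tgt G e"
proof -
  obtain p1 p2 where p: "p = p1 @ e # p2" using assms(2) by (meson split_list)
  then have "src G e \<in> insert a (tgt G ` set p1)" using assms(1) walk_src_prefix unfolding spath_def by metis
  moreover have "distinct (a # map (tgt G) (p1 @ e # p2))" using assms(1) p by (simp add: spath_def pverts_def)
  then have "tgt G e \<notin> insert a (tgt G ` set p1)" by auto
  ultimately show ?thesis by metis
qed

text \<open>The descriptions defining \<open>cell_dom\<close> and its companions need uniqueness
  before acyclicity is available. Absence of repeated vertices replaces it: only the first edge of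
  such a walk leaves \<open>a\<close>.\<close>

lemma simple_walk_determined:
  assumes "walk G a p b" "walk G a q b'" "distinct (pverts G a p)" "distinct (pverts G a q)" "set p = set q"
  shows "p = q"
  using assms
proof (induction p arbitrary: a q)
  case Nil
  then show ?case by simp
next
  case (Cons e p)
  then obtain f q' where q: "q = f # q'" by (cases q) auto
  have nin: "g \<notin> set r" if "walk G (tgt G g') r c" "a \<notin> tgt G ` set (g' # r)" "src G g = a" for g g' r c
    using walk_src_cases[OF that(1), of g] that(2,3) by auto
  have e: "e \<notin> set p" using nin[of e p b e] Cons.prems by (auto simp: pverts_def)
  have f: "e \<notin> set q'" "f \<notin> set q'"
    using nin[of f q' b' e] nin[of f q' b' f] Cons.prems q by (auto simp: pverts_def)
  then have "e = f" using Cons.prems(5) q by (metis list.set_intros(1) set_ConsD)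
  moreover have "set p = set q'" using Cons.prems(5) q e f calculation by (metis insert_ident list.simps(15))
  ultimately show ?case using Cons q by (auto simp: pverts_def)
qed

text \<open>The start of a simple path is the only source among its edges that is not also a target,
  so the edge set determines the start and then the path.\<close>

lemma spath_determined:
  assumes p: "spath G a p b" and q: "spath G a' q b'" and eq: "set p = set q"
  shows "a = a' \<and> p = q \<and> b = b'"
proof -
  have w: "walk G a p b" "walk G a' q b'" "distinct (pverts G a p)" "distinct (pverts G a' q)" "p \<noteq> []"
    using p q by (auto simp: spath_def)
  obtain e p' where "p = e # p'" using w(5) by (cases p) auto
  then have e: "src G e = a" "e \<in> set q" using w(1) eq by auto
  have "a \<notin> tgt G ` set q" using w(3) unfolding eq[symmetric] by (auto simp: pverts_def)
  then have "a = a'" using walk_src_cases[OF w(2) e(2)] e(1) by auto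
  moreover have "p = q" using simple_walk_determined[OF w(1) _ w(3)] w(2,4) eq calculation by blast
  ultimately show ?thesis using w walk_end_unique by metis
qed

lemma face_anchored_unique:
  assumes "face_anchored G F s t d c" "face_anchored G F s' t' d' c'"
  shows "s = s' \<and> t = t' \<and> d = d' \<and> c = c'"
  using assms spath_determined[of G s d t s' d' t'] spath_determined[of G s c t s' c' t']
  by (simp add: face_anchored_def)

lemma face_anchored_cell:
  assumes "face_anchored G F s t d c"
  shows "face_anchored G F (cell_src G F) (cell_tgt G F) (cell_dom G F) (cell_cod G F)"
proof -
  have "cell_src G F = s" "cell_tgt G F = t" "cell_dom G F = d" "cell_cod G F = c"
    unfolding cell_src_def cell_tgt_def cell_dom_def cell_cod_def
    using assms face_anchored_unique[OF assms] by (blast intro: the_equality)+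
  then show ?thesis using assms by simp
qed

lemma ext_dom_eq:
  assumes "ext_anchored G s t d c"
  shows "ext_dom G = d"
  unfolding ext_dom_def
proof (rule the_equality)
  fix d' assume "\<exists>s t c. ext_anchored G s t d' c"
  then obtain s' t' c' where "ext_anchored G s' t' d' c'" by blast
  then show "d' = d" using assms spath_determined[of G s' d' t' s d t] by (simp add: ext_anchored_def)
qed (use assms in blast)

lemma swind_append: "swind G (l @ l') w = swind G l w + swind G l' w"
  by (simp add: swind_def)

lemma swind_srev: "swind G (srev l) w = - swind G l w"
  by (induction l) (auto simp: swind_def srev_def sgnb_def)

lemma pcurve_eq_scurve: "pcurve G a p = scurve G a (map (\<lambda>e. (e, True)) p)"
  by (induction p arbitrary: a) auto

lemma pasting_scheme_loopless:
  assumes "pasting_scheme G s t"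
  shows "loopless_plane_graph G"
proof
  show "plane_graph G" using assms by (simp add: pasting_scheme_def)
  then interpret embedded_graph G by unfold_locales
  fix e assume e: "e \<in> edges G"
  show "src G e \<noteq> tgt G e"
  proof
    assume loop: "src G e = tgt G e"
    obtain Q where Q: "Q \<in> regions G" "bounded Q" "side_region G 1 e Q \<or> side_region G (-1) e Q"
      using loop_edge_has_bounded_side[OF e loop] .
    then have F: "closure Q \<in> interior_faces G" "left_of G e (closure Q) \<or> right_of G e (closure Q)"
      by (auto simp: interior_faces_def left_of_def right_of_def)
    then obtain sF tF d c where "face_anchored G (closure Q) sF tF d c"
      using assms by (auto simp: pasting_scheme_def)
    then have "spath G sF d tF" "spath G sF c tF" "e \<in> set d \<or> e \<in> set c"
      using F(2) e by (auto simp: face_anchored_def)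
    then show False using spath_no_loop loop by metis
  qed
qed

context loopless_plane_graph
begin

definition lface :: "'e \<Rightarrow> complex set" where "lface e = closure (lreg e)"
definition rface :: "'e \<Rightarrow> complex set" where "rface e = closure (rreg e)"

text \<open>Winding numbers are defined on regions, whereas the cells are closed faces; this
  translates back.\<close>

definition face_region :: "complex set \<Rightarrow> complex set" where
  "face_region = the_inv_into (regions G) closure"

lemma face_region_closure: "Q \<in> regions G \<Longrightarrow> face_region (closure Q) = Q"
  unfolding face_region_def using closure_region_inj by (intro the_inv_into_f_f) (auto simp: inj_on_def)

lemma ext_face_notin: "ext_face G \<notin> interior_faces G"
  unfolding ext_face_eq interior_faces_eq using closure_region_inj ext_region(1) by blast

lemma closure_in_faces: "Q \<in> regions G \<Longrightarrow> closure Q \<in> insert (ext_face G) (interior_faces G)"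
  unfolding ext_face_eq interior_faces_eq by blast

lemma closed_swalk_face_winding:
  assumes "swalk G a l a"
  obtains n :: "complex set \<Rightarrow> int" where "n (ext_face G) = 0"
    "\<And>e. e \<in> edges G \<Longrightarrow> n (lface e) - n (rface e) = ecount l e"
    "\<And>Q w. Q \<in> regions G \<Longrightarrow> w \<in> Q \<Longrightarrow> swind G l w = of_int (n (closure Q))"
proof (rule closed_swalk_winding[OF assms])
  fix n :: "complex set \<Rightarrow> int"
  assume n: "n ext_region = 0" "\<And>e. e \<in> edges G \<Longrightarrow> n (lreg e) - n (rreg e) = ecount l e"
    "\<And>Q w. Q \<in> regions G \<Longrightarrow> w \<in> Q \<Longrightarrow> swind G l w = of_int (n Q)"
  show thesis
  proof (rule that[of "n \<circ> face_region"])
    show "(n \<circ> face_region) (ext_face G) = 0"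
      using n(1) face_region_closure[OF ext_region(1)] by (simp add: ext_face_eq)
    show "(n \<circ> face_region) (lface e) - (n \<circ> face_region) (rface e) = ecount l e" if "e \<in> edges G" for e
      using n(2)[OF that] lreg_in[OF that] rreg_in[OF that] by (simp add: lface_def rface_def face_region_closure)
    show "swind G l w = of_int ((n \<circ> face_region) (closure Q))" if "Q \<in> regions G" "w \<in> Q" for Q w
      using n(3)[OF that] that(1) by (simp add: face_region_closure)
  qed
qed

lemma pasting_cells:
  assumes ps: "pasting_scheme G s t" and ext: "ext_anchored G s t d c"
  shows "pasting_cells G s t (ext_face G) lface rface d c"
proof
  have anch: "face_anchored G F (cell_src G F) (cell_tgt G F) (cell_dom G F) (cell_cod G F)"
    if "F \<in> interior_faces G" for F
    using ps that face_anchored_cell unfolding pasting_scheme_def by metis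
  show "finite (verts G)" "finite (edges G)" by (rule finite_verts finite_edges)+
  show "src G e \<in> verts G" "tgt G e \<in> verts G" if "e \<in> edges G" for e using that src_in tgt_in by auto
  show "(u, v) \<in> (uedge G)\<^sup>*" if "u \<in> verts G" "v \<in> verts G" for u v using that verts_connected by blast
  show "ext_face G \<notin> interior_faces G" by (rule ext_face_notin)
  show "lface e \<in> insert (ext_face G) (interior_faces G)" "rface e \<in> insert (ext_face G) (interior_faces G)"
    if "e \<in> edges G" for e
    using closure_in_faces lreg_in[OF that] rreg_in[OF that] by (auto simp: lface_def rface_def)
  show "spath G (cell_src G F) (cell_dom G F) (cell_tgt G F)" "spath G (cell_src G F) (cell_cod G F) (cell_tgt G F)"
    "set (cell_dom G F) = {e \<in> edges G. rface e = F}" "set (cell_cod G F) = {e \<in> edges G. lface e = F}"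
    if "F \<in> interior_faces G" for F
    using anch[OF that] left_of_iff right_of_iff by (auto simp: face_anchored_def lface_def rface_def)
  show "spath G s d t" "spath G s c t" "set d = {e \<in> edges G. lface e = ext_face G}" "set c = {e \<in> edges G. rface e = ext_face G}"
    using ext left_of_iff right_of_iff by (auto simp: ext_anchored_def lface_def rface_def)
  show "\<exists>e\<in>edges G. src G e = v" if "v \<in> verts G" "v \<noteq> t" for v using that ps by (auto simp: pasting_scheme_def)
  show "\<exists>e\<in>edges G. tgt G e = v" if "v \<in> verts G" "v \<noteq> s" for v using that ps by (auto simp: pasting_scheme_def)
  show "\<exists>n :: complex set \<Rightarrow> int. n (ext_face G) = 0 \<and> (\<forall>e\<in>edges G. n (lface e) - n (rface e) = ecount l e)"
    if "swalk G a l a" for a l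
    using closed_swalk_face_winding[OF that] by metis
  show "\<exists>e\<in>edges G. (lface e \<in> A) \<noteq> (rface e \<in> A)" if A: "A \<subseteq> interior_faces G" "A \<noteq> {}" for A
  proof (rule ccontr)
    assume "\<not> ?thesis"
    then have bal: "lface e \<in> A \<longleftrightarrow> rface e \<in> A" if "e \<in> edges G" for e using that by blast
    \<comment> \<open>The preimage of \<open>A\<close> under closure would contain both sides of
      every edge or neither, hence all regions, the exterior one included.\<close>
    let ?A = "{Q \<in> regions G. closure Q \<in> A}"
    have "?A = regions G"
    proof (rule regions_dual_connected)
      show "?A \<noteq> {}" using A by (auto simp: interior_faces_eq)
      show "lreg e \<in> ?A \<longleftrightarrow> rreg e \<in> ?A" if "e \<in> edges G" for e
        using bal[OF that] lreg_in[OF that] rreg_in[OF that] by (auto simp: lface_def rface_def)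
    qed auto
    then have "ext_face G \<in> A" using ext_region(1) by (auto simp: ext_face_eq)
    then show False using A(1) ext_face_notin by blast
  qed
qed

text \<open>The geometric winding number and \<open>wind\<close> have the same jumps and vanish on
  the exterior, so they agree on bounded faces. The former is constant on each region, so a single
  point \<open>w\<close> decides.\<close>

lemma above_iff_wind:
  assumes ps: "pasting_scheme G s t" and ext: "ext_anchored G s t d c"
    and p: "walk G s p t" and F: "F \<in> interior_faces G"
  shows "above G s p F \<longleftrightarrow> anchored_graph.wind G (ext_face G) lface rface d p F \<noteq> 0"
proof -
  interpret pasting_cells G s t "ext_face G" lface rface d c by (rule pasting_cells[OF ps ext])
  let ?l = "map (\<lambda>e. (e, True)) p @ srev (map (\<lambda>e. (e, True)) d)"
  have sp: "swalk G s (map (\<lambda>e. (e, True)) p) t" using walk_imp_swalk[OF p] .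
  have sd: "swalk G s (map (\<lambda>e. (e, True)) d) t" using walk_imp_swalk[OF D_walk] .
  have l: "swalk G s ?l s" using swalk_append[OF sp swalk_srev[OF sd]] .
  show ?thesis
  proof (rule closed_swalk_face_winding[OF l])
    fix n :: "complex set \<Rightarrow> int"
    assume n: "n (ext_face G) = 0" "\<And>e. e \<in> edges G \<Longrightarrow> n (lface e) - n (rface e) = ecount ?l e"
      "\<And>Q w. Q \<in> regions G \<Longrightarrow> w \<in> Q \<Longrightarrow> swind G ?l w = of_int (n (closure Q))"
    have wn: "wind p F = n F" using wind_unique[of p n F] p F n(1,2) by (simp add: ecount_walk_srev)
    have "winding_number (pcurve G s p +++ reversepath (pcurve G s d)) w = of_int (n (closure Q))"
      if Q: "Q \<in> regions G" "w \<in> Q" for Q w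
    proof -
      note P = scurve_props[OF sp] and DD = scurve_props[OF sd]
      have wg: "w \<notin> gset G" using region_subset Q by blast
      then have "w \<notin> path_image (scurve G s (map (\<lambda>e. (e, True)) p))" "w \<notin> path_image (scurve G s (map (\<lambda>e. (e, True)) d))"
        using P(4) DD(4) by blast+
      then have "winding_number (pcurve G s p +++ reversepath (pcurve G s d)) w = swind G ?l w"
        unfolding pcurve_eq_scurve using P(1-3) DD(1-3) P(5)[OF wg] DD(5)[OF wg]
        by (simp add: winding_number_join winding_number_reversepath swind_append swind_srev)
      then show ?thesis using n(3)[OF Q] by simp
    qed
    moreover obtain Q where Q: "Q \<in> regions G" "closure Q = F" using F by (auto simp: interior_faces_eq)
    moreover obtain w where "w \<in> Q" using region_nonempty Q by blast
    ultimately show ?thesis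
      unfolding above_def ext_dom_eq[OF ext] wn by auto
  qed
qed

end

text \<open>An isomorphism of the hom-category with the poset amounts to a bijection on objects for
  which arrows exist exactly along the order and parallel arrows are equal.\<close>

theorem mainTheorem3:
  fixes G :: "('v,'e) pgraph" and s t :: 'v
  assumes "pasting_scheme G s t"
  shows "bij_betw (chi G s) {p. walk G s p t} (Pge G) \<and>
         (\<forall>p q. walk G s p t \<longrightarrow> walk G s q t \<longrightarrow>
            (hom2 G s t p q \<noteq> {} \<longleftrightarrow> (\<forall>F\<in>interior_faces G. chi G s p F \<le> chi G s q F)) \<and>
            (\<forall>x\<in>hom2 G s t p q. \<forall>y\<in>hom2 G s t p q. eq2 G s t x y))"
proof -
  interpret loopless_plane_graph G by (rule pasting_scheme_loopless[OF assms])
  obtain d c where ext: "ext_anchored G s t d c" using assms by (auto simp: pasting_scheme_def)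
  interpret pasting_cells G s t "ext_face G" lface rface d c by (rule pasting_cells[OF assms ext])
  \<comment> \<open>\<open>above\<close> asks for a nonzero winding number; since the values are 0
    and 1 this means the value 1.\<close>
  have chi: "int (chi G s p F) = wind p F" if "walk G s p t" "F \<in> interior_faces G" for p F
    using above_iff_wind[OF assms ext that] wind_01[OF that] that(2) by (auto simp: chi_def)
  have chi_out: "chi G s p F = 0" if "F \<notin> interior_faces G" for p F using that by (simp add: chi_def)
  have "bij_betw (chi G s) {p. walk G s p t} (Pge G)"
    unfolding bij_betw_def
  proof
    show "inj_on (chi G s) {p. walk G s p t}"
    proof (rule inj_onI)
      fix p q assume "p \<in> {p. walk G s p t}" "q \<in> {p. walk G s p t}" "chi G s p = chi G s q"
      then show "p = q" using chi wind_inj[of p q] by (metis mem_Collect_eq)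
    qed
    show "chi G s ` {p. walk G s p t} = Pge G"
    proof
      show "chi G s ` {p. walk G s p t} \<subseteq> Pge G"
      proof clarify
        fix p assume p: "walk G s p t"
        have "chi G s p \<beta> \<le> chi G s p \<alpha>" if ab: "\<alpha> \<in> interior_faces G" "\<beta> \<in> interior_faces G" "directly_above G \<alpha> \<beta>" for \<alpha> \<beta>
        proof -
          obtain e where e: "e \<in> edges G" "lface e = \<alpha>" "rface e = \<beta>"
            using ab set_cd[OF ab(1)] set_dm[OF ab(2)] by (auto simp: directly_above_def)
          then have "wind p \<beta> \<le> wind p \<alpha>" using wind_mono[OF p e(1)] ab(1) by simp
          then show ?thesis using chi[OF p ab(1)] chi[OF p ab(2)] by simp
        qed
        moreover have "chi G s p F \<in> {0, 1}" for F by (simp add: chi_def)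
        ultimately show "chi G s p \<in> Pge G" using chi_out by (simp add: Pge_def)
      qed
      show "Pge G \<subseteq> chi G s ` {p. walk G s p t}"
      proof
        fix f assume f: "f \<in> Pge G"
        have 1: "int (f F) \<in> {0, 1}" if "F \<in> interior_faces G" for F using f that by (auto simp: Pge_def)
        have 2: "int (f (rface e)) \<le> int (f (lface e))"
          if e: "e \<in> edges G" "lface e \<in> interior_faces G" "rface e \<in> interior_faces G" for e
        proof -
          have "e \<in> set (cell_cod G (lface e)) \<inter> set (cell_dom G (rface e))"
            using set_cd[OF e(2)] set_dm[OF e(3)] e(1) by simp
          then have "directly_above G (lface e) (rface e)" unfolding directly_above_def by blast
          then show ?thesis using f e by (auto simp: Pge_def)
        qed
        \<comment> \<open>The source path of the scheme is the least path, from which every element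
          \<open>f\<close> can be reached by a chain.\<close>
        have 3: "wind d F \<le> int (f F)" if "F \<in> interior_faces G" for F using wind_D[OF that] by simp
        obtain q where q: "walk G s q t" "\<forall>F\<in>interior_faces G. wind q F = int (f F)"
          using chain_exists[OF D_walk, of "\<lambda>F. int (f F)"] 1 2 3 by blast
        have "chi G s q F = f F" for F
        proof (cases "F \<in> interior_faces G")
          case True
          then show ?thesis using chi[OF q(1) True] q(2) by simp
        next
          case False
          then show ?thesis using chi_out f by (simp add: Pge_def)
        qed
        then have "f = chi G s q" by auto
        then show "f \<in> chi G s ` {p. walk G s p t}" using q(1) by blast
      qed
    qed
  qed
  moreover have "hom2 G s t p q \<noteq> {} \<longleftrightarrow> (\<forall>F\<in>interior_faces G. chi G s p F \<le> chi G s q F)"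
    if "walk G s p t" "walk G s q t" for p q
    unfolding hom2_nonempty_iff[OF that] using chi[OF that(1)] chi[OF that(2)] by (metis of_nat_le_iff)
  ultimately show ?thesis using hom2_unique by blast
qed

end
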